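(* Poisson point processes are finitary factors of Brownian motions reflected on bounded regions. That is, for every bounded interval $[a,b]\subset\mathbb{R}$ with $a<b$ and every $\lambda>0$, there is a finitary factor map from the flow associated with a stationary Brownian motion reflected on $[a,b]$ to the flow associated with a Poisson point process on $\mathbb{R}$ of intensity $\lambda$.
   Context: **Reflected Brownian motion.** For $h>0$, let $W=(W_s)_{s\in\mathbb{R}}$ be a (two-sided) Brownian motion with variance parameter $\sigma^2=1$, where $W_0$ is a real-valued random variable. The Brownian motion reflected on $[0,h]$ is $B_s:=|W_s-2nh|$, where $n=n(s)\in\mathbb{Z}$ is chosen so that $|W_s-2nh|\le h$; it is stationary if and only if $B_0$ is uniformly distributed on $[0,h]$. Brownian motion reflected on an arbitrary interval $[a,b]$ is defined in a similar way (shift by $a$ a Brownian motion reflected on $[0,b-a]$). **Associated flows.** Let $T=(T_t)_{t\in\mathbb{R}}$ be the group of translations of $\mathbb{R}$. It acts on the space $C(\mathbb{R},[a,b])$ of continuous functions by $T_t(f)=f\circ T_{-t}$, and on the space $\mathbb{M}$ of simple Borel point measures on $\mathbb{R}$ (countable sums of Dirac masses without multiplicity) by $T_t(\mu)=\mu\circ T_{-t}$. The flow associated with a stationary reflected Brownian motion $B$ on $[a,b]$ is $(C(\mathbb{R},[a,b]),\mathbb{P}(B\in\cdot),T)$; the flow associated with a Poisson point process $\Pi$ is $(\mathbb{M},\mathbb{P}(\Pi\in\cdot),T)$. **Factors.** For measure-preserving flows $(K,\kappa,T)$ and $(K',\kappa',T')$, a (measurable) map $\phi:K\to K'$ is a factor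 if, on a set of full measure, $\phi\circ T_s=T'_s\circ\phi$ for all $s\in\mathbb{R}$, and $\kappa'=\kappa\circ\phi^{-1}$. **Finitary.** A factor $\phi:C(\mathbb{R},[a,b])\to\mathbb{M}$ is finitary if there is a measurable function $w:C(\mathbb{R},[a,b])\to\mathbb{N}\cup\{\infty\}$ with $w(B)<\infty$ almost surely, such that $\phi(f)|_{(0,1)}=\phi(f')|_{(0,1)}$ whenever $f$ and $f'$ agree on $(-w(f),w(f))$ (have the same restriction to this interval). For a point measure $\mu$ and $I\subset\mathbb{R}$, $\mu|_I(\cdot)=\mu(\cdot\cap I)$. *)

theory Defs
  imports "HOL-Probability.Probability"
begin

text \<open>
  Two-sided Brownian motion with variance parameter 1 and arbitrary initial value. The family
  in the last conjunct lists the initial value \<open>W 0\<close> (index 0) followed by consecutive increments,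
  so the condition says both that increments are independent and that \<open>W 0\<close> is independent of the
  increment process \<open>(W s - W 0)\<close>.
\<close>

definition two_sided_brownian_motion :: "'a measure \<Rightarrow> (real \<Rightarrow> 'a \<Rightarrow> real) \<Rightarrow> bool" where
  "two_sided_brownian_motion M W \<longleftrightarrow>
     prob_space M \<and>
     (\<forall>s. W s \<in> borel_measurable M) \<and>
     (\<forall>\<omega>\<in>space M. continuous_on UNIV (\<lambda>s. W s \<omega>)) \<and>
     (\<forall>s t. s < t \<longrightarrow>
        distributed M lborel (\<lambda>\<omega>. W t \<omega> - W s \<omega>) (\<lambda>x. ennreal (normal_density 0 (sqrt (t - s)) x))) \<and>
     (\<forall>(n::nat) (s :: nat \<Rightarrow> real). (\<forall>i<n. s i < s (Suc i)) \<longrightarrow>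
        prob_space.indep_vars M (\<lambda>_. borel)
          (\<lambda>i \<omega>. case i of 0 \<Rightarrow> W 0 \<omega> | Suc j \<Rightarrow> W (s (Suc j)) \<omega> - W (s j) \<omega>) {0..n})"

text \<open>
  For \<open>h > 0\<close> a suitable \<open>n\<close> exists, and it is unique unless \<open>x\<close> is an odd multiple of \<open>h\<close>, in
  which case both choices give the value \<open>h\<close>.
\<close>

definition reflect :: "real \<Rightarrow> real \<Rightarrow> real" where
  "reflect h x = \<bar>x - 2 * of_int (SOME n::int. \<bar>x - 2 * of_int n * h\<bar> \<le> h) * h\<bar>"

definition reflected_brownian_motion ::
    "real \<Rightarrow> real \<Rightarrow> 'a measure \<Rightarrow> (real \<Rightarrow> 'a \<Rightarrow> real) \<Rightarrow> bool" where
  "reflected_brownian_motion a b M B \<longleftrightarrow>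
     (\<exists>W. two_sided_brownian_motion M W \<and>
          (\<forall>s. \<forall>\<omega>\<in>space M. B s \<omega> = a + reflect (b - a) (W s \<omega>)))"

definition stationary_process :: "'a measure \<Rightarrow> (real \<Rightarrow> 'a \<Rightarrow> real) \<Rightarrow> bool" where
  "stationary_process M X \<longleftrightarrow>
     (\<forall>t. distr M (\<Pi>\<^sub>M s\<in>UNIV. borel) (\<lambda>\<omega> s. X (s + t) \<omega>) =
          distr M (\<Pi>\<^sub>M s\<in>UNIV. borel) (\<lambda>\<omega> s. X s \<omega>))"

text \<open>
  The measurable space \<open>C(\<real>, [a, b])\<close>. The trace of the product sigma-algebra is the Borel
  sigma-algebra of locally uniform convergence.
\<close>

definition path_space :: "real \<Rightarrow> real \<Rightarrow> (real \<Rightarrow> real) measure" where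
  "path_space a b =
     restrict_space (\<Pi>\<^sub>M s\<in>UNIV. borel) {f. continuous_on UNIV f \<and> range f \<subseteq> {a..b}}"

definition path_law :: "real \<Rightarrow> real \<Rightarrow> 'a measure \<Rightarrow> (real \<Rightarrow> 'a \<Rightarrow> real) \<Rightarrow> (real \<Rightarrow> real) measure" where
  "path_law a b M B = distr M (path_space a b) (\<lambda>\<omega> s. B s \<omega>)"

definition path_shift :: "real \<Rightarrow> (real \<Rightarrow> real) \<Rightarrow> real \<Rightarrow> real" where
  "path_shift t f = (\<lambda>x. f (x - t))"

definition simple_point_measure :: "real measure \<Rightarrow> bool" where
  "simple_point_measure \<mu> \<longleftrightarrow>
     sets \<mu> = sets borel \<and>
     (\<exists>S. countable S \<and>
          (\<forall>A\<in>sets borel. emeasure \<mu> A = (\<integral>\<^sup>+ x. emeasure (return borel x) A \<partial>count_space S)))"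

text \<open>The sigma-algebra is generated by the evaluations \<open>\<mu> \<mapsto> \<mu>(A)\<close> for Borel sets \<open>A\<close>.\<close>

definition point_measure_space :: "real measure measure" where
  "point_measure_space =
     sigma {\<mu>. simple_point_measure \<mu>}
       {{\<mu>. simple_point_measure \<mu> \<and> emeasure \<mu> A \<in> U} | A U. A \<in> sets borel \<and> U \<in> sets borel}"

text \<open>The push-forward under \<open>x \<mapsto> x + t\<close>, that is, \<open>A \<mapsto> \<mu>(A - t)\<close>.\<close>

definition point_shift :: "real \<Rightarrow> real measure \<Rightarrow> real measure" where
  "point_shift t \<mu> = distr \<mu> borel (\<lambda>x. x + t)"

text \<open>
  The Poisson probabilities are written out because \<^term>\<open>poisson_pmf\<close> does not cover rate 0,
  which occurs for Lebesgue null sets.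
\<close>

definition poisson_point_process :: "real \<Rightarrow> 'b measure \<Rightarrow> ('b \<Rightarrow> real measure) \<Rightarrow> bool" where
  "poisson_point_process l N P \<longleftrightarrow>
     prob_space N \<and>
     P \<in> N \<rightarrow>\<^sub>M point_measure_space \<and>
     (\<forall>A\<in>sets borel. emeasure lborel A < \<infinity> \<longrightarrow>
        (\<forall>k::nat. measure N {\<omega>\<in>space N. emeasure (P \<omega>) A = of_nat k} =
            (l * measure lborel A) ^ k / fact k * exp (- (l * measure lborel A)))) \<and>
     (\<forall>(n::nat) (A :: nat \<Rightarrow> real set).
        (\<forall>i<n. A i \<in> sets borel) \<and> disjoint_family_on A {..<n} \<longrightarrow>
        prob_space.indep_vars N (\<lambda>_. borel) (\<lambda>i \<omega>. emeasure (P \<omega>) (A i)) {..<n})"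

definition mp_flow :: "'k measure \<Rightarrow> (real \<Rightarrow> 'k \<Rightarrow> 'k) \<Rightarrow> bool" where
  "mp_flow K T \<longleftrightarrow>
     prob_space K \<and>
     (\<forall>t. T t \<in> K \<rightarrow>\<^sub>M K \<and> distr K K (T t) = K) \<and>
     (\<forall>x\<in>space K. T 0 x = x \<and> (\<forall>s t. T (s + t) x = T s (T t x)))"

definition factor_map ::
    "'k measure \<Rightarrow> (real \<Rightarrow> 'k \<Rightarrow> 'k) \<Rightarrow> 'l measure \<Rightarrow> (real \<Rightarrow> 'l \<Rightarrow> 'l) \<Rightarrow> ('k \<Rightarrow> 'l) \<Rightarrow> bool" where
  "factor_map K T K' T' \<phi> \<longleftrightarrow>
     mp_flow K T \<and> mp_flow K' T' \<and>
     \<phi> \<in> K \<rightarrow>\<^sub>M K' \<and>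
     (AE x in K. \<forall>s. \<phi> (T s x) = T' s (\<phi> x)) \<and>
     distr K K' \<phi> = K'"

text \<open>
  \<open>K\<close> is the law on a path space. The restriction of a measure \<open>\<mu>\<close> to \<open>I\<close> in the sense of
  \<open>A \<mapsto> \<mu>(A \<inter> I)\<close>, still as a measure on the whole line, is \<open>density \<mu> (indicator I)\<close>.
\<close>

definition finitary :: "(real \<Rightarrow> real) measure \<Rightarrow> ((real \<Rightarrow> real) \<Rightarrow> real measure) \<Rightarrow> bool" where
  "finitary K \<phi> \<longleftrightarrow>
     (\<exists>w :: (real \<Rightarrow> real) \<Rightarrow> enat.
        w \<in> K \<rightarrow>\<^sub>M count_space UNIV \<and>
        (AE f in K. w f < \<infinity>) \<and>
        (\<forall>f\<in>space K. \<forall>f'\<in>space K.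
           (\<forall>x. ereal \<bar>x\<bar> < ereal_of_enat (w f) \<longrightarrow> f x = f' x) \<longrightarrow>
           density (\<phi> f) (indicator {0<..<1}) = density (\<phi> f') (indicator {0<..<1})))"

end

theory Submission
  imports Defs
begin

text \<open>
  Let \<open>m\<close> be the midpoint of \<open>[a, b]\<close>. The path splits into its distance to \<open>m\<close> and the signs of
  its excursions away from \<open>m\<close>, and the reason why the theorem is true is that, given the
  distance, the signs are independent fair coins (\<open>signs_are_fair_coins\<close>). Everything that depends
  on the distance alone can serve as a scaffold on the line, and the signs supply randomness
  that is independent of the scaffold.

  The scaffold consists of the renewals, the times at which excursions of height more than a quarter
  of \<open>b - a\<close> end. Almost surely they are locally finite and unbounded to the left, and infinitely many
  small excursions accumulate at each of them from the right. The signs of these excursions are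
  decoded into independent uniform variables, which put a Poisson number of uniform points
  into each unit cell after the renewal, up to the next renewal. Given the scaffold, a Borel set \<open>A\<close> receives no
  point with probability \<open>exp (- l * |A|)\<close>, the product of the void probabilities of the cells
  (\<open>all_cells_void_probability\<close>, \<open>cell_target_measure_sums\<close>). This number does not depend
  on the scaffold, and void probabilities determine the law of a simple point process
  (\<open>point_process_law_eqI\<close>). The construction refers only to relative positions, so it commutes
  with translations (\<open>points_shift\<close>), and the points in \<open>(0, 1)\<close> are read off from the path between some
  large excursion that has ended by time 0 and time 2 (\<open>points_local\<close>), so it is finitary.

  The coins come from flips: reflecting the path about \<open>m\<close> after its first visit to \<open>m\<close> after a given time
  preserves the law (\<open>flip_preserves\<close>) and the distance to \<open>m\<close>. Two suitable flips change exactly one out of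
  finitely many signs (\<open>exists_isolating_flips\<close>), so each sign is fair given the others and the
  distance. Flips preserve the law by the reflection principle for the unfolded Brownian motion
  (\<open>reflect_at_hit_law\<close>): reflection at a fixed time is harmless because increments are
  independent and symmetric, countably many fixed times can be combined when each decision depends
  on the past only (\<open>measure_preserving_piecewise\<close>), and the hitting time is a limit of such
  combinations (\<open>process_law_limit\<close>).

  That excursions accumulate at a renewal is also a consequence of flips. Brownian motion almost
  surely has no extremum over a fixed interval at a prescribed level (\<open>no_extremum_at_level\<close>), so a
  path that touches \<open>m\<close> in a fixed interval crosses it. A renewal that is isolated from the right would
  be a crossing by a single zero, and a flip would turn it into a touching
  (\<open>zeros_accumulate\<close>).
\<close>

section \<open>Simple point processes and their void probabilities\<close>

text \<open>
  Counting occupied dyadic cells undercounts only when two points share a cell, and finitely many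
  points are separated by a fine enough grid. This is where multiplicity one matters: the number of
  points of a simple configuration is recovered from knowing which cells are empty.
\<close>

lemma count_eq_SUP_dyadic_cells:
  fixes X :: "real set"
  shows "emeasure (count_space UNIV) X = (SUP k::nat. emeasure (count_space UNIV) ((\<lambda>x. \<lfloor>2 ^ k * x\<rfloor>) ` X))"
proof (rule antisym)
  have inj: "\<exists>k::nat. inj_on (\<lambda>x. \<lfloor>2 ^ k * x\<rfloor>) E" if finE: "finite E" for E :: "real set"
  proof -
    obtain \<delta> where \<delta>: "\<delta> > 0" "\<And>x y. x \<in> E \<Longrightarrow> y \<in> E \<Longrightarrow> x \<noteq> y \<Longrightarrow> \<delta> \<le> \<bar>x - y\<bar>"
    proof (cases "\<exists>x\<in>E. \<exists>y\<in>E. x \<noteq> y")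
      case True
      let ?D = "(\<lambda>(x,y). \<bar>x - y\<bar>) ` {p \<in> E \<times> E. fst p \<noteq> snd p}"
      have "finite {p \<in> E \<times> E. fst p \<noteq> snd p}"
        by (rule finite_subset[of _ "E \<times> E"]) (use finE in auto)
      then have fin: "finite ?D" by simp
      have ne: "?D \<noteq> {}" using True by auto
      have "Min ?D > 0" using fin ne by (subst Min_gr_iff) auto
      moreover have "Min ?D \<le> \<bar>x - y\<bar>" if "x \<in> E" "y \<in> E" "x \<noteq> y" for x y
        using that by (intro Min_le fin) (auto intro!: rev_image_eqI[of "(x, y)"])
      ultimately show ?thesis using that by blast
    next
      case False
      then show ?thesis using that[of 1] by force
    qed
    obtain k where k: "(1/2::real) ^ k < \<delta>"
      using real_arch_pow_inv[of \<delta> "1/2"] \<delta>(1) by auto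
    have "x = y" if "x \<in> E" "y \<in> E" "\<lfloor>2 ^ k * x\<rfloor> = \<lfloor>2 ^ k * y\<rfloor>" for x y
    proof (rule ccontr)
      assume "x \<noteq> y"
      then have "\<delta> \<le> \<bar>x - y\<bar>" using \<delta>(2) that by blast
      moreover have "\<bar>2 ^ k * x - 2 ^ k * y\<bar> < 1" using that(3) by linarith
      then have "2 ^ k * \<bar>x - y\<bar> < 1" by (simp add: abs_mult flip: right_diff_distrib)
      then have "\<bar>x - y\<bar> < (1/2) ^ k" by (simp add: power_one_over field_simps)
      ultimately show False using k by simp
    qed
    then show ?thesis by (auto simp: inj_on_def)
  qed
  have fin_le: "emeasure (count_space UNIV) E \<le> (SUP k::nat. emeasure (count_space UNIV) ((\<lambda>x. \<lfloor>2 ^ k * x\<rfloor>) ` X))"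
    if E: "finite E" "E \<subseteq> X" for E
  proof -
    obtain k :: nat where k: "inj_on (\<lambda>x. \<lfloor>2 ^ k * x\<rfloor>) E" using inj[OF E(1)] by blast
    have "emeasure (count_space UNIV) E = emeasure (count_space UNIV) ((\<lambda>x. \<lfloor>2 ^ k * x\<rfloor>) ` E)"
      using E(1) by (simp add: card_image[OF k])
    also have "\<dots> \<le> emeasure (count_space UNIV) ((\<lambda>x. \<lfloor>2 ^ k * x\<rfloor>) ` X)"
      using E(2) by (intro emeasure_mono) auto
    also have "\<dots> \<le> (SUP k::nat. emeasure (count_space UNIV) ((\<lambda>x. \<lfloor>2 ^ k * x\<rfloor>) ` X))"
      by (rule SUP_upper) auto
    finally show ?thesis .
  qed
  show "emeasure (count_space UNIV) X \<le> (SUP k::nat. emeasure (count_space UNIV) ((\<lambda>x. \<lfloor>2 ^ k * x\<rfloor>) ` X))"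
  proof (cases "finite X")
    case True
    then show ?thesis using fin_le by blast
  next
    case False
    have "of_nat n \<le> (SUP k::nat. emeasure (count_space UNIV) ((\<lambda>x. \<lfloor>2 ^ k * x\<rfloor>) ` X))" for n
    proof -
      obtain E where "finite E" "card E = n" "E \<subseteq> X"
        using infinite_arbitrarily_large[OF False] by blast
      then show ?thesis using fin_le[of E] by simp
    qed
    then have "(SUP k::nat. emeasure (count_space UNIV) ((\<lambda>x. \<lfloor>2 ^ k * x\<rfloor>) ` X)) = \<infinity>"
      by (metis ennreal_SUP_of_nat_eq_top infinity_ennreal_def SUP_least top.extremum_unique)
    then show ?thesis by (simp only: infinity_ennreal_def top_greatest)
  qed
  show "(SUP k::nat. emeasure (count_space UNIV) ((\<lambda>x. \<lfloor>2 ^ k * x\<rfloor>) ` X)) \<le> emeasure (count_space UNIV) X"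
  proof (rule SUP_least)
    fix k :: nat
    show "emeasure (count_space UNIV) ((\<lambda>x. \<lfloor>2 ^ k * x\<rfloor>) ` X) \<le> emeasure (count_space UNIV) X"
      using card_image_le[of X "\<lambda>x. \<lfloor>2 ^ k * x\<rfloor>"] by (cases "finite X") auto
  qed
qed

lemma emeasure_simple_point_measure:
  assumes "simple_point_measure \<mu>"
  obtains S where "countable S"
    "\<And>A. A \<in> sets borel \<Longrightarrow> emeasure \<mu> A = emeasure (count_space UNIV) (A \<inter> S)"
proof -
  from assms obtain S where S: "countable S"
    "\<And>A. A \<in> sets borel \<Longrightarrow> emeasure \<mu> A = (\<integral>\<^sup>+ x. emeasure (return borel x) A \<partial>count_space S)"
    by (auto simp: simple_point_measure_def)
  have "emeasure \<mu> A = emeasure (count_space UNIV) (A \<inter> S)" if A: "A \<in> sets borel" for A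
  proof -
    have "emeasure \<mu> A = (\<integral>\<^sup>+ x. indicator A x \<partial>count_space S)"
      using S(2)[OF A] A by (simp add: emeasure_return)
    also have "\<dots> = (\<integral>\<^sup>+ x. indicator (A \<inter> S) x \<partial>count_space S)"
      by (intro nn_integral_cong) (auto simp: indicator_def)
    also have "\<dots> = emeasure (count_space S) (A \<inter> S)"
      by (subst nn_integral_indicator) auto
    also have "\<dots> = emeasure (count_space UNIV) (A \<inter> S)"
      by (cases "finite (A \<inter> S)") auto
    finally show ?thesis .
  qed
  with S(1) that show ?thesis by blast
qed

text \<open>
  Sets of finite measure suffice as test sets because dyadic cells have finite measure; the
  restriction leaves only those void probabilities that the Poisson process prescribes.
\<close>

definition void_events :: "real measure set set" where
  "void_events = {{\<mu>. simple_point_measure \<mu> \<and> emeasure \<mu> A = 0} | A. A \<in> sets borel \<and> emeasure lborel A < \<infinity>}"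

lemma space_point_measure_space [simp]: "space point_measure_space = {\<mu>. simple_point_measure \<mu>}"
  by (auto simp: point_measure_space_def space_measure_of_conv)

lemma void_event_in_sets:
  assumes "A \<in> sets borel"
  shows "{\<mu>. simple_point_measure \<mu> \<and> emeasure \<mu> A = 0} \<in> sets point_measure_space"
proof -
  have "{\<mu>. simple_point_measure \<mu> \<and> emeasure \<mu> A \<in> {0}} \<in> sets point_measure_space"
    unfolding point_measure_space_def
  proof (intro in_measure_of CollectI exI conjI)
    show "A \<in> sets borel" by fact
    show "{0::ennreal} \<in> sets borel" by simp
  qed auto
  then show ?thesis by simp
qed

text \<open>
  The evaluation at \<open>A\<close> is a supremum of numbers of charged cells \<open>A \<inter> cell\<close>, so it is a
  measurable function of the void events.
\<close>

lemma sets_point_measure_space_void: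
  "sets point_measure_space = sigma_sets {\<mu>. simple_point_measure \<mu>} void_events"
proof -
  define \<Omega> where "\<Omega> = {\<mu>. simple_point_measure \<mu>}"
  define V where "V = sigma \<Omega> void_events"
  have void_sub: "void_events \<subseteq> Pow \<Omega>" by (auto simp: void_events_def \<Omega>_def)
  have spV: "space V = \<Omega>" and setsV: "sets V = sigma_sets \<Omega> void_events"
    using void_sub by (auto simp: V_def)
  have meas: "(\<lambda>\<mu>. emeasure \<mu> A) \<in> borel_measurable V" if A: "A \<in> sets borel" for A :: "real set"
  proof -
    let ?I = "\<lambda>k (j::int). {x::real. \<lfloor>2 ^ k * x\<rfloor> = j}"
    have I: "?I k j \<in> sets borel" for k :: nat and j by measurable
    have Ifin: "emeasure lborel (A \<inter> ?I k j) < \<infinity>" for k :: nat and j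
    proof -
      have "?I k j \<subseteq> {real_of_int j / 2 ^ k .. (real_of_int j + 1) / 2 ^ k}"
        by (auto simp: field_simps) linarith+
      then have "emeasure lborel (A \<inter> ?I k j) \<le> emeasure lborel {real_of_int j / 2 ^ k .. (real_of_int j + 1) / 2 ^ k}"
        by (intro emeasure_mono) auto
      also have "\<dots> < \<infinity>" by (simp add: emeasure_lborel_Icc_eq)
      finally show ?thesis .
    qed
    have eq: "emeasure \<mu> A = (SUP k. \<Sum>n. if emeasure \<mu> (A \<inter> ?I k (int_decode n)) = 0 then 0 else 1)"
      if "\<mu> \<in> \<Omega>" for \<mu>
    proof -
      have "simple_point_measure \<mu>" using that by (simp add: \<Omega>_def)
      then obtain S where "countable S" and
        S: "\<And>A. A \<in> sets borel \<Longrightarrow> emeasure \<mu> A = emeasure (count_space UNIV) (A \<inter> S)"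
        by (rule emeasure_simple_point_measure) blast
      have "emeasure (count_space UNIV) ((\<lambda>x. \<lfloor>2 ^ k * x\<rfloor>) ` (A \<inter> S)) =
        (\<Sum>n. if emeasure \<mu> (A \<inter> ?I k (int_decode n)) = 0 then 0 else 1)" for k
      proof -
        let ?J = "(\<lambda>x. \<lfloor>2 ^ k * x\<rfloor>) ` (A \<inter> S)"
        have "emeasure (count_space UNIV) ?J = (\<integral>\<^sup>+ j. indicator ?J j \<partial>count_space UNIV)" by simp
        also have "\<dots> = (\<integral>\<^sup>+ n. indicator ?J (int_decode n) \<partial>count_space UNIV)"
          by (rule nn_integral_bij_count_space[symmetric, OF bij_int_decode])
        also have "\<dots> = (\<Sum>n. indicator ?J (int_decode n))" by (rule nn_integral_count_space_nat)
        also have "\<dots> = (\<Sum>n. if emeasure \<mu> (A \<inter> ?I k (int_decode n)) = 0 then 0 else 1)"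
        proof (rule suminf_cong)
          fix n
          have "emeasure \<mu> (A \<inter> ?I k (int_decode n)) = emeasure (count_space UNIV) (A \<inter> ?I k (int_decode n) \<inter> S)"
            using A I by (intro S) auto
          moreover have "\<dots> = 0 \<longleftrightarrow> A \<inter> ?I k (int_decode n) \<inter> S = {}"
            by (subst emeasure_count_space_eq_0) auto
          moreover have "int_decode n \<in> ?J \<longleftrightarrow> A \<inter> ?I k (int_decode n) \<inter> S \<noteq> {}"
          proof
            assume "int_decode n \<in> ?J"
            then obtain x where "int_decode n = \<lfloor>2 ^ k * x\<rfloor>" "x \<in> A \<inter> S" by (rule imageE)
            then have "x \<in> A \<inter> ?I k (int_decode n) \<inter> S" by simp
            then show "A \<inter> ?I k (int_decode n) \<inter> S \<noteq> {}" by (rule ex_in_conv[THEN iffD1, OF exI])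
          next
            assume "A \<inter> ?I k (int_decode n) \<inter> S \<noteq> {}"
            then obtain x where "x \<in> A \<inter> ?I k (int_decode n) \<inter> S" by (rule ex_in_conv[THEN iffD2, THEN exE])
            then have "x \<in> A \<inter> S" "int_decode n = \<lfloor>2 ^ k * x\<rfloor>" by simp_all
            then show "int_decode n \<in> ?J" by (intro image_eqI)
          qed
          ultimately show "indicator ?J (int_decode n) = (if emeasure \<mu> (A \<inter> ?I k (int_decode n)) = 0 then 0 else 1 :: ennreal)"
            by (simp add: indicator_def)
        qed
        finally show ?thesis .
      qed
      then show ?thesis using S[OF A] count_eq_SUP_dyadic_cells[of "A \<inter> S"] by simp
    qed
    have m0: "(\<lambda>\<mu>. (if emeasure \<mu> (A \<inter> ?I k j) = 0 then 0 else 1 :: ennreal)) \<in> borel_measurable V" for k j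
    proof (intro measurable_If measurable_const)
      have "{\<mu>. simple_point_measure \<mu> \<and> emeasure \<mu> (A \<inter> ?I k j) = 0} \<in> void_events"
        using A I Ifin[of k j] unfolding void_events_def by blast
      then show "{\<mu> \<in> space V. emeasure \<mu> (A \<inter> ?I k j) = 0} \<in> sets V"
        unfolding spV setsV by (auto simp: \<Omega>_def intro!: sigma_sets.Basic)
    qed simp_all
    have "(\<lambda>\<mu>. SUP k. \<Sum>n. if emeasure \<mu> (A \<inter> ?I k (int_decode n)) = 0 then 0 else 1 :: ennreal) \<in> borel_measurable V"
    proof (rule borel_measurable_SUP)
      fix k :: nat
      show "(\<lambda>\<mu>. \<Sum>n. if emeasure \<mu> (A \<inter> ?I k (int_decode n)) = 0 then 0 else 1 :: ennreal) \<in> borel_measurable V"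
        by (rule borel_measurable_suminf_order) (rule m0)
    qed simp
    then show ?thesis
      by (subst measurable_cong[of V "\<lambda>\<mu>. emeasure \<mu> A", OF eq[folded spV]])
  qed
  have "sets point_measure_space \<subseteq> sigma_sets \<Omega> void_events"
  proof -
    have "{\<mu>. simple_point_measure \<mu> \<and> emeasure \<mu> A \<in> U} \<in> sets V"
      if "A \<in> sets borel" "U \<in> sets borel" for A U
    proof -
      have "(\<lambda>\<mu>. emeasure \<mu> A) -` U \<inter> space V \<in> sets V"
        using meas[OF that(1)] that(2) by (rule measurable_sets)
      moreover have "(\<lambda>\<mu>. emeasure \<mu> A) -` U \<inter> space V = {\<mu>. simple_point_measure \<mu> \<and> emeasure \<mu> A \<in> U}"
        by (auto simp: spV \<Omega>_def)
      ultimately show ?thesis by simp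
    qed
    then have G: "{{\<mu>. simple_point_measure \<mu> \<and> emeasure \<mu> A \<in> U} | A U. A \<in> sets borel \<and> U \<in> sets borel} \<subseteq> sigma_sets \<Omega> void_events" (is "?G \<subseteq> _")
      unfolding setsV by blast
    have "?G \<subseteq> Pow \<Omega>" unfolding \<Omega>_def by blast
    then have "sets point_measure_space = sigma_sets \<Omega> ?G"
      unfolding point_measure_space_def \<Omega>_def by (rule sets_measure_of)
    then show ?thesis using sigma_sets_mono[OF G] by simp
  qed
  moreover have "sigma_sets \<Omega> void_events \<subseteq> sets point_measure_space"
  proof -
    have "void_events \<subseteq> sets point_measure_space"
      using void_event_in_sets by (auto simp: void_events_def)
    then show ?thesis
      using sets.sigma_sets_subset[of void_events point_measure_space] by (simp add: \<Omega>_def)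
  qed
  ultimately show ?thesis unfolding \<Omega>_def by blast
qed

lemma measurable_point_measure_spaceI:
  assumes "\<And>x. x \<in> space M \<Longrightarrow> simple_point_measure (f x)"
    and "\<And>A. A \<in> sets borel \<Longrightarrow> emeasure lborel A < \<infinity> \<Longrightarrow> {x \<in> space M. emeasure (f x) A = 0} \<in> sets M"
  shows "f \<in> M \<rightarrow>\<^sub>M point_measure_space"
proof (rule measurable_sigma_sets[OF sets_point_measure_space_void])
  show "void_events \<subseteq> Pow {\<mu>. simple_point_measure \<mu>}" by (auto simp: void_events_def)
  show "f \<in> space M \<rightarrow> {\<mu>. simple_point_measure \<mu>}" using assms(1) by auto
  fix Y assume "Y \<in> void_events"
  then obtain A where A: "Y = {\<mu>. simple_point_measure \<mu> \<and> emeasure \<mu> A = 0}" "A \<in> sets borel" "emeasure lborel A < \<infinity>"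
    by (auto simp: void_events_def)
  then have "f -` Y \<inter> space M = {x \<in> space M. emeasure (f x) A = 0}" using assms(1) by auto
  then show "f -` Y \<inter> space M \<in> sets M" using assms(2) A by simp
qed

text \<open>
  Void events are closed under intersection, since two sets are both empty of points iff their union
  is. So they form a generator on which equality of the laws can be tested.
\<close>

lemma point_process_law_eqI:
  assumes "prob_space \<mu>" "prob_space \<nu>"
    and sets: "sets \<mu> = sets point_measure_space" "sets \<nu> = sets point_measure_space"
    and void: "\<And>A. A \<in> sets borel \<Longrightarrow> emeasure lborel A < \<infinity> \<Longrightarrow>
      emeasure \<mu> {m. simple_point_measure m \<and> emeasure m A = 0} = emeasure \<nu> {m. simple_point_measure m \<and> emeasure m A = 0}"
  shows "\<mu> = \<nu>"
proof (rule measure_eqI_generator_eq[where E = void_events and \<Omega> = "{m. simple_point_measure m}" and A = "\<lambda>_. {m. simple_point_measure m}"])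
  show "Int_stable void_events"
  proof (rule Int_stableI)
    fix a b assume "a \<in> void_events" "b \<in> void_events"
    then obtain A B where A: "a = {\<mu>. simple_point_measure \<mu> \<and> emeasure \<mu> A = 0}" "A \<in> sets borel" "emeasure lborel A < \<infinity>"
      and B: "b = {\<mu>. simple_point_measure \<mu> \<and> emeasure \<mu> B = 0}" "B \<in> sets borel" "emeasure lborel B < \<infinity>"
      by (auto simp: void_events_def)
    have "emeasure m (A \<union> B) = 0 \<longleftrightarrow> emeasure m A = 0 \<and> emeasure m B = 0" if "simple_point_measure m" for m
    proof -
      have [simp]: "sets m = sets borel" using that by (simp add: simple_point_measure_def)
      show ?thesis using A(2) B(2) emeasure_mono[of A "A \<union> B" m] emeasure_mono[of B "A \<union> B" m]
        emeasure_subadditive[of A m B] by auto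
    qed
    then have "a \<inter> b = {\<mu>. simple_point_measure \<mu> \<and> emeasure \<mu> (A \<union> B) = 0}" unfolding A B by auto
    moreover have "emeasure lborel (A \<union> B) < \<infinity>"
      using emeasure_subadditive[of A lborel B] A B by (simp add: order.strict_trans1)
    ultimately show "a \<inter> b \<in> void_events" using A(2) B(2) by (auto simp: void_events_def)
  qed
  show "void_events \<subseteq> Pow {m. simple_point_measure m}" by (auto simp: void_events_def)
  show "sets \<mu> = sigma_sets {m. simple_point_measure m} void_events"
    "sets \<nu> = sigma_sets {m. simple_point_measure m} void_events"
    using sets sets_point_measure_space_void by auto
  show "emeasure \<mu> X = emeasure \<nu> X" if "X \<in> void_events" for X
    using that void by (auto simp: void_events_def)
  have "{m. simple_point_measure m} = {\<mu>. simple_point_measure \<mu> \<and> emeasure \<mu> {} = 0}" by simp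
  then have "{m. simple_point_measure m} \<in> void_events"
    unfolding void_events_def by (intro CollectI exI[of _ "{}"]) simp
  then show "range (\<lambda>_. {m. simple_point_measure m}) \<subseteq> void_events" by auto
  show "(\<Union>i::nat. {m. simple_point_measure m}) = {m. simple_point_measure m}" by simp
  show "emeasure \<mu> {m. simple_point_measure m} \<noteq> \<infinity>"
    using prob_space.emeasure_space_1[OF assms(1)] sets_eq_imp_space_eq[OF sets(1)] by simp
qed

lemma emeasure_point_shift:
  assumes "simple_point_measure \<mu>" "A \<in> sets borel"
  shows "emeasure (point_shift t \<mu>) A = emeasure \<mu> ((\<lambda>x. x + t) -` A)"
proof -
  have s: "sets \<mu> = sets borel" using assms by (simp add: simple_point_measure_def)
  then have "space \<mu> = UNIV" using sets_eq_imp_space_eq by fastforce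
  moreover have "(\<lambda>x. x + t) \<in> measurable \<mu> borel" using s by (simp cong: measurable_cong_sets)
  ultimately show ?thesis using assms unfolding point_shift_def by (subst emeasure_distr) auto
qed

lemma simple_point_measure_shift:
  assumes "simple_point_measure \<mu>"
  shows "simple_point_measure (point_shift t \<mu>)"
proof -
  from assms obtain S where S: "countable S"
    "\<And>A. A \<in> sets borel \<Longrightarrow> emeasure \<mu> A = (\<integral>\<^sup>+ x. emeasure (return borel x) A \<partial>count_space S)"
    by (auto simp: simple_point_measure_def)
  show ?thesis unfolding simple_point_measure_def
  proof (intro conjI exI ballI)
    show "sets (point_shift t \<mu>) = sets borel" by (simp add: point_shift_def)
    show "countable ((\<lambda>x. x + t) ` S)" using S(1) by simp
    fix A :: "real set" assume A: "A \<in> sets borel"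
    have A': "(\<lambda>x. x + t) -` A \<in> sets borel"
      using measurable_sets[of "\<lambda>x::real. x + t" borel borel A] A by simp
    have "emeasure (point_shift t \<mu>) A = (\<integral>\<^sup>+ x. emeasure (return borel (x + t)) A \<partial>count_space S)"
      using A A' by (simp add: emeasure_point_shift[OF assms] S(2) emeasure_return indicator_def)
    also have "\<dots> = (\<integral>\<^sup>+ x. emeasure (return borel x) A \<partial>count_space ((\<lambda>x. x + t) ` S))"
      by (rule nn_integral_bij_count_space) (auto simp: bij_betw_def inj_on_def)
    finally show "emeasure (point_shift t \<mu>) A = (\<integral>\<^sup>+ x. emeasure (return borel x) A \<partial>count_space ((\<lambda>x. x + t) ` S))" .
  qed
qed

lemma vimage_translate_borel:
  fixes A :: "real set"
  assumes "A \<in> sets borel"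
  shows "(\<lambda>x. x + t) -` A \<in> sets borel" "emeasure lborel ((\<lambda>x. x + t) -` A) = emeasure lborel A"
proof -
  show *: "(\<lambda>x. x + t) -` A \<in> sets borel"
    using measurable_sets[of "\<lambda>x::real. x + t" borel borel A] assms by simp
  have "emeasure lborel A = emeasure (distr lborel borel ((+) t)) A"
    using lborel_distr_plus[of t] by simp
  also have "\<dots> = emeasure lborel ((\<lambda>x. x + t) -` A)"
    using assms by (subst emeasure_distr) (auto simp: vimage_def add.commute)
  finally show "emeasure lborel ((\<lambda>x. x + t) -` A) = emeasure lborel A" ..
qed

lemma measurable_point_shift: "point_shift t \<in> point_measure_space \<rightarrow>\<^sub>M point_measure_space"
proof (rule measurable_point_measure_spaceI)
  fix A :: "real set" assume A: "A \<in> sets borel"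
  have "{x \<in> space point_measure_space. emeasure (point_shift t x) A = 0} =
    {x. simple_point_measure x \<and> emeasure x ((\<lambda>x. x + t) -` A) = 0}"
    using A by (auto simp: emeasure_point_shift)
  then show "{x \<in> space point_measure_space. emeasure (point_shift t x) A = 0} \<in> sets point_measure_space"
    using void_event_in_sets vimage_translate_borel(1)[OF A] by simp
qed (auto intro: simple_point_measure_shift)

lemma poisson_void_probability:
  assumes "poisson_point_process l N P" "A \<in> sets borel" "emeasure lborel A < \<infinity>"
  shows "emeasure (distr N point_measure_space P) {m. simple_point_measure m \<and> emeasure m A = 0}
    = ennreal (exp (- (l * measure lborel A)))"
proof -
  interpret prob_space N using assms by (simp add: poisson_point_process_def)
  have P: "P \<in> N \<rightarrow>\<^sub>M point_measure_space" using assms by (simp add: poisson_point_process_def)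
  have "measure N {\<omega>\<in>space N. emeasure (P \<omega>) A = of_nat 0} = (l * measure lborel A) ^ 0 / fact 0 * exp (- (l * measure lborel A))"
    using assms unfolding poisson_point_process_def by blast
  then have "measure N {\<omega>\<in>space N. emeasure (P \<omega>) A = 0} = exp (- (l * measure lborel A))" by simp
  moreover have "P -` {m. simple_point_measure m \<and> emeasure m A = 0} \<inter> space N = {\<omega>\<in>space N. emeasure (P \<omega>) A = 0}"
    using measurable_space[OF P] by auto
  ultimately show ?thesis
    using P void_event_in_sets[OF assms(2)] by (simp add: emeasure_distr emeasure_eq_measure)
qed

text \<open>
  Translation preserves Lebesgue measure, hence all void probabilities.
\<close>

lemma mp_flow_poisson:
  assumes "poisson_point_process l N P"
  shows "mp_flow (distr N point_measure_space P) point_shift"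
proof -
  have P: "P \<in> N \<rightarrow>\<^sub>M point_measure_space" and N: "prob_space N"
    using assms by (simp_all add: poisson_point_process_def)
  let ?Q = "distr N point_measure_space P"
  have Q: "prob_space ?Q" using N P by (rule prob_space.prob_space_distr)
  have m: "point_shift t \<in> ?Q \<rightarrow>\<^sub>M ?Q" for t
    using measurable_point_shift by simp
  have inv: "distr ?Q ?Q (point_shift t) = ?Q" for t
  proof (rule point_process_law_eqI)
    show "prob_space (distr ?Q ?Q (point_shift t))" using Q m by (rule prob_space.prob_space_distr)
    fix A :: "real set" assume A: "A \<in> sets borel" "emeasure lborel A < \<infinity>"
    have "point_shift t -` {m. simple_point_measure m \<and> emeasure m A = 0} \<inter> space ?Q =
      {m. simple_point_measure m \<and> emeasure m ((\<lambda>x. x + t) -` A) = 0}"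
      using A by (auto simp: emeasure_point_shift simple_point_measure_shift)
    then have "emeasure (distr ?Q ?Q (point_shift t)) {m. simple_point_measure m \<and> emeasure m A = 0} =
        emeasure ?Q {m. simple_point_measure m \<and> emeasure m ((\<lambda>x. x + t) -` A) = 0}"
      using m void_event_in_sets[OF A(1)] by (simp add: emeasure_distr)
    also have "\<dots> = emeasure ?Q {m. simple_point_measure m \<and> emeasure m A = 0}"
      using poisson_void_probability[OF assms] vimage_translate_borel[OF A(1), of t] A by (simp add: measure_def)
    finally show "emeasure (distr ?Q ?Q (point_shift t)) {m. simple_point_measure m \<and> emeasure m A = 0} =
      emeasure ?Q {m. simple_point_measure m \<and> emeasure m A = 0}" .
  qed (use Q in auto)
  have act: "point_shift 0 x = x" "point_shift (s + t) x = point_shift s (point_shift t x)"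
    if "simple_point_measure x" for s t x
  proof -
    have s: "sets x = sets borel" using that by (simp add: simple_point_measure_def)
    show "point_shift 0 x = x"
      by (rule measure_eqI) (use that s in \<open>auto simp: point_shift_def emeasure_point_shift[of _ _ 0, unfolded point_shift_def, simplified]\<close>)
    show "point_shift (s + t) x = point_shift s (point_shift t x)"
    proof (rule measure_eqI)
      fix A assume "A \<in> sets (point_shift (s + t) x)"
      then have "A \<in> sets borel" by (simp add: point_shift_def)
      then show "emeasure (point_shift (s + t) x) A = emeasure (point_shift s (point_shift t x)) A"
        using that by (simp add: emeasure_point_shift simple_point_measure_shift vimage_translate_borel vimage_comp comp_def ac_simps)
    qed (simp add: point_shift_def)
  qed
  show ?thesis unfolding mp_flow_def using Q m inv act by (auto simp: space_point_measure_space)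
qed

section \<open>Laws of real processes and measure-preserving rearrangements\<close>

text \<open>
  Orthants form an intersection-stable generator that is adapted to limits: their indicators are
  decreasing limits of continuous functions of finitely many coordinates.
\<close>

lemma sets_PiM_borel_orthants:
  "sets (\<Pi>\<^sub>M s\<in>(UNIV::'i set). (borel :: real measure)) =
    sigma_sets UNIV {{x. \<forall>s\<in>J. x s \<le> c s} | J c. finite J}"
proof
  let ?E = "{{x. \<forall>s\<in>J. x s \<le> c s} | J c. finite (J :: 'i set)} :: ('i \<Rightarrow> real) set set"
  let ?S = "sigma UNIV ?E"
  let ?R = "\<Pi>\<^sub>M s\<in>(UNIV::'i set). (borel :: real measure)"
  have coord: "(\<lambda>x. x s) \<in> borel_measurable ?S" for s
  proof -
    have "{x. x s \<le> a} \<in> sets ?S" for a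
    proof -
      have "{x. x s \<le> a} = {x. \<forall>t\<in>{s}. x t \<le> (\<lambda>_. a) t}" by simp
      then have "{x. x s \<le> a} \<in> ?E" by (intro CollectI exI[of _ "{s}"] exI[of _ "\<lambda>_. a"]) simp
      then show ?thesis by simp
    qed
    then show ?thesis by (subst borel_measurable_iff_le) simp
  qed
  have "(\<lambda>x. x) \<in> ?S \<rightarrow>\<^sub>M ?R"
    by (rule measurable_PiM_single') (use coord in auto)
  then have "A \<in> sets ?S" if "A \<in> sets ?R" for A
    using measurable_sets[OF _ that, of "\<lambda>x. x" ?S] by simp
  then show "sets ?R \<subseteq> sigma_sets UNIV ?E" by auto
  have "{x. \<forall>s\<in>J. x s \<le> c s} \<in> sets ?R" if "finite J" for J :: "'i set" and c :: "'i \<Rightarrow> real"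
  proof -
    have "{x \<in> space ?R. \<forall>s\<in>J. x s \<le> c s} \<in> sets ?R" using that by measurable
    then show ?thesis by (simp add: space_PiM)
  qed
  then have "?E \<subseteq> sets ?R" by auto
  then show "sigma_sets UNIV ?E \<subseteq> sets ?R"
    using sets.sigma_sets_subset[of ?E ?R] by (simp add: space_PiM)
qed

lemma process_law_eqI:
  fixes \<mu> \<nu> :: "('i \<Rightarrow> real) measure"
  assumes "prob_space \<mu>"
    and sets: "sets \<mu> = sets (\<Pi>\<^sub>M s\<in>UNIV. borel)" "sets \<nu> = sets (\<Pi>\<^sub>M s\<in>UNIV. borel)"
    and eq: "\<And>J c. finite J \<Longrightarrow> emeasure \<mu> {x. \<forall>s\<in>J. x s \<le> c s} = emeasure \<nu> {x. \<forall>s\<in>J. x s \<le> c s}"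
  shows "\<mu> = \<nu>"
proof (rule measure_eqI_generator_eq[where E = "{{x. \<forall>s\<in>J. x s \<le> c s} | J c. finite (J :: 'i set)}" and \<Omega> = UNIV and A = "\<lambda>_. UNIV"])
  let ?E = "{{x. \<forall>s\<in>J. x s \<le> c s} | J c. finite (J :: 'i set)} :: ('i \<Rightarrow> real) set set"
  show "Int_stable ?E"
  proof (rule Int_stableI)
    fix a b assume "a \<in> ?E" "b \<in> ?E"
    then obtain J c J' c' where a: "a = {x. \<forall>s\<in>J. x s \<le> c s}" "finite J"
      and b: "b = {x. \<forall>s\<in>J'. x s \<le> c' s}" "finite J'" by blast
    define d where "d s = min (if s \<in> J then c s else c' s) (if s \<in> J' then c' s else c s)" for s
    have "(\<forall>s\<in>J \<union> J'. x s \<le> d s) \<longleftrightarrow> (\<forall>s\<in>J. x s \<le> c s) \<and> (\<forall>s\<in>J'. x s \<le> c' s)" for x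
      by (auto simp: d_def ball_Un)
    then have "a \<inter> b = {x. \<forall>s\<in>J \<union> J'. x s \<le> d s}"
      unfolding a b by blast
    moreover have "finite (J \<union> J')" using a b by simp
    ultimately show "a \<inter> b \<in> ?E" by blast
  qed
  show "sets \<mu> = sigma_sets UNIV ?E" "sets \<nu> = sigma_sets UNIV ?E"
    using sets sets_PiM_borel_orthants by auto
  have "UNIV = {x. \<forall>s\<in>{}. x s \<le> (\<lambda>_. 0) s}" by simp
  then have "UNIV \<in> ?E" by (intro CollectI exI[of _ "{}"] exI[of _ "\<lambda>_. 0"]) simp
  then show "range (\<lambda>_. UNIV) \<subseteq> ?E" by auto
  have "space \<mu> = UNIV" using sets_eq_imp_space_eq[OF sets(1)] by (simp add: space_PiM)
  then show "emeasure \<mu> UNIV \<noteq> \<infinity>"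
    using prob_space.emeasure_space_1[OF assms(1)] by simp
  show "emeasure \<mu> X = emeasure \<nu> X" if "X \<in> ?E" for X
    using that eq by auto
qed auto

lemma pred_Bex_countable_set:
  assumes "countable X" "\<And>i. i \<in> X \<Longrightarrow> Measurable.pred M (P i)"
  shows "Measurable.pred M (\<lambda>x. \<exists>i\<in>X. P i x)"
proof -
  have "{x \<in> space M. \<exists>i\<in>X. P i x} = (\<Union>i\<in>X. {x \<in> space M. P i x})" by auto
  also have "\<dots> \<in> sets M" using assms by (intro sets.countable_UN'') (auto simp: pred_def)
  finally show ?thesis by (simp add: pred_def)
qed

lemma measurable_process:
  assumes "\<And>s. X s \<in> borel_measurable M"
  shows "(\<lambda>\<omega> s. X s \<omega>) \<in> M \<rightarrow>\<^sub>M (\<Pi>\<^sub>M s\<in>UNIV. borel)"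
  using assms by (intro measurable_PiM_single') auto

lemma emeasure_process_orthant:
  fixes X :: "'i \<Rightarrow> 'a \<Rightarrow> real"
  assumes "\<And>s. X s \<in> borel_measurable M" "finite J"
  shows "emeasure (distr M (\<Pi>\<^sub>M s\<in>UNIV. borel) (\<lambda>\<omega> s. X s \<omega>)) {x. \<forall>s\<in>J. x s \<le> c s} =
    emeasure M {\<omega>\<in>space M. \<forall>s\<in>J. X s \<omega> \<le> c s}"
proof -
  have "{x. \<forall>s\<in>J. x s \<le> c s} \<in> sets (\<Pi>\<^sub>M s\<in>UNIV. borel)"
    unfolding sets_PiM_borel_orthants using assms(2) by (intro sigma_sets.Basic) blast
  then show ?thesis using measurable_process[of X, OF assms(1)]
    by (subst emeasure_distr) (auto intro!: arg_cong2[where f = emeasure])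
qed

text \<open>
  Pointwise limits of processes with a common law have that law. The test functions \<open>\<psi> n\<close> are
  continuous and decrease to the indicator of a half line, so the expectations of their products
  pass first to the limit in \<open>k\<close> and then in \<open>n\<close>.
\<close>

lemma process_law_limit:
  fixes Q :: "('i \<Rightarrow> real) measure" and X :: "nat \<Rightarrow> 'i \<Rightarrow> 'a \<Rightarrow> real"
  assumes "prob_space M"
    and X: "\<And>k s. X k s \<in> borel_measurable M"
    and law: "\<And>k. distr M (\<Pi>\<^sub>M s\<in>UNIV. borel) (\<lambda>\<omega> s. X k s \<omega>) = Q"
    and lim: "\<And>\<omega> s. \<omega> \<in> space M \<Longrightarrow> (\<lambda>k. X k s \<omega>) \<longlonglongrightarrow> Y s \<omega>"
  shows "distr M (\<Pi>\<^sub>M s\<in>UNIV. borel) (\<lambda>\<omega> s. Y s \<omega>) = Q"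
proof -
  interpret M: prob_space M by fact
  have Y: "Y s \<in> borel_measurable M" for s
    using X lim by (rule borel_measurable_LIMSEQ_real[rotated])
  note mX = measurable_process[of "X _", OF X] and mY = measurable_process[of Y, OF Y]
  have Q: "prob_space Q" using M.prob_space_distr[OF mX] law by metis
  interpret Q: prob_space Q by fact
  have setsQ [measurable_cong]: "sets Q = sets (\<Pi>\<^sub>M s\<in>UNIV. borel)" using law[of 0] by (metis sets_distr)
  have spQ: "space Q = UNIV" using sets_eq_imp_space_eq[OF setsQ] by (simp add: space_PiM)
  define \<psi> :: "nat \<Rightarrow> real \<Rightarrow> real" where "\<psi> n z = 1 - min 1 (real n * max 0 z)" for n z
  have \<psi>01: "0 \<le> \<psi> n z" "\<psi> n z \<le> 1" for n z by (auto simp: \<psi>_def)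
  have \<psi>lim: "(\<lambda>n. \<psi> n z) \<longlonglongrightarrow> (if z \<le> 0 then 1 else 0)" for z
  proof (cases "z \<le> 0")
    case True then show ?thesis by (simp add: \<psi>_def max_def)
  next
    case False
    then obtain n0 where n0: "1 < real n0 * z" using reals_Archimedean3[of z] by auto
    have "\<psi> n z = 0" if "n \<ge> n0" for n
    proof -
      have "real n0 * z \<le> real n * z" using False that by (intro mult_right_mono) auto
      then have "min 1 (real n * z) = 1" using n0 by (intro min_absorb1) linarith
      then show ?thesis using False by (simp add: \<psi>_def)
    qed
    then have "eventually (\<lambda>n. \<psi> n z = 0) sequentially" unfolding eventually_sequentially by blast
    then show ?thesis using False by (simp add: tendsto_eventually)
  qed
  show ?thesis
  proof (rule process_law_eqI)
    show "prob_space (distr M (\<Pi>\<^sub>M s\<in>UNIV. borel) (\<lambda>\<omega> s. Y s \<omega>))"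
      using M.prob_space_distr[OF mY] .
    fix J :: "'i set" and c :: "'i \<Rightarrow> real" assume J: "finite J"
    define g :: "nat \<Rightarrow> ('i \<Rightarrow> real) \<Rightarrow> real" where "g n x = (\<Prod>s\<in>J. \<psi> n (x s - c s))" for n x
    define I :: "('i \<Rightarrow> real) \<Rightarrow> real" where "I x = (if \<forall>s\<in>J. x s \<le> c s then 1 else 0)" for x
    have g01: "0 \<le> g n x" "g n x \<le> 1" for n x
      unfolding g_def using \<psi>01 by (auto intro!: prod_nonneg prod_le_1)
    have gI: "(\<lambda>n. g n x) \<longlonglongrightarrow> I x" for x
    proof -
      have "(\<lambda>n. g n x) \<longlonglongrightarrow> (\<Prod>s\<in>J. if x s - c s \<le> 0 then 1 else 0)"
        unfolding g_def by (intro tendsto_prod \<psi>lim)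
      moreover have "(\<Prod>s\<in>J. if x s - c s \<le> 0 then 1 else 0) = I x"
        using J by (auto simp: I_def intro!: prod.neutral prod_zero)
      ultimately show ?thesis by simp
    qed
    have g_meas[measurable]: "g n \<in> borel_measurable (\<Pi>\<^sub>M s\<in>UNIV. borel)" for n
      unfolding g_def \<psi>_def by measurable
    have I_meas[measurable]: "I \<in> borel_measurable (\<Pi>\<^sub>M s\<in>UNIV. borel)"
      using gI by (rule borel_measurable_LIMSEQ_real) measurable
    note [measurable] = X Y mX mY
    have gQ: "(\<integral>\<omega>. g n (\<lambda>s. Y s \<omega>) \<partial>M) = (\<integral>x. g n x \<partial>Q)" for n
    proof -
      have "(\<lambda>k. \<integral>\<omega>. g n (\<lambda>s. X k s \<omega>) \<partial>M) \<longlonglongrightarrow> (\<integral>\<omega>. g n (\<lambda>s. Y s \<omega>) \<partial>M)"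
      proof (rule integral_dominated_convergence[where w = "\<lambda>_. 1"])
        show "AE \<omega> in M. (\<lambda>k. g n (\<lambda>s. X k s \<omega>)) \<longlonglongrightarrow> g n (\<lambda>s. Y s \<omega>)"
          unfolding g_def \<psi>_def by (intro AE_I2 tendsto_intros lim)
        show "AE \<omega> in M. norm (g n (\<lambda>s. X k s \<omega>)) \<le> 1" for k using g01 by simp
        show "integrable M (\<lambda>_. 1::real)" by simp
        show "(\<lambda>\<omega>. g n (\<lambda>s. X k s \<omega>)) \<in> borel_measurable M" for k by measurable
        show "(\<lambda>\<omega>. g n (\<lambda>s. Y s \<omega>)) \<in> borel_measurable M" by measurable
      qed
      moreover have "(\<integral>\<omega>. g n (\<lambda>s. X k s \<omega>) \<partial>M) = (\<integral>x. g n x \<partial>Q)" for k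
        unfolding law[of k, symmetric] by (subst integral_distr) auto
      ultimately show ?thesis by (simp add: LIMSEQ_const_iff)
    qed
    have "(\<lambda>n. \<integral>\<omega>. g n (\<lambda>s. Y s \<omega>) \<partial>M) \<longlonglongrightarrow> (\<integral>\<omega>. I (\<lambda>s. Y s \<omega>) \<partial>M)"
    proof (rule integral_dominated_convergence[where w = "\<lambda>_. 1"])
      show "AE \<omega> in M. norm (g k (\<lambda>s. Y s \<omega>)) \<le> 1" for k using g01 by simp
    qed (use gI in \<open>auto\<close>)
    moreover have "(\<lambda>n. \<integral>x. g n x \<partial>Q) \<longlonglongrightarrow> (\<integral>x. I x \<partial>Q)"
    proof (rule integral_dominated_convergence[where w = "\<lambda>_. 1"])
      show "AE x in Q. norm (g k x) \<le> 1" for k using g01 by simp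
      show "I \<in> borel_measurable Q" "g k \<in> borel_measurable Q" for k by measurable
    qed (use gI in \<open>auto\<close>)
    ultimately have eq: "(\<integral>\<omega>. I (\<lambda>s. Y s \<omega>) \<partial>M) = (\<integral>x. I x \<partial>Q)"
      unfolding gQ by (rule LIMSEQ_unique)
    have ms: "{\<omega>\<in>space M. \<forall>s\<in>J. Y s \<omega> \<le> c s} \<in> sets M" using J by measurable
    have mq: "{x. \<forall>s\<in>J. x s \<le> c s} \<in> sets Q"
      unfolding setsQ sets_PiM_borel_orthants using J by (intro sigma_sets.Basic) blast
    have "(\<integral>\<omega>. I (\<lambda>s. Y s \<omega>) \<partial>M) = (\<integral>\<omega>. indicator {\<omega>\<in>space M. \<forall>s\<in>J. Y s \<omega> \<le> c s} \<omega> \<partial>M)"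
      by (intro Bochner_Integration.integral_cong) (auto simp: I_def)
    moreover have "(\<integral>x. I x \<partial>Q) = (\<integral>x. indicator {x. \<forall>s\<in>J. x s \<le> c s} x \<partial>Q)"
      by (intro Bochner_Integration.integral_cong) (auto simp: I_def)
    ultimately have "measure M {\<omega>\<in>space M. \<forall>s\<in>J. Y s \<omega> \<le> c s} = measure Q {x. \<forall>s\<in>J. x s \<le> c s}"
      using eq ms mq spQ by simp
    then show "emeasure (distr M (\<Pi>\<^sub>M s\<in>UNIV. borel) (\<lambda>\<omega> s. Y s \<omega>)) {x. \<forall>s\<in>J. x s \<le> c s} = emeasure Q {x. \<forall>s\<in>J. x s \<le> c s}"
      using emeasure_process_orthant[of Y M J c, OF Y J] by (simp add: M.emeasure_eq_measure Q.emeasure_eq_measure)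
  qed (use setsQ in auto)
qed

text \<open>
  A countable case distinction between measure-preserving maps is again measure-preserving, as long
  as each map respects the part of the space on which it is used. This lemma takes the place of the
  strong Markov property below, and it also allows the choice of a flip to depend on the path.
\<close>

lemma measure_preserving_piecewise:
  fixes \<Psi> :: "nat \<Rightarrow> 'x \<Rightarrow> 'x" and \<kappa> :: "'x \<Rightarrow> nat"
  assumes \<Psi>: "\<And>i. \<Psi> i \<in> M \<rightarrow>\<^sub>M M" "\<And>i. distr M M (\<Psi> i) = M"
    and \<kappa>: "\<kappa> \<in> M \<rightarrow>\<^sub>M count_space UNIV"
    and inv: "\<And>i x. x \<in> space M \<Longrightarrow> \<kappa> (\<Psi> i x) = i \<longleftrightarrow> \<kappa> x = i"
  shows "(\<lambda>x. \<Psi> (\<kappa> x) x) \<in> M \<rightarrow>\<^sub>M M" "distr M M (\<lambda>x. \<Psi> (\<kappa> x) x) = M"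
proof -
  show m: "(\<lambda>x. \<Psi> (\<kappa> x) x) \<in> M \<rightarrow>\<^sub>M M"
    using \<Psi>(1) \<kappa> by (rule measurable_compose_countable)
  show "distr M M (\<lambda>x. \<Psi> (\<kappa> x) x) = M"
  proof (rule measure_eqI)
    fix A assume "A \<in> sets (distr M M (\<lambda>x. \<Psi> (\<kappa> x) x))"
    then have A: "A \<in> sets M" by simp
    let ?K = "\<lambda>i. {x \<in> space M. \<kappa> x = i}"
    have K: "?K i \<in> sets M" for i using measurable_sets[OF \<kappa>, of "{i}"] by (simp add: vimage_def Int_def conj_commute)
    have split: "emeasure M B = (\<Sum>i. emeasure M (?K i \<inter> B))" if "B \<in> sets M" for B
    proof -
      have "(\<Sum>i. emeasure M (?K i \<inter> B)) = emeasure M (\<Union>i. ?K i \<inter> B)"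
        using K that by (intro suminf_emeasure) (auto simp: disjoint_family_on_def)
      moreover have "(\<Union>i. ?K i \<inter> B) = B" using sets.sets_into_space[OF that] by auto
      ultimately show ?thesis by simp
    qed
    let ?B = "(\<lambda>x. \<Psi> (\<kappa> x) x) -` A \<inter> space M"
    have B: "?B \<in> sets M" using m A by (rule measurable_sets)
    have "emeasure M (?K i \<inter> ?B) = emeasure M (?K i \<inter> A)" for i
    proof -
      have "?K i \<inter> ?B = \<Psi> i -` (?K i \<inter> A) \<inter> space M"
        using inv measurable_space[OF \<Psi>(1)[of i]] by auto
      then have "emeasure M (?K i \<inter> ?B) = emeasure (distr M M (\<Psi> i)) (?K i \<inter> A)"
        using \<Psi>(1) K A by (subst emeasure_distr) auto
      then show ?thesis using \<Psi>(2) by simp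
    qed
    then show "emeasure (distr M M (\<lambda>x. \<Psi> (\<kappa> x) x)) A = emeasure M A"
      using m A split[OF A] split[OF B] by (simp add: emeasure_distr)
  qed simp
qed

section \<open>Reflecting Brownian motion at a hitting time\<close>

definition reflect_after :: "real \<Rightarrow> (real \<Rightarrow> real) \<Rightarrow> real \<Rightarrow> real" where
  "reflect_after u v s = (if s \<le> u then v s else 2 * v u - v s)"

text \<open>
  The path \<open>v\<close> visits \<open>C\<close> during \<open>[q, u]\<close>, phrased through countably many coordinates so that it
  makes sense, and is measurable, on the full product space; for continuous paths and closed \<open>C\<close> it
  is the usual notion.
\<close>

definition hits_set :: "real set \<Rightarrow> real \<Rightarrow> real \<Rightarrow> (real \<Rightarrow> real) \<Rightarrow> bool" where
  "hits_set C q u v \<longleftrightarrow> (\<forall>n::nat. \<exists>r\<in>\<rat> \<inter> {0..1}. infdist (v (q + (u - q) * r)) C < 1 / real (Suc n))"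

lemma hits_set_iff:
  assumes v: "continuous_on UNIV v" and C: "closed C" "C \<noteq> {}" and "q \<le> u"
  shows "hits_set C q u v \<longleftrightarrow> (\<exists>x\<in>{q..u}. v x \<in> C)"
proof
  let ?g = "\<lambda>r. infdist (v (q + (u - q) * r)) C"
  have g: "continuous_on UNIV ?g"
    by (intro continuous_on_infdist continuous_on_compose2[OF v] continuous_intros) auto
  have inI: "q + (u - q) * r \<in> {q..u}" if "r \<in> {0..1}" for r
    using that assms(4) mult_left_le[of r "u - q"] by auto
  {
    assume H: "hits_set C q u v"
    obtain r where r: "r \<in> {0..1}" "\<And>r'. r' \<in> {0..1} \<Longrightarrow> ?g r \<le> ?g r'"
      using continuous_attains_inf[of "{0..1::real}" ?g] continuous_on_subset[OF g] by auto
    have "?g r = 0"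
    proof (rule ccontr)
      assume "?g r \<noteq> 0"
      then have "?g r > 0" using infdist_nonneg[of _ C] by (simp add: order.strict_iff_order)
      then obtain n :: nat where "1 / real (Suc n) < ?g r"
        using nat_approx_posE by blast
      moreover obtain r' where "r' \<in> {0..1}" "?g r' < 1 / real (Suc n)"
        using H unfolding hits_set_def by blast
      ultimately show False using r(2)[of r'] by simp
    qed
    then have "v (q + (u - q) * r) \<in> C" using C by (simp add: in_closed_iff_infdist_zero)
    then show "\<exists>x\<in>{q..u}. v x \<in> C" using inI[OF r(1)] by blast
  }
  assume "\<exists>x\<in>{q..u}. v x \<in> C"
  then obtain x where x: "q \<le> x" "x \<le> u" "v x \<in> C" by auto
  obtain r where r: "r \<in> {0..1}" "x = q + (u - q) * r"
  proof (cases "u = q")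
    case True then show ?thesis using that[of 0] x by simp
  next
    case False then show ?thesis using that[of "(x - q) / (u - q)"] x assms(4) by (simp add: field_simps)
  qed
  have gr: "?g r = 0" using x r by simp
  show "hits_set C q u v" unfolding hits_set_def
  proof
    fix n :: nat
    have "isCont ?g r" using g by (simp add: continuous_on_eq_continuous_at)
    then obtain d where d: "d > 0" "\<And>r'. \<bar>r' - r\<bar> < d \<Longrightarrow> \<bar>?g r' - ?g r\<bar> < 1 / real (Suc n)"
      unfolding continuous_at_eps_delta dist_real_def by (metis of_nat_0_less_iff zero_less_Suc zero_less_divide_1_iff)
    have "\<exists>r'\<in>\<rat>. max 0 (r - d) < r' \<and> r' < min 1 (r + d)"
      using d(1) r(1) by (intro Rats_dense_in_real) auto
    then obtain r' where r': "r' \<in> \<rat>" "max 0 (r - d) < r'" "r' < min 1 (r + d)" by blast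
    then have "?g r' < 1 / real (Suc n)" using d(2)[of r'] gr by (auto simp: abs_less_iff)
    then show "\<exists>r\<in>\<rat> \<inter> {0..1}. ?g r < 1 / real (Suc n)" using r' by auto
  qed
qed

lemma hits_set_cong:
  assumes "\<And>x. q \<le> x \<Longrightarrow> x \<le> u \<Longrightarrow> v x = v' x" "q \<le> u"
  shows "hits_set C q u v \<longleftrightarrow> hits_set C q u v'"
proof -
  have "v (q + (u - q) * r) = v' (q + (u - q) * r)" if "r \<in> \<rat> \<inter> {0..1}" for r
    using that assms(2) mult_left_le[of r "u - q"] by (intro assms(1)) auto
  then show ?thesis unfolding hits_set_def by (metis (no_types, lifting))
qed

lemma measurable_hits_set [measurable]:
  "Measurable.pred (\<Pi>\<^sub>M s\<in>UNIV. borel) (hits_set C q u)"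
proof -
  have [measurable]: "(\<lambda>x::real. infdist x C) \<in> borel_measurable borel"
    by (intro borel_measurable_continuous_onI continuous_on_infdist continuous_on_id)
  have [simp]: "countable (\<rat> \<inter> {0..1::real})" using countable_rat by (rule countable_subset[rotated]) auto
  show ?thesis unfolding hits_set_def
    by (intro pred_intros_countable pred_intros_countable_bounded) (simp, measurable)
qed

text \<open>
  For negative times \<open>W s\<close> is not independent of the later increments, because independence is
  anchored at time 0. All arguments therefore use \<open>W\<close> on the half line only, and \<open>V\<close> is the path frozen
  before time 0.
\<close>

locale brownian_motion =
  fixes M :: "'a measure" and W :: "real \<Rightarrow> 'a \<Rightarrow> real"
  assumes bm: "two_sided_brownian_motion M W"
begin

sublocale prob_space M using bm by (simp add: two_sided_brownian_motion_def)

lemma W_measurable [measurable]: "W s \<in> borel_measurable M"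
  using bm by (simp add: two_sided_brownian_motion_def)

lemma W_continuous: "\<omega> \<in> space M \<Longrightarrow> continuous_on UNIV (\<lambda>s. W s \<omega>)"
  using bm by (simp add: two_sided_brownian_motion_def)

lemma W_increment:
  "s < t \<Longrightarrow> distributed M lborel (\<lambda>\<omega>. W t \<omega> - W s \<omega>) (\<lambda>x. ennreal (normal_density 0 (sqrt (t - s)) x))"
  using bm by (simp add: two_sided_brownian_motion_def)

definition increments :: "(nat \<Rightarrow> real) \<Rightarrow> nat \<Rightarrow> 'a \<Rightarrow> real" where
  "increments t i \<omega> = (case i of 0 \<Rightarrow> W 0 \<omega> | Suc j \<Rightarrow> W (t (Suc j)) \<omega> - W (t j) \<omega>)"

lemma increments_measurable [measurable]: "increments t i \<in> borel_measurable M"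
  unfolding increments_def by (cases i) simp_all

lemma increments_indep:
  assumes "\<And>i. i < n \<Longrightarrow> t i < t (Suc i)"
  shows "indep_vars (\<lambda>_. borel) (increments t) {0..n}"
  using bm assms unfolding two_sided_brownian_motion_def increments_def by blast

definition V :: "real \<Rightarrow> 'a \<Rightarrow> real" where "V s = W (max 0 s)"

definition forward_law :: "(real \<Rightarrow> real) measure" where
  "forward_law = distr M (\<Pi>\<^sub>M s\<in>UNIV. borel) (\<lambda>\<omega> s. V s \<omega>)"

lemma V_measurable [measurable]: "V s \<in> borel_measurable M"
  by (simp add: V_def)

lemma sets_forward_law [simp, measurable_cong]: "sets forward_law = sets (\<Pi>\<^sub>M s\<in>UNIV. borel)"
  by (simp add: forward_law_def)

lemma space_forward_law [simp]: "space forward_law = UNIV"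
  by (simp add: forward_law_def space_PiM)

lemma measurable_V_process [measurable]: "(\<lambda>\<omega> s. V s \<omega>) \<in> M \<rightarrow>\<^sub>M (\<Pi>\<^sub>M s\<in>UNIV. borel)"
  by (rule measurable_process) simp

lemma increment_symmetric:
  assumes "s < t"
  shows "distr M borel (\<lambda>\<omega>. - (W t \<omega> - W s \<omega>)) = distr M borel (\<lambda>\<omega>. W t \<omega> - W s \<omega>)"
proof -
  have "distributed M lborel (\<lambda>\<omega>. 0 + (-1) * (W t \<omega> - W s \<omega>)) (normal_density (0 + (-1) * 0) (\<bar>-1\<bar> * sqrt (t - s)))"
    using assms by (intro normal_density_affine W_increment) auto
  then have "distr M lborel (\<lambda>\<omega>. - (W t \<omega> - W s \<omega>)) = distr M lborel (\<lambda>\<omega>. W t \<omega> - W s \<omega>)"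
    using W_increment[OF assms] by (simp add: distributed_distr_eq_density)
  then show ?thesis by (simp cong: distr_cong)
qed

text \<open>
  Reflection at a fixed time \<open>u \<ge> 0\<close> changes the sign of the increments after \<open>u\<close>. They are symmetric
  and independent of each other and of the past, so the joint law stays the same.
\<close>

lemma reflect_after_law:
  assumes u: "0 \<le> u"
  shows "distr M (\<Pi>\<^sub>M s\<in>UNIV. borel) (\<lambda>\<omega> s. reflect_after u (\<lambda>s. V s \<omega>) s) = forward_law"
  unfolding forward_law_def
proof (rule process_law_eqI)
  let ?X = "\<lambda>s \<omega>. reflect_after u (\<lambda>s. V s \<omega>) s"
  have X: "?X s \<in> borel_measurable M" for s
    unfolding reflect_after_def by simp
  show "prob_space (distr M (\<Pi>\<^sub>M s\<in>UNIV. borel) (\<lambda>\<omega> s. ?X s \<omega>))"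
    by (rule prob_space_distr) (rule measurable_process[of ?X, OF X])
  fix J :: "real set" and c :: "real \<Rightarrow> real" assume J: "finite J"
  \<comment> \<open>The list of times contains 0, where the increments are anchored, and \<open>u\<close>, so that no increment straddles \<open>u\<close>.\<close>
  define S where "S = insert 0 (insert u (max 0 ` J))"
  have S: "finite S" "\<And>s. s \<in> S \<Longrightarrow> 0 \<le> s" "0 \<in> S" "u \<in> S" using J u by (auto simp: S_def)
  define ts where "ts = sorted_list_of_set S"
  have ts: "sorted_wrt (<) ts" "set ts = S" using S(1) by (auto simp: ts_def strict_sorted_iff)
  define n where "n = length ts - 1"
  define t where "t i = ts ! i" for i
  have len: "length ts = Suc n" using ts(2) S(3) by (cases ts) (auto simp: n_def)
  have mono: "t i < t j" if "i < j" "j \<le> n" for i j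
    using sorted_wrt_nth_less[OF ts(1), of i j] that len by (simp add: t_def)
  have mono_le: "t i \<le> t j" if "i \<le> j" "j \<le> n" for i j
    using mono[of i j] that by (cases "i = j") auto
  have idx: "\<exists>k\<le>n. t k = s" if "s \<in> S" for s
    using that ts(2) len unfolding t_def by (metis in_set_conv_nth less_Suc_eq_le)
  have t0: "t 0 = 0"
  proof -
    obtain k where k: "k \<le> n" "t k = 0" using idx[OF S(3)] by blast
    have "t 0 \<in> S" using ts(2) len by (auto simp: t_def)
    then show ?thesis using S(2)[of "t 0"] mono_le[of 0 k] k by simp
  qed
  obtain p where p: "p \<le> n" "t p = u" using idx[OF S(4)] by blast
  define ix where "ix s = (SOME k. k \<le> n \<and> t k = max 0 s)" for s
  have ix: "ix s \<le> n" "t (ix s) = max 0 s" if "s \<in> J" for s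
    using someI_ex[of "\<lambda>k. k \<le> n \<and> t k = max 0 s"] idx[of "max 0 s"] that by (auto simp: ix_def S_def)
  define \<epsilon> :: "nat \<Rightarrow> real" where "\<epsilon> i = (if p < i then -1 else 1)" for i
  let ?\<Delta> = "increments t"
  let ?\<Delta>' = "\<lambda>i \<omega>. \<epsilon> i * increments t i \<omega>"
  have sum_V: "(\<Sum>i\<le>k. ?\<Delta> i \<omega>) = W (t k) \<omega>" if "k \<le> n" for k \<omega>
    using that by (induction k) (auto simp: increments_def t0)
  have sum_X: "(\<Sum>i\<le>k. ?\<Delta>' i \<omega>) = (if t k \<le> u then W (t k) \<omega> else 2 * W u \<omega> - W (t k) \<omega>)" if "k \<le> n" for k \<omega>
    using that
  proof (induction k)
    case 0 then show ?case using u by (simp add: increments_def t0 \<epsilon>_def)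
  next
    case (Suc k)
    have 1: "t k \<le> u \<longleftrightarrow> k \<le> p" if "k \<le> n" for k
      using mono_le[of k p] mono[of p k] p that by (cases "k \<le> p") auto
    have 2: "t k = u" if "k \<le> p" "p < Suc k" using that p by (metis le_less_Suc_eq less_Suc_eq_le le_antisym)
    show ?case using Suc 1[of k] 1[of "Suc k"] 2 by (auto simp: increments_def \<epsilon>_def)
  qed
  have ind: "indep_vars (\<lambda>_. borel) ?\<Delta> {0..n}"
    using mono by (intro increments_indep) auto
  have ind': "indep_vars (\<lambda>_. borel) ?\<Delta>' {0..n}"
    using indep_vars_compose2[OF ind, of "\<lambda>i x. \<epsilon> i * x" "\<lambda>_. borel"] by simp
  have marg: "distr M borel (?\<Delta>' i) = distr M borel (?\<Delta> i)" if "i \<in> {0..n}" for i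
  proof (cases "p < i")
    case True
    then obtain j where j: "i = Suc j" by (cases i) auto
    then show ?thesis using True increment_symmetric[of "t j" "t (Suc j)"] mono[of j "Suc j"] that
      by (simp add: \<epsilon>_def increments_def[abs_def])
  qed (simp add: \<epsilon>_def)
  let ?P = "\<Pi>\<^sub>M i\<in>{0..n}. (borel :: real measure)"
  have "distr M ?P (\<lambda>\<omega>. \<lambda>i\<in>{0..n}. ?\<Delta>' i \<omega>) = (\<Pi>\<^sub>M i\<in>{0..n}. distr M borel (?\<Delta>' i))"
    using ind' by (subst (asm) indep_vars_iff_distr_eq_PiM') auto
  also have "\<dots> = (\<Pi>\<^sub>M i\<in>{0..n}. distr M borel (?\<Delta> i))"
    using marg by (intro PiM_cong) auto
  also have "\<dots> = distr M ?P (\<lambda>\<omega>. \<lambda>i\<in>{0..n}. ?\<Delta> i \<omega>)"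
    using ind by (subst (asm) indep_vars_iff_distr_eq_PiM') auto
  finally have joint: "distr M ?P (\<lambda>\<omega>. \<lambda>i\<in>{0..n}. ?\<Delta>' i \<omega>) = distr M ?P (\<lambda>\<omega>. \<lambda>i\<in>{0..n}. ?\<Delta> i \<omega>)" .
  define G where "G = {z \<in> space ?P. \<forall>s\<in>J. (\<Sum>i\<le>ix s. z i) \<le> c s}"
  have G: "G \<in> sets ?P"
  proof -
    have "(\<lambda>z. \<Sum>i\<le>ix s. z i) \<in> borel_measurable ?P" if "s \<in> J" for s
      using ix(1)[OF that] by (intro borel_measurable_sum measurable_component_singleton) auto
    then show ?thesis unfolding G_def using J by (intro sets.sets_Collect_finite_All borel_measurable_le) auto
  qed
  have pre: "emeasure (distr M ?P (\<lambda>\<omega>. \<lambda>i\<in>{0..n}. Z i \<omega>)) G = emeasure M {\<omega>\<in>space M. \<forall>s\<in>J. (\<Sum>i\<le>ix s. Z i \<omega>) \<le> c s}"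
    if [measurable]: "\<And>i. Z i \<in> borel_measurable M" for Z
  proof -
    have "(\<Sum>i\<le>ix s. (\<lambda>i\<in>{0..n}. Z i \<omega>) i) = (\<Sum>i\<le>ix s. Z i \<omega>)" if "s \<in> J" for s \<omega>
      using ix(1)[OF that] by (intro sum.cong) auto
    then have "(\<lambda>\<omega>. \<lambda>i\<in>{0..n}. Z i \<omega>) -` G \<inter> space M = {\<omega>\<in>space M. \<forall>s\<in>J. (\<Sum>i\<le>ix s. Z i \<omega>) \<le> c s}"
      by (auto simp: G_def space_PiM)
    moreover have "(\<lambda>\<omega>. \<lambda>i\<in>{0..n}. Z i \<omega>) \<in> M \<rightarrow>\<^sub>M ?P" by (intro measurable_restrict) simp
    ultimately show ?thesis using G by (simp add: emeasure_distr)
  qed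
  have eqX: "?X s \<omega> = (\<Sum>i\<le>ix s. ?\<Delta>' i \<omega>)" if "s \<in> J" for s \<omega>
  proof -
    have "s \<le> u \<longleftrightarrow> max 0 s \<le> u" using u by auto
    then show ?thesis using sum_X[OF ix(1)[OF that], of \<omega>] ix(2)[OF that] u
      by (simp add: reflect_after_def V_def max_absorb2)
  qed
  have eqV: "V s \<omega> = (\<Sum>i\<le>ix s. ?\<Delta> i \<omega>)" if "s \<in> J" for s \<omega>
    using sum_V[OF ix(1)[OF that], of \<omega>] ix(2)[OF that] by (simp add: V_def)
  have "emeasure M {\<omega>\<in>space M. \<forall>s\<in>J. ?X s \<omega> \<le> c s} = emeasure M {\<omega>\<in>space M. \<forall>s\<in>J. V s \<omega> \<le> c s}"
    using pre[of ?\<Delta>'] pre[of ?\<Delta>] joint by (simp add: eqX eqV cong: conj_cong)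
  then show "emeasure (distr M (\<Pi>\<^sub>M s\<in>UNIV. borel) (\<lambda>\<omega> s. ?X s \<omega>)) {x. \<forall>s\<in>J. x s \<le> c s} =
      emeasure (distr M (\<Pi>\<^sub>M s\<in>UNIV. borel) (\<lambda>\<omega> s. V s \<omega>)) {x. \<forall>s\<in>J. x s \<le> c s}"
    using emeasure_process_orthant[of ?X M J c, OF X J] emeasure_process_orthant[of V M J c, OF V_measurable J] by simp
qed simp_all

lemma reflect_after_measurable [measurable]:
  "reflect_after u \<in> (\<Pi>\<^sub>M s\<in>UNIV. borel) \<rightarrow>\<^sub>M (\<Pi>\<^sub>M s\<in>UNIV. borel)"
  by (rule measurable_PiM_single') (auto simp: reflect_after_def)

lemma reflect_after_preserves:
  assumes "0 \<le> u"
  shows "distr forward_law forward_law (reflect_after u) = forward_law"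
proof -
  have "distr forward_law forward_law (reflect_after u) =
      distr (distr M (\<Pi>\<^sub>M s\<in>UNIV. borel) (\<lambda>\<omega> s. V s \<omega>)) (\<Pi>\<^sub>M s\<in>UNIV. borel) (reflect_after u)"
    unfolding forward_law_def by (rule distr_cong) auto
  also have "\<dots> = distr M (\<Pi>\<^sub>M s\<in>UNIV. borel) (\<lambda>\<omega> s. reflect_after u (\<lambda>s. V s \<omega>) s)"
    by (subst distr_distr) (auto simp: comp_def)
  finally show ?thesis using reflect_after_law[OF assms] by simp
qed

end

text \<open>
  One plus the index of the first point of the grid \<open>q + i / 2 ^ k\<close> by which \<open>C\<close> has been visited, and
  0 if there is none; the shift by one makes room for this last case. Rounding the hitting time up
  to the grid keeps the decision to reflect at \<open>u\<close> a matter of the path before \<open>u\<close>.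
\<close>

definition grid_stop :: "real set \<Rightarrow> real \<Rightarrow> nat \<Rightarrow> (real \<Rightarrow> real) \<Rightarrow> nat" where
  "grid_stop C q k v = (if \<exists>i. hits_set C q (q + real i / 2 ^ k) v
     then Suc (LEAST i. hits_set C q (q + real i / 2 ^ k) v) else 0)"

definition reflect_grid :: "real \<Rightarrow> nat \<Rightarrow> nat \<Rightarrow> (real \<Rightarrow> real) \<Rightarrow> real \<Rightarrow> real" where
  "reflect_grid q k j = (case j of 0 \<Rightarrow> (\<lambda>v. v) | Suc i \<Rightarrow> reflect_after (q + real i / 2 ^ k))"

lemma grid_stop_eq_Suc_iff:
  "grid_stop C q k v = Suc i \<longleftrightarrow> hits_set C q (q + real i / 2 ^ k) v \<and> (\<forall>i'<i. \<not> hits_set C q (q + real i' / 2 ^ k) v)"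
  (is "?l \<longleftrightarrow> ?r")
proof
  let ?H = "\<lambda>i. hits_set C q (q + real i / 2 ^ k) v"
  show "?r" if ?l
  proof -
    have ex: "\<exists>i. ?H i" and L: "(LEAST i. ?H i) = i"
      using that by (auto simp: grid_stop_def split: if_splits)
    show ?thesis using LeastI_ex[OF ex] not_less_Least[of _ ?H] L by auto
  qed
  show "?l" if ?r
  proof -
    have "(LEAST i. ?H i) = i" using that by (intro Least_equality) (auto simp: not_less[symmetric])
    then show ?thesis using that by (auto simp: grid_stop_def)
  qed
qed

text \<open>
  Without a visit to \<open>C\<close> the value is the same unspecified constant for all paths.
\<close>

definition hit_time :: "real set \<Rightarrow> real \<Rightarrow> (real \<Rightarrow> real) \<Rightarrow> real" where
  "hit_time C q v = Inf {x. q \<le> x \<and> v x \<in> C}"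

definition reflect_at_hit :: "real set \<Rightarrow> real \<Rightarrow> (real \<Rightarrow> real) \<Rightarrow> real \<Rightarrow> real" where
  "reflect_at_hit C q v s = (if \<exists>x\<in>{q..s}. v x \<in> C then 2 * v (hit_time C q v) - v s else v s)"

lemma hit_time:
  assumes v: "continuous_on UNIV v" and C: "closed C" and x: "q \<le> x" "v x \<in> C"
  shows "q \<le> hit_time C q v" "v (hit_time C q v) \<in> C" "hit_time C q v \<le> x"
proof -
  let ?S = "{x. q \<le> x \<and> v x \<in> C}"
  have "?S = {q..} \<inter> v -` C" by auto
  then have "closed ?S" using closed_Int[OF closed_atLeast closed_vimage[OF C v]] by simp
  moreover have "x \<in> ?S" using x by simp
  then have "?S \<noteq> {}" by blast
  moreover have "bdd_below ?S" by (rule bdd_belowI[of _ q]) simp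
  ultimately have "hit_time C q v \<in> ?S" unfolding hit_time_def by (intro closed_contains_Inf)
  then show "q \<le> hit_time C q v" "v (hit_time C q v) \<in> C" by auto
  show "hit_time C q v \<le> x" unfolding hit_time_def
    using x \<open>bdd_below ?S\<close> by (intro cInf_lower) auto
qed

text \<open>
  The grid times decrease to the hitting time \<open>d\<close>. Before \<open>d\<close> nothing is ever reflected; after \<open>d\<close> the
  reflection eventually takes place, about values that converge to \<open>v d\<close> by continuity.
\<close>

lemma grid_reflection_limit:
  assumes v: "continuous_on UNIV v" and C: "closed C" "C \<noteq> {}"
  shows "(\<lambda>k. reflect_grid q k (grid_stop C q k v) v s) \<longlonglongrightarrow> reflect_at_hit C q v s"
proof (cases "\<exists>x\<ge>q. v x \<in> C")
  case False
  then have "grid_stop C q k v = 0" for k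
    using hits_set_iff[OF v C, of q] by (auto simp: grid_stop_def)
  moreover have "reflect_at_hit C q v s = v s" using False by (auto simp: reflect_at_hit_def)
  ultimately show ?thesis by (simp add: reflect_grid_def)
next
  case True
  define d where "d = hit_time C q v"
  have d: "q \<le> d" "v d \<in> C" "\<And>x. q \<le> x \<Longrightarrow> v x \<in> C \<Longrightarrow> d \<le> x"
    using True hit_time[OF v C(1)] by (auto simp: d_def)
  have cond: "(\<exists>x\<in>{q..s}. v x \<in> C) \<longleftrightarrow> d \<le> s" for s
  proof
    assume "\<exists>x\<in>{q..s}. v x \<in> C"
    then obtain x where "q \<le> x" "x \<le> s" "v x \<in> C" by auto
    then show "d \<le> s" using d(3)[of x] by simp
  qed (use d(1,2) in \<open>intro bexI[of _ d]; simp\<close>)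
  have H: "hits_set C q (q + real i / 2 ^ k) v \<longleftrightarrow> d \<le> q + real i / 2 ^ k" for i k
    by (subst hits_set_iff[OF v C]) (simp, rule cond)
  define u where "u k = q + real (grid_stop C q k v - 1) / 2 ^ k" for k
  have stop: "d \<le> u k \<and> u k \<le> d + (1/2) ^ k \<and> reflect_grid q k (grid_stop C q k v) v = reflect_after (u k) v" for k
  proof -
    obtain i where i: "real i \<ge> (d - q) * 2 ^ k" using real_arch_simple by blast
    then have "hits_set C q (q + real i / 2 ^ k) v" unfolding H by (simp add: field_simps)
    then have "\<exists>i. hits_set C q (q + real i / 2 ^ k) v" by blast
    then have "grid_stop C q k v = Suc (LEAST i. hits_set C q (q + real i / 2 ^ k) v)" by (simp only: grid_stop_def if_True)
    then obtain j where j: "grid_stop C q k v = Suc j" by blast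
    then have Hj: "d \<le> q + real j / 2 ^ k" "\<And>i'. i' < j \<Longrightarrow> \<not> d \<le> q + real i' / 2 ^ k"
      unfolding grid_stop_eq_Suc_iff H by auto
    have uj: "u k = q + real j / 2 ^ k" by (simp add: u_def j)
    have "u k \<le> d + (1/2) ^ k"
    proof (cases j)
      case 0 then show ?thesis using uj d by (simp add: add_increasing2)
    next
      case (Suc i')
      have "u k = q + real i' / 2 ^ k + (1/2) ^ k" by (simp add: uj Suc power_one_over add_divide_distrib)
      then show ?thesis using Hj(2)[of i'] Suc by simp
    qed
    then show ?thesis using Hj uj by (simp add: j reflect_grid_def)
  qed
  have ulim: "u \<longlonglongrightarrow> d"
  proof (rule tendsto_sandwich[of "\<lambda>_. d" _ _ "\<lambda>k. d + (1/2) ^ k"])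
    have "(\<lambda>k. d + (1/2::real) ^ k) \<longlonglongrightarrow> d + 0" by (intro tendsto_intros LIMSEQ_power_zero) auto
    then show "(\<lambda>k. d + (1/2::real) ^ k) \<longlonglongrightarrow> d" by simp
  qed (use stop in auto)
  have vlim: "(\<lambda>k. 2 * v (u k) - v s) \<longlonglongrightarrow> 2 * v d - v s"
    using v ulim by (intro tendsto_intros isCont_tendsto_compose[of d v]) (auto simp: continuous_on_eq_continuous_at)
  show ?thesis
  proof (cases "s \<le> d")
    case True
    then have "reflect_grid q k (grid_stop C q k v) v s = v s" for k
      using stop[of k] by (auto simp: reflect_after_def)
    moreover have "reflect_at_hit C q v s = v s"
      using True by (auto simp: reflect_at_hit_def cond d_def[symmetric])
    ultimately show ?thesis by simp
  next
    case False
    then have "eventually (\<lambda>k. u k < s) sequentially" using order_tendstoD(2)[OF ulim, of s] by simp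
    then have "eventually (\<lambda>k. 2 * v (u k) - v s = reflect_grid q k (grid_stop C q k v) v s) sequentially"
      by eventually_elim (use stop in \<open>auto simp: reflect_after_def\<close>)
    moreover have "reflect_at_hit C q v s = 2 * v d - v s"
      using False by (auto simp: reflect_at_hit_def cond d_def[symmetric])
    ultimately show ?thesis using vlim by (simp add: tendsto_cong)
  qed
qed

context brownian_motion
begin

text \<open>
  Whether the stop happens at a given grid point \<open>u\<close> depends only on the path up to \<open>u\<close>, which the
  reflection after \<open>u\<close> does not touch.
\<close>

lemma grid_reflection_preserves:
  assumes q: "0 \<le> q"
  shows "(\<lambda>v. reflect_grid q k (grid_stop C q k v) v) \<in> forward_law \<rightarrow>\<^sub>M forward_law"
    "distr forward_law forward_law (\<lambda>v. reflect_grid q k (grid_stop C q k v) v) = forward_law"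
proof -
  have 1: "reflect_grid q k i \<in> forward_law \<rightarrow>\<^sub>M forward_law" for i
    by (cases i) (auto simp: reflect_grid_def)
  have 2: "distr forward_law forward_law (reflect_grid q k i) = forward_law" for i
  proof (cases i)
    case 0 then show ?thesis by (simp add: reflect_grid_def distr_id2)
  next
    case (Suc j) then show ?thesis using q by (simp add: reflect_grid_def reflect_after_preserves)
  qed
  have 3: "grid_stop C q k \<in> forward_law \<rightarrow>\<^sub>M count_space UNIV"
    unfolding grid_stop_def by measurable
  have 4: "grid_stop C q k (reflect_grid q k i v) = i \<longleftrightarrow> grid_stop C q k v = i" for i v
  proof (cases i)
    case 0 then show ?thesis by (simp add: reflect_grid_def)
  next
    case (Suc j)
    have "hits_set C q (q + real i' / 2 ^ k) (reflect_grid q k i v) \<longleftrightarrow> hits_set C q (q + real i' / 2 ^ k) v" if "i' \<le> j" for i'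
    proof (rule hits_set_cong)
      fix x assume "x \<le> q + real i' / 2 ^ k"
      moreover have "real i' / 2 ^ k \<le> real j / 2 ^ k" using that by (simp add: divide_right_mono)
      ultimately show "reflect_grid q k i v x = v x" by (simp add: Suc reflect_grid_def reflect_after_def)
    qed simp
    then show ?thesis by (auto simp: Suc grid_stop_eq_Suc_iff)
  qed
  show "(\<lambda>v. reflect_grid q k (grid_stop C q k v) v) \<in> forward_law \<rightarrow>\<^sub>M forward_law"
    "distr forward_law forward_law (\<lambda>v. reflect_grid q k (grid_stop C q k v) v) = forward_law"
    using measure_preserving_piecewise[where \<Psi> = "reflect_grid q k" and \<kappa> = "grid_stop C q k" and M = forward_law, OF 1 2 3 4]
    by simp_all
qed

lemma V_continuous: "\<omega> \<in> space M \<Longrightarrow> continuous_on UNIV (\<lambda>s. V s \<omega>)"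
  unfolding V_def by (intro continuous_on_compose2[OF W_continuous] continuous_intros) auto

text \<open>
  The reflection principle at the first visit to a closed set, obtained from the discrete times by
  passing to the limit.
\<close>

theorem reflect_at_hit_law:
  assumes q: "0 \<le> q" and C: "closed C" "C \<noteq> {}"
  shows measurable_reflect_at_hit: "(\<lambda>\<omega> s. reflect_at_hit C q (\<lambda>s. V s \<omega>) s) \<in> M \<rightarrow>\<^sub>M (\<Pi>\<^sub>M s\<in>UNIV. borel)"
    and reflect_at_hit_distr: "distr M (\<Pi>\<^sub>M s\<in>UNIV. borel) (\<lambda>\<omega> s. reflect_at_hit C q (\<lambda>s. V s \<omega>) s) = forward_law"
proof -
  let ?\<Phi> = "\<lambda>k v. reflect_grid q k (grid_stop C q k v) v"
  note m = grid_reflection_preserves(1)[OF q, of _ C]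
  have m': "(\<lambda>\<omega>. ?\<Phi> k (\<lambda>s. V s \<omega>)) \<in> M \<rightarrow>\<^sub>M (\<Pi>\<^sub>M s\<in>UNIV. borel)" for k
    using measurable_compose[OF measurable_V_process, of "?\<Phi> k" "\<Pi>\<^sub>M s\<in>UNIV. borel"] m[of k]
    by (simp cong: measurable_cong_sets)
  have meas: "(\<lambda>\<omega>. ?\<Phi> k (\<lambda>s. V s \<omega>) s) \<in> borel_measurable M" for k s
    using measurable_compose[OF m'[of k] measurable_component_singleton[of s UNIV]] by simp
  have law: "distr M (\<Pi>\<^sub>M s\<in>UNIV. borel) (\<lambda>\<omega> s. ?\<Phi> k (\<lambda>s. V s \<omega>) s) = forward_law" for k
  proof -
    have "distr forward_law forward_law (?\<Phi> k) = distr (distr M (\<Pi>\<^sub>M s\<in>UNIV. borel) (\<lambda>\<omega> s. V s \<omega>)) (\<Pi>\<^sub>M s\<in>UNIV. borel) (?\<Phi> k)"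
      unfolding forward_law_def by (rule distr_cong) auto
    also have "\<dots> = distr M (\<Pi>\<^sub>M s\<in>UNIV. borel) (\<lambda>\<omega>. ?\<Phi> k (\<lambda>s. V s \<omega>))"
      using m[of k] by (subst distr_distr) (auto simp: comp_def cong: measurable_cong_sets)
    finally show ?thesis using grid_reflection_preserves(2)[OF q] by simp
  qed
  have lim: "(\<lambda>k. ?\<Phi> k (\<lambda>s. V s \<omega>) s) \<longlonglongrightarrow> reflect_at_hit C q (\<lambda>s. V s \<omega>) s" if "\<omega> \<in> space M" for \<omega> s
    by (rule grid_reflection_limit[OF V_continuous[OF that] C])
  show "distr M (\<Pi>\<^sub>M s\<in>UNIV. borel) (\<lambda>\<omega> s. reflect_at_hit C q (\<lambda>s. V s \<omega>) s) = forward_law"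
    by (rule process_law_limit[where X = "\<lambda>k s \<omega>. ?\<Phi> k (\<lambda>s. V s \<omega>) s", OF prob_space_axioms meas law lim])
  have "(\<lambda>\<omega>. reflect_at_hit C q (\<lambda>s. V s \<omega>) s) \<in> borel_measurable M" for s
    using lim meas by (rule borel_measurable_LIMSEQ_real)
  then show "(\<lambda>\<omega> s. reflect_at_hit C q (\<lambda>s. V s \<omega>) s) \<in> M \<rightarrow>\<^sub>M (\<Pi>\<^sub>M s\<in>UNIV. borel)"
    by (rule measurable_process)
qed

subsection \<open>Brownian motion does not touch a given level at an extremum\<close>

text \<open>
  The maximum is \<open>\<sigma> * (W 1 - W 0)\<close> plus a quantity built from \<open>W 0\<close> and the increments after time 1.
  The first summand is standard normal, independent of the second, and has a density at most 1. The
  bound does not depend on the number of grid points, which lets the grid be refined.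
\<close>

lemma grid_max_concentration:
  fixes \<sigma> c \<delta> p :: real
  assumes \<sigma>: "\<sigma> = 1 \<or> \<sigma> = -1" and p: "p > 0" and \<delta>: "\<delta> > 0"
  shows "prob {\<omega>\<in>space M. \<bar>Max ((\<lambda>i. \<sigma> * W (1 + real i * p) \<omega>) ` {..n}) - c\<bar> \<le> \<delta>} \<le> 2 * \<delta>"
proof -
  \<comment> \<open>The increment with index 1 runs over \<open>[0, 1]\<close> and is the independent normal summand.\<close>
  define t where "t i = (case i of 0 \<Rightarrow> 0 | Suc i \<Rightarrow> 1 + real i * p)" for i :: nat
  have t: "t i < t (Suc i)" for i using p by (cases i) (auto simp: t_def algebra_simps)
  let ?\<Delta> = "increments t"
  have ind: "indep_vars (\<lambda>_. borel) ?\<Delta> {0..Suc n}" using t by (intro increments_indep) auto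
  define A where "A = insert 0 {2..Suc n}"
  have iv: "indep_var (Pi\<^sub>M {1} (\<lambda>_. borel)) (\<lambda>\<omega>. restrict (\<lambda>i. ?\<Delta> i \<omega>) {1}) (Pi\<^sub>M A (\<lambda>_. borel)) (\<lambda>\<omega>. restrict (\<lambda>i. ?\<Delta> i \<omega>) A)"
    by (rule indep_var_restrict[OF ind]) (auto simp: A_def)
  define g :: "(nat \<Rightarrow> real) \<Rightarrow> real" where
    "g z = Max ((\<lambda>i. \<sigma> * z 0 + \<sigma> * (\<Sum>j\<in>{2..Suc i}. z j)) ` {..n})" for z
  have g: "g \<in> borel_measurable (Pi\<^sub>M A (\<lambda>_. borel))"
    unfolding g_def A_def
    by (intro borel_measurable_Max borel_measurable_add borel_measurable_times borel_measurable_sum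
        measurable_component_singleton borel_measurable_const) auto
  define D where "D \<omega> = W 1 \<omega> - W 0 \<omega>" for \<omega>
  define R where "R \<omega> = g (restrict (\<lambda>i. ?\<Delta> i \<omega>) A)" for \<omega>
  have "indep_var borel ((\<lambda>z. z 1) \<circ> (\<lambda>\<omega>. restrict (\<lambda>i. ?\<Delta> i \<omega>) {1})) borel (g \<circ> (\<lambda>\<omega>. restrict (\<lambda>i. ?\<Delta> i \<omega>) A))"
    using g by (intro indep_var_compose[OF iv] measurable_component_singleton) auto
  moreover have "(\<lambda>z. z 1) \<circ> (\<lambda>\<omega>. restrict (\<lambda>i. ?\<Delta> i \<omega>) {1}) = D"
    by (auto simp: fun_eq_iff D_def increments_def t_def)
  ultimately have DR: "indep_var borel D borel R" by (simp add: comp_def R_def[abs_def])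
  have Dm [measurable]: "D \<in> borel_measurable M" unfolding D_def by measurable
  have Rm [measurable]: "R \<in> borel_measurable M" using DR by (rule indep_var_rv2)
  have W_eq: "W (1 + real i * p) \<omega> = W 0 \<omega> + D \<omega> + (\<Sum>j\<in>{2..Suc i}. ?\<Delta> j \<omega>)" for i \<omega>
  proof (induction i)
    case 0 then show ?case by (simp add: D_def)
  next
    case (Suc i)
    have "{2..Suc (Suc i)} = insert (Suc (Suc i)) {2..Suc i}" by auto
    then show ?case using Suc by (simp add: increments_def t_def)
  qed
  have Max_eq: "Max ((\<lambda>i. \<sigma> * W (1 + real i * p) \<omega>) ` {..n}) = \<sigma> * D \<omega> + R \<omega>" for \<omega>
  proof -
    have "(\<lambda>i. \<sigma> * W (1 + real i * p) \<omega>) ` {..n} = (\<lambda>x. \<sigma> * D \<omega> + x) ` (\<lambda>i. \<sigma> * ?\<Delta> 0 \<omega> + \<sigma> * (\<Sum>j\<in>{2..Suc i}. ?\<Delta> j \<omega>)) ` {..n}"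
      unfolding image_image
    proof (intro image_cong refl)
      fix i
      show "\<sigma> * W (1 + real i * p) \<omega> = \<sigma> * D \<omega> + (\<sigma> * ?\<Delta> 0 \<omega> + \<sigma> * (\<Sum>j = 2..Suc i. ?\<Delta> j \<omega>))"
        by (subst W_eq) (simp add: increments_def[of t 0] algebra_simps)
    qed
    then have "Max ((\<lambda>i. \<sigma> * W (1 + real i * p) \<omega>) ` {..n}) = \<sigma> * D \<omega> + Max ((\<lambda>i. \<sigma> * ?\<Delta> 0 \<omega> + \<sigma> * (\<Sum>j\<in>{2..Suc i}. ?\<Delta> j \<omega>)) ` {..n})"
      by (simp add: mono_Max_commute[of "\<lambda>x. \<sigma> * D \<omega> + x", symmetric] mono_def)
    also have "Max ((\<lambda>i. \<sigma> * ?\<Delta> 0 \<omega> + \<sigma> * (\<Sum>j\<in>{2..Suc i}. ?\<Delta> j \<omega>)) ` {..n}) = R \<omega>"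
      unfolding R_def g_def A_def by (intro arg_cong[where f = Max] image_cong) auto
    finally show ?thesis .
  qed
  have bound: "emeasure (distr M borel D) {x. \<bar>\<sigma> * x + r - c\<bar> \<le> \<delta>} \<le> ennreal (2 * \<delta>)" for r
  proof -
    have D_distr: "distr M borel D = density lborel (\<lambda>x. ennreal (normal_density 0 1 x))"
      using distributed_distr_eq_density[OF W_increment[of 0 1]] by (simp add: D_def cong: distr_cong)
    have le1: "normal_density 0 1 x \<le> 1" for x
    proof -
      have "1 \<le> sqrt (2 * pi)" using pi_ge_two by (simp add: real_le_rsqrt)
      then have "1 / sqrt (2 * pi) \<le> 1" by simp
      moreover have "exp (- (x\<^sup>2 / 2)) \<le> 1" by simp
      ultimately show ?thesis unfolding normal_density_def
        by (intro mult_le_one[THEN order.trans]) (auto simp: field_simps)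
    qed
    have I: "{x. \<bar>\<sigma> * x + r - c\<bar> \<le> \<delta>} = {\<sigma> * (c - r) - \<delta> .. \<sigma> * (c - r) + \<delta>}"
      using \<sigma> by (auto simp: abs_le_iff)
    have "emeasure (distr M borel D) {x. \<bar>\<sigma> * x + r - c\<bar> \<le> \<delta>} =
        (\<integral>\<^sup>+x. ennreal (normal_density 0 1 x) * indicator {\<sigma> * (c - r) - \<delta> .. \<sigma> * (c - r) + \<delta>} x \<partial>lborel)"
      unfolding D_distr I by (subst emeasure_density) auto
    also have "\<dots> \<le> (\<integral>\<^sup>+x. indicator {\<sigma> * (c - r) - \<delta> .. \<sigma> * (c - r) + \<delta>} x \<partial>lborel)"
      using le1 by (intro nn_integral_mono) (auto simp: indicator_def ennreal_le_1)
    also have "\<dots> = ennreal (2 * \<delta>)" using \<delta> by simp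
    finally show ?thesis .
  qed
  interpret RD: prob_space "distr M borel R" by (rule prob_space_distr) simp
  interpret DD: prob_space "distr M borel D" by (rule prob_space_distr) simp
  have "emeasure M {\<omega>\<in>space M. \<bar>\<sigma> * D \<omega> + R \<omega> - c\<bar> \<le> \<delta>} =
    emeasure (distr M (borel \<Otimes>\<^sub>M borel) (\<lambda>\<omega>. (D \<omega>, R \<omega>))) {z. \<bar>\<sigma> * fst z + snd z - c\<bar> \<le> \<delta>}"
  proof -
    have "{z::real \<times> real. \<bar>\<sigma> * fst z + snd z - c\<bar> \<le> \<delta>} = {z \<in> space (borel \<Otimes>\<^sub>M borel). \<bar>\<sigma> * fst z + snd z - c\<bar> \<le> \<delta>}"
      by (simp add: space_pair_measure)
    also have "\<dots> \<in> sets (borel \<Otimes>\<^sub>M borel)" by measurable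
    finally show ?thesis by (subst emeasure_distr) (auto simp: vimage_def Int_def conj_commute)
  qed
  also have "\<dots> = emeasure (distr M borel D \<Otimes>\<^sub>M distr M borel R) {z. \<bar>\<sigma> * fst z + snd z - c\<bar> \<le> \<delta>}"
    using DR by (simp add: indep_var_distribution_eq)
  also have "\<dots> = (\<integral>\<^sup>+r. emeasure (distr M borel D) ((\<lambda>x. (x, r)) -` {z. \<bar>\<sigma> * fst z + snd z - c\<bar> \<le> \<delta>}) \<partial>distr M borel R)"
  proof (rule pair_sigma_finite.emeasure_pair_measure_alt2)
    show "pair_sigma_finite (distr M borel D) (distr M borel R)" by unfold_locales
    have "{z::real \<times> real. \<bar>\<sigma> * fst z + snd z - c\<bar> \<le> \<delta>} = {z \<in> space (borel \<Otimes>\<^sub>M borel). \<bar>\<sigma> * fst z + snd z - c\<bar> \<le> \<delta>}"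
      by (simp add: space_pair_measure)
    also have "\<dots> \<in> sets (borel \<Otimes>\<^sub>M borel)" by measurable
    also have "sets (borel \<Otimes>\<^sub>M borel) = sets (distr M borel D \<Otimes>\<^sub>M distr M borel R)"
      by (intro sets_pair_measure_cong) auto
    finally show "{z. \<bar>\<sigma> * fst z + snd z - c\<bar> \<le> \<delta>} \<in> sets (distr M borel D \<Otimes>\<^sub>M distr M borel R)" .
  qed
  also have "\<dots> \<le> (\<integral>\<^sup>+r. ennreal (2 * \<delta>) \<partial>distr M borel R)"
    using bound by (intro nn_integral_mono) (simp add: vimage_def)
  also have "\<dots> = ennreal (2 * \<delta>)" using RD.emeasure_space_1 by simp
  finally show ?thesis using \<delta> by (simp add: Max_eq emeasure_eq_measure)
qed

text \<open>
  By continuity the maxima over finer and finer grids converge to the maximum over the interval, and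
  each of them lies within \<open>\<delta>\<close> of \<open>c\<close> with probability at most \<open>2 * \<delta>\<close>. The sign \<open>\<sigma>\<close> covers
  maxima and minima at once.
\<close>

lemma no_extremum_at_level:
  fixes \<sigma> c p :: real
  assumes \<sigma>: "\<sigma> = 1 \<or> \<sigma> = -1" and p: "p > 0"
  shows "AE \<omega> in M. \<not> (\<exists>y\<in>{1..1+p}. \<sigma> * W y \<omega> = c \<and> (\<forall>x\<in>{1..1+p}. \<sigma> * W x \<omega> \<le> c))"
proof -
  define mx where "mx n \<omega> = Max ((\<lambda>i. \<sigma> * W (1 + real i * (p / 2 ^ n)) \<omega>) ` {..2 ^ n})" for n :: nat and \<omega>
  have mx_meas [measurable]: "mx n \<in> borel_measurable M" for n
    unfolding mx_def by (intro borel_measurable_Max) auto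
  define A where "A \<delta> N = {\<omega>\<in>space M. \<forall>n\<ge>N. \<bar>mx n \<omega> - c\<bar> \<le> \<delta>}" for \<delta> and N :: nat
  have A_meas [measurable]: "A \<delta> N \<in> sets M" for \<delta> N unfolding A_def by measurable
  have bound: "prob (\<Union>N. A \<delta> N) \<le> 2 * \<delta>" if "\<delta> > 0" for \<delta>
  proof (rule LIMSEQ_le_const2)
    show "(\<lambda>N. prob (A \<delta> N)) \<longlonglongrightarrow> prob (\<Union>N. A \<delta> N)"
      by (intro finite_Lim_measure_incseq) (auto simp: incseq_def A_def)
    have "prob (A \<delta> N) \<le> 2 * \<delta>" for N
    proof -
      have "prob (A \<delta> N) \<le> prob {\<omega>\<in>space M. \<bar>mx N \<omega> - c\<bar> \<le> \<delta>}"
        by (intro finite_measure_mono) (auto simp: A_def)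
      also have "\<dots> \<le> 2 * \<delta>"
        unfolding mx_def using grid_max_concentration[OF \<sigma> _ that, of "p / 2 ^ N"] p by simp
      finally show ?thesis .
    qed
    then show "\<exists>n0. \<forall>N\<ge>n0. prob (A \<delta> N) \<le> 2 * \<delta>" by blast
  qed
  define Z where "Z = (\<Inter>k. \<Union>N. A (1 / real (Suc k)) N)"
  have Zm: "Z \<in> sets M" unfolding Z_def by measurable
  have "prob Z \<le> 0"
  proof (rule field_le_epsilon)
    fix e :: real assume "e > 0"
    then obtain k where k: "1 / real (Suc k) < e / 2" using nat_approx_posE[of "e/2"] by auto
    have "prob Z \<le> prob (\<Union>N. A (1 / real (Suc k)) N)"
      unfolding Z_def by (intro finite_measure_mono) auto
    also have "\<dots> \<le> 2 * (1 / real (Suc k))" by (intro bound) simp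
    also have "\<dots> \<le> 0 + e" using k by simp
    finally show "prob Z \<le> 0 + e" .
  qed
  then have "Z \<in> null_sets M" using Zm by (simp add: null_sets_def emeasure_eq_measure measure_le_0_iff)
  moreover have "{\<omega>\<in>space M. \<not> \<not> (\<exists>y\<in>{1..1+p}. \<sigma> * W y \<omega> = c \<and> (\<forall>x\<in>{1..1+p}. \<sigma> * W x \<omega> \<le> c))} \<subseteq> Z"
  proof (rule subsetI)
    fix \<omega> assume "\<omega> \<in> {\<omega>\<in>space M. \<not> \<not> (\<exists>y\<in>{1..1+p}. \<sigma> * W y \<omega> = c \<and> (\<forall>x\<in>{1..1+p}. \<sigma> * W x \<omega> \<le> c))}"
    then obtain y where \<omega>: "\<omega> \<in> space M" and y: "y \<in> {1..1+p}" "\<sigma> * W y \<omega> = c" and le: "\<forall>x\<in>{1..1+p}. \<sigma> * W x \<omega> \<le> c"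
      by auto
    have "isCont (\<lambda>s. \<sigma> * W s \<omega>) y"
      using W_continuous[OF \<omega>] by (auto simp: continuous_on_eq_continuous_at intro!: continuous_intros)
    have "\<exists>N. \<omega> \<in> A \<delta> N" if \<delta>: "\<delta> > 0" for \<delta>
    proof -
      obtain d where d: "d > 0" "\<And>x. \<bar>x - y\<bar> < d \<Longrightarrow> \<bar>\<sigma> * W x \<omega> - c\<bar> < \<delta>"
        using \<open>isCont (\<lambda>s. \<sigma> * W s \<omega>) y\<close> \<delta> y(2) unfolding continuous_at_eps_delta dist_real_def by blast
      obtain N where N: "(1/2) ^ N < d / p" using real_arch_pow_inv[of "d / p" "1/2"] d p by auto
      have "\<bar>mx n \<omega> - c\<bar> \<le> \<delta>" if "n \<ge> N" for n
      proof -
        have pn: "p / 2 ^ n < d"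
        proof -
          have "(1/2::real) ^ n \<le> (1/2) ^ N" using that by (intro power_decreasing) auto
          then have "(1/2) ^ n < d / p" using N by linarith
          then show ?thesis using p by (simp add: field_simps power_one_over)
        qed
        define i where "i = nat \<lfloor>(y - 1) * 2 ^ n / p\<rfloor>"
        have y0: "0 \<le> (y - 1) * 2 ^ n / p" using y p by simp
        then have fl: "real i \<le> (y - 1) * 2 ^ n / p" "(y - 1) * 2 ^ n / p < real i + 1"
          unfolding i_def by linarith+
        have "(y - 1) * 2 ^ n / p \<le> 2 ^ n" using y p by (simp add: divide_le_eq mult.commute)
        then have "real i \<le> 2 ^ n" using fl(1) by linarith
        then have "real i \<le> real (2 ^ n)" by simp
        then have i: "i \<in> {..2 ^ n}" by (simp only: of_nat_le_iff atMost_iff)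
        have a1: "real i * (p / 2 ^ n) \<le> y - 1" using fl(1) p by (simp add: field_simps)
        have a2: "y - 1 < real i * (p / 2 ^ n) + p / 2 ^ n" using fl(2) p by (simp add: field_simps)
        have close: "\<bar>1 + real i * (p / 2 ^ n) - y\<bar> < d" using a1 a2 pn d(1) unfolding abs_less_iff by linarith
        have "\<sigma> * W (1 + real i * (p / 2 ^ n)) \<omega> \<le> mx n \<omega>"
          unfolding mx_def using i by (intro Max_ge) auto
        then have lower: "c - \<delta> \<le> mx n \<omega>" using d(2)[OF close] by (simp add: abs_if split: if_splits)
        have "mx n \<omega> \<le> c" unfolding mx_def
        proof (subst Max_le_iff; safe?)
          fix j :: nat assume "j \<le> 2 ^ n"
          then have "real j \<le> 2 ^ n" by (metis of_nat_le_iff of_nat_numeral of_nat_power)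
          then have "real j * (p / 2 ^ n) \<le> 2 ^ n * (p / 2 ^ n)" using p by (intro mult_right_mono) auto
          then have "1 + real j * (p / 2 ^ n) \<in> {1..1+p}" using p by simp
          then show "\<sigma> * W (1 + real j * (p / 2 ^ n)) \<omega> \<le> c" using le by blast
        qed auto
        then show ?thesis using lower \<delta> by simp
      qed
      then show ?thesis using \<omega> by (auto simp: A_def)
    qed
    then show "\<omega> \<in> Z" by (auto simp: Z_def)
  qed
  ultimately show ?thesis by (intro AE_I')
qed

subsection \<open>Large increments occur\<close>

text \<open>
  Unit increments are independent and exceed \<open>K\<close> with the same positive probability.
\<close>

lemma large_increment_occurs:
  "AE \<omega> in M. \<exists>i::nat. W (real i + 1) \<omega> - W (real i) \<omega> > K"
proof -
  define p where "p = prob {\<omega>\<in>space M. W 1 \<omega> - W 0 \<omega> \<le> K}"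
  let ?dens = "\<lambda>x. ennreal (normal_density 0 1 x)"
  have D_distr: "distr M lborel (\<lambda>\<omega>. W (s + 1) \<omega> - W s \<omega>) = density lborel ?dens" for s
    using distributed_distr_eq_density[OF W_increment[of s "s + 1"]] by simp
  have em: "emeasure M {\<omega>\<in>space M. W (s + 1) \<omega> - W s \<omega> \<in> A} = emeasure (density lborel ?dens) A"
    if "A \<in> sets borel" for s A
    unfolding D_distr[of s, symmetric] using that by (subst emeasure_distr) (auto intro!: arg_cong2[where f = emeasure])
  have p: "prob {\<omega>\<in>space M. W (s + 1) \<omega> - W s \<omega> \<le> K} = p" for s
    using em[of "{..K}" s] em[of "{..K}" 0] by (simp add: p_def measure_def)
  have "emeasure M {\<omega>\<in>space M. W (0 + 1) \<omega> - W 0 \<omega> \<in> {K<..}} \<noteq> 0"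
  proof
    assume "emeasure M {\<omega>\<in>space M. W (0 + 1) \<omega> - W 0 \<omega> \<in> {K<..}} = 0"
    then have "(\<integral>\<^sup>+x. ?dens x * indicator {K<..} x \<partial>lborel) = 0"
      using em[of "{K<..}" 0] by (simp add: emeasure_density)
    then have "AE x in lborel. ?dens x * indicator {K<..} x = 0"
      by (subst (asm) nn_integral_0_iff_AE) auto
    then have "AE x in lborel. x \<notin> {K<..}"
      by eventually_elim (use normal_density_pos[of 1 0] in \<open>auto simp: indicator_def ennreal_eq_0_iff not_le[symmetric] split: if_splits\<close>)
    then have "emeasure lborel {K<..} = 0"
      by (subst (asm) AE_iff_measurable[OF _ refl]) (auto simp: greaterThan_def)
    moreover have "emeasure lborel {K<..<K+1} \<le> emeasure lborel {K<..}" by (intro emeasure_mono) auto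
    ultimately show False by simp
  qed
  then have gt: "prob {\<omega>\<in>space M. W 1 \<omega> - W 0 \<omega> > K} > 0"
    by (simp add: emeasure_eq_measure zero_less_measure_iff)
  have p01: "0 \<le> p" "p < 1"
  proof -
    have "prob {\<omega>\<in>space M. W 1 \<omega> - W 0 \<omega> > K} = 1 - p"
      unfolding p_def by (subst prob_compl[symmetric]) (auto intro!: arg_cong[where f = prob])
    then show "p < 1" using gt by simp
    show "0 \<le> p" by (simp add: p_def)
  qed
  let ?B = "{\<omega>\<in>space M. \<forall>i::nat. W (real i + 1) \<omega> - W (real i) \<omega> \<le> K}"
  have le: "prob ?B \<le> p ^ n" for n
  proof (cases "n = 0")
    case False
    have ind: "indep_vars (\<lambda>_. borel) (increments real) {0..n}" by (intro increments_indep) auto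
    have "prob ?B \<le> prob (\<Inter>i\<in>{1..n}. increments real i -` {..K} \<inter> space M)"
    proof (intro finite_measure_mono)
      show "?B \<subseteq> (\<Inter>i\<in>{1..n}. increments real i -` {..K} \<inter> space M)"
      proof (intro subsetI INT_I)
        fix \<omega> i assume *: "\<omega> \<in> ?B" "i \<in> {1..n}"
        then obtain j where "i = Suc j" by (cases i) auto
        then show "\<omega> \<in> increments real i -` {..K} \<inter> space M" using *(1) by (auto simp: increments_def add.commute)
      qed
    qed (use False in auto)
    also have "\<dots> = (\<Prod>i\<in>{1..n}. prob (increments real i -` {..K} \<inter> space M))"
      using False by (intro indep_varsD[OF ind]) auto
    also have "\<dots> = p ^ n"
    proof -
      have "prob (increments real i -` {..K} \<inter> space M) = p" if "i \<in> {1..n}" for i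
      proof -
        from that obtain j where j: "i = Suc j" by (cases i) auto
        have "increments real i -` {..K} \<inter> space M = {\<omega>\<in>space M. W (real j + 1) \<omega> - W (real j) \<omega> \<le> K}"
          by (auto simp: increments_def j add.commute)
        then show ?thesis using p[of "real j"] by simp
      qed
      then show ?thesis by simp
    qed
    finally show ?thesis .
  qed simp
  have "(\<lambda>n. p ^ n) \<longlonglongrightarrow> 0" using p01 by (intro LIMSEQ_power_zero) simp
  then have "prob ?B \<le> 0" using le by (intro LIMSEQ_le_const) auto
  then have "?B \<in> null_sets M" by (simp add: null_sets_def emeasure_eq_measure measure_le_0_iff)
  then show ?thesis by (rule AE_I'[of ?B]) (auto simp: not_less)
qed

end

section \<open>The folding map\<close>

text \<open>
  Distinct multiples of \<open>2 * h\<close> are at least \<open>2 * h\<close> apart, so a multiple within distance \<open>h\<close> of \<open>x\<close> is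
  a nearest one. Thus \<open>reflect h x\<close> is the distance from \<open>x\<close> to the multiples of \<open>2 * h\<close>.
\<close>

lemma reflect_eq:
  assumes h: "h > 0" and n: "\<bar>x - 2 * of_int n * h\<bar> \<le> h"
  shows "reflect h x = \<bar>x - 2 * of_int n * h\<bar>" "\<bar>x - 2 * of_int n * h\<bar> \<le> \<bar>x - 2 * of_int k * h\<bar>"
proof -
  have min: "\<bar>x - 2 * of_int i * h\<bar> \<le> \<bar>x - 2 * of_int j * h\<bar>" if "\<bar>x - 2 * of_int i * h\<bar> \<le> h" for i j :: int
  proof (cases "i = j")
    case False
    then have "1 \<le> \<bar>real_of_int i - of_int j\<bar>" by linarith
    then have "2 * h \<le> 2 * h * \<bar>real_of_int i - of_int j\<bar>" using h by simp
    also have "\<dots> = \<bar>2 * of_int i * h - 2 * of_int j * h\<bar>"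
    proof -
      have "2 * of_int i * h - 2 * of_int j * h = 2 * h * (real_of_int i - of_int j)" by (simp add: algebra_simps)
      then show ?thesis using h by (simp add: abs_mult)
    qed
    finally show ?thesis using that by linarith
  qed simp
  then show "\<bar>x - 2 * of_int n * h\<bar> \<le> \<bar>x - 2 * of_int k * h\<bar>" using n by blast
  define n' where "n' = (SOME n::int. \<bar>x - 2 * of_int n * h\<bar> \<le> h)"
  have "\<bar>x - 2 * of_int n' * h\<bar> \<le> h" unfolding n'_def using n by (rule someI)
  then show "reflect h x = \<bar>x - 2 * of_int n * h\<bar>"
    unfolding reflect_def n'_def[symmetric] using min[of n n'] min[of n' n] n by linarith
qed

lemma reflect_witness:
  assumes h: "h > 0"
  obtains n :: int where "\<bar>x - 2 * of_int n * h\<bar> \<le> h" "reflect h x = \<bar>x - 2 * of_int n * h\<bar>"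
proof -
  define n where "n = \<lfloor>x / (2 * h) + 1 / 2\<rfloor>"
  have "of_int n \<le> x / (2 * h) + 1 / 2" "x / (2 * h) + 1 / 2 < of_int n + 1" unfolding n_def by linarith+
  then have "\<bar>x - 2 * of_int n * h\<bar> \<le> h" using h by (simp add: field_simps abs_le_iff)
  then show ?thesis using that reflect_eq(1)[OF h] by blast
qed

lemma reflect_bounds:
  assumes "h > 0" shows "0 \<le> reflect h x" "reflect h x \<le> h"
proof -
  obtain n :: int where n: "\<bar>x - 2 * of_int n * h\<bar> \<le> h" "reflect h x = \<bar>x - 2 * of_int n * h\<bar>"
    using reflect_witness[OF assms] by blast
  show "0 \<le> reflect h x" "reflect h x \<le> h" unfolding n(2) using n(1) by simp_all
qed

lemma reflect_lipschitz:
  assumes h: "h > 0" shows "\<bar>reflect h x - reflect h y\<bar> \<le> \<bar>x - y\<bar>"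
proof -
  have "reflect h x \<le> reflect h y + \<bar>x - y\<bar>" for x y
  proof -
    obtain n :: int where n: "\<bar>x - 2 * of_int n * h\<bar> \<le> h" "reflect h x = \<bar>x - 2 * of_int n * h\<bar>"
      using reflect_witness[OF h] by blast
    obtain k :: int where k: "reflect h y = \<bar>y - 2 * of_int k * h\<bar>"
      using reflect_witness[OF h, of y] by blast
    show ?thesis using reflect_eq(2)[OF h n(1), of k] n(2) k by linarith
  qed
  from this[of x y] this[of y x] show ?thesis by linarith
qed

lemma continuous_on_reflect:
  assumes "h > 0" shows "continuous_on UNIV (reflect h)"
  unfolding continuous_on_iff dist_real_def
  using reflect_lipschitz[OF assms] by (metis le_less_trans)

lemma reflect_minus:
  assumes h: "h > 0" shows "reflect h (- x) = reflect h x"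
proof -
  obtain n :: int where n: "\<bar>x - 2 * of_int n * h\<bar> \<le> h" "reflect h x = \<bar>x - 2 * of_int n * h\<bar>"
    using reflect_witness[OF h] by blast
  have "\<bar>- x - 2 * of_int (- n) * h\<bar> = \<bar>x - 2 * of_int n * h\<bar>" by simp
  then show ?thesis using reflect_eq(1)[OF h, of "- x" "- n"] n by simp
qed

lemma reflect_periodic:
  assumes h: "h > 0" shows "reflect h (x + 2 * of_int k * h) = reflect h x"
proof -
  obtain n :: int where n: "\<bar>x - 2 * of_int n * h\<bar> \<le> h" "reflect h x = \<bar>x - 2 * of_int n * h\<bar>"
    using reflect_witness[OF h] by blast
  have "x + 2 * of_int k * h - 2 * of_int (n + k) * h = x - 2 * of_int n * h" by (simp add: algebra_simps)
  then show ?thesis using reflect_eq(1)[OF h, of "x + 2 * of_int k * h" "n + k"] n by simp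
qed

lemma reflect_half_period:
  assumes h: "h > 0" shows "reflect h (x + h) = h - reflect h x"
proof -
  obtain n :: int where n: "\<bar>x - 2 * of_int n * h\<bar> \<le> h" "reflect h x = \<bar>x - 2 * of_int n * h\<bar>"
    using reflect_witness[OF h] by blast
  show ?thesis
  proof (cases "x - 2 * of_int n * h \<le> 0")
    case True
    then show ?thesis using reflect_eq(1)[OF h, of "x + h" n] n by simp
  next
    case False
    moreover have "x + h - 2 * of_int (n + 1) * h = x - 2 * of_int n * h - h" by (simp add: algebra_simps)
    ultimately show ?thesis using reflect_eq(1)[OF h, of "x + h" "n + 1"] n h by simp
  qed
qed

text \<open>
  The points of the line that fold to the midpoint of \<open>[0, h]\<close>.
\<close>

definition mid_points :: "real \<Rightarrow> real set" where
  "mid_points h = {c. reflect h c = h / 2}"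

lemma mid_pointsE:
  assumes h: "h > 0" and c: "c \<in> mid_points h"
  obtains k :: int where "c = h / 2 + of_int k * h"
proof -
  obtain n :: int where n: "reflect h c = \<bar>c - 2 * of_int n * h\<bar>"
    using reflect_witness[OF h] by blast
  then have "c = h / 2 + of_int (2 * n) * h \<or> c = h / 2 + of_int (2 * n - 1) * h"
    using c by (auto simp: mid_points_def abs_if algebra_simps split: if_splits)
  then show ?thesis using that by blast
qed

lemma reflect_near_mid_point:
  assumes h: "h > 0" and c: "c = h / 2 + of_int k * h" and e: "\<bar>e\<bar> \<le> h / 2"
  shows "reflect h (c + e) = (if even k then h / 2 + e else h / 2 - e)"
proof (cases "even k")
  case True
  then obtain n where "k = 2 * n" by blast
  then have "c + e - 2 * of_int n * h = h / 2 + e" by (simp add: c)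
  then show ?thesis using reflect_eq(1)[OF h, of "c + e" n] True e by (simp add: abs_le_iff)
next
  case False
  then obtain n where "k = 2 * n + 1" by (elim oddE)
  then have "c + e - 2 * of_int (n + 1) * h = e - h / 2" by (simp add: c algebra_simps)
  then show ?thesis using reflect_eq(1)[OF h, of "c + e" "n + 1"] False e by (simp add: abs_le_iff)
qed

lemma mid_points_iff:
  assumes h: "h > 0" shows "c \<in> mid_points h \<longleftrightarrow> (\<exists>k::int. c = h / 2 + of_int k * h)"
  using mid_pointsE[OF h, of c] reflect_near_mid_point[OF h, of c _ 0] h by (auto simp: mid_points_def)

text \<open>
  Point reflection of the unfolded path about such a \<open>c\<close> becomes reflection of the folded path about
  the midpoint of the interval.
\<close>

lemma reflect_point_symmetry:
  assumes h: "h > 0" and c: "c \<in> mid_points h"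
  shows "reflect h (2 * c - x) = h - reflect h x"
proof -
  obtain k :: int where k: "c = h / 2 + of_int k * h" using mid_pointsE[OF h c] .
  have eq: "2 * c - x = (- x + h) + 2 * of_int k * h" by (simp add: k)
  show ?thesis unfolding eq reflect_periodic[OF h] reflect_half_period[OF h] reflect_minus[OF h] ..
qed

lemma mid_points:
  assumes h: "h > 0" shows "closed (mid_points h)" "mid_points h \<noteq> {}" "countable (mid_points h)"
proof -
  have "mid_points h = reflect h -` {h / 2}" by (auto simp: mid_points_def)
  then show "closed (mid_points h)" using closed_vimage[OF _ continuous_on_reflect[OF h], of "{h/2}"] by simp
  show "mid_points h \<noteq> {}" using mid_points_iff[OF h, of "h / 2"] by (auto intro!: exI[of _ 0])
  have "mid_points h = range (\<lambda>k::int. h / 2 + of_int k * h)" using mid_points_iff[OF h] by auto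
  then show "countable (mid_points h)" by simp
qed

section \<open>Excursions from a level\<close>

text \<open>
  Excursions of a path away from the level \<open>m\<close>; those that rise higher than \<open>\<eta>\<close> on either side
  count as large.
\<close>

locale level =
  fixes m \<eta> :: real
  assumes \<eta>: "0 < \<eta>"
begin

definition hits :: "(real \<Rightarrow> real) \<Rightarrow> real \<Rightarrow> real \<Rightarrow> bool" where
  "hits f x y \<longleftrightarrow> (\<exists>z\<in>{x..y}. f z = m)"

definition big :: "(real \<Rightarrow> real) \<Rightarrow> real \<Rightarrow> bool" where
  "big f q \<longleftrightarrow> \<eta> < \<bar>f q - m\<bar>"

text \<open>
  Reflection about \<open>m\<close> from the first visit to \<open>m\<close> after time \<open>q\<close> on. It changes neither the zero set
  of \<open>f - m\<close> nor the distance to \<open>m\<close>.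
\<close>

definition flip :: "real \<Rightarrow> (real \<Rightarrow> real) \<Rightarrow> real \<Rightarrow> real" where
  "flip q f s = (if hits f q s then 2 * m - f s else f s)"

lemma hitsI: "x \<le> z \<Longrightarrow> z \<le> y \<Longrightarrow> f z = m \<Longrightarrow> hits f x y"
  by (auto simp: hits_def)

lemma hits_mono: "hits f x y \<Longrightarrow> x' \<le> x \<Longrightarrow> y \<le> y' \<Longrightarrow> hits f x' y'"
  by (force simp: hits_def)

lemma hits_iff_hits_set:
  assumes "continuous_on UNIV f"
  shows "hits f x y \<longleftrightarrow> x \<le> y \<and> hits_set {m} x y f"
proof (cases "x \<le> y")
  case True
  have "hits_set {m} x y f \<longleftrightarrow> (\<exists>z\<in>{x..y}. f z \<in> {m})" using True by (intro hits_set_iff[OF assms]) simp_all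
  then show ?thesis using True by (simp add: hits_def)
qed (simp add: hits_def)

lemma flip_level [simp]: "flip q f s = m \<longleftrightarrow> f s = m"
  by (auto simp: flip_def)

lemma hits_flip [simp]: "hits (flip q f) x y \<longleftrightarrow> hits f x y"
  by (simp add: hits_def)

lemma big_flip [simp]: "big (flip q f) x \<longleftrightarrow> big f x"
  by (auto simp: big_def flip_def)

lemma hits_iff_hit_time:
  assumes "continuous_on UNIV f" "q \<le> x" "f x = m"
  shows "hits f q s \<longleftrightarrow> hit_time {m} q f \<le> s"
proof
  assume "hits f q s"
  then obtain z where "q \<le> z" "z \<le> s" "f z = m" by (auto simp: hits_def)
  then show "hit_time {m} q f \<le> s" using hit_time(3)[OF assms(1), of "{m}" q z] by simp
next
  assume "hit_time {m} q f \<le> s"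
  then show "hits f q s"
    using hit_time[OF assms(1), of "{m}" q x] assms(2,3) by (intro hitsI[of q "hit_time {m} q f"]) simp_all
qed

text \<open>
  If \<open>d\<close> is the time of the first visit then the flipped path is \<open>f (min s d) + m - f (max s d)\<close>.
\<close>

lemma continuous_on_flip:
  assumes f: "continuous_on UNIV f"
  shows "continuous_on UNIV (flip q f)"
proof (cases "\<exists>x\<ge>q. f x = m")
  case False
  then have "flip q f = f" by (force simp: flip_def hits_def)
  then show ?thesis using f by simp
next
  case True
  then obtain x where x: "q \<le> x" "f x = m" by blast
  define d where "d = hit_time {m} q f"
  have d: "f d = m" using hit_time(2)[OF f, of "{m}" q x] x by (simp add: d_def)
  have "flip q f s = f (min s d) + m - f (max s d)" for s
  proof (cases "d \<le> s")
    case True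
    then show ?thesis using d hits_iff_hit_time[OF f x, of s]
      by (simp add: flip_def d_def[symmetric] min_absorb2 max_absorb1)
  next
    case False
    then show ?thesis using d hits_iff_hit_time[OF f x, of s]
      by (simp add: flip_def d_def[symmetric] min_absorb1 max_absorb2)
  qed
  moreover have "continuous_on UNIV (\<lambda>s. f (min s d) + m - f (max s d))"
    by (intro continuous_intros continuous_on_compose2[OF f]) auto
  ultimately show ?thesis by presburger
qed

lemma flip_shift: "flip q (path_shift t f) s = flip (q - t) f (s - t)"
  and hits_shift: "hits (path_shift t f) x y = hits f (x - t) (y - t)"
  and big_shift: "big (path_shift t f) q = big f (q - t)"
proof -
  show *: "hits (path_shift t f) x y = hits f (x - t) (y - t)" for x y
  proof
    assume "hits (path_shift t f) x y"
    then obtain z where "z \<in> {x..y}" "f (z - t) = m" by (auto simp: hits_def path_shift_def)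
    then show "hits f (x - t) (y - t)" by (intro hitsI[of _ "z - t"]) auto
  next
    assume "hits f (x - t) (y - t)"
    then obtain z where "z \<in> {x - t..y - t}" "f z = m" by (auto simp: hits_def)
    then show "hits (path_shift t f) x y" by (intro hitsI[of _ "z + t"]) (auto simp: path_shift_def)
  qed
  show "flip q (path_shift t f) s = flip (q - t) f (s - t)"
    by (simp add: flip_def *) (simp add: path_shift_def)
  show "big (path_shift t f) q = big f (q - t)" by (simp add: big_def path_shift_def)
qed

text \<open>
  The witnesses are rational multiples of the length of the interval, which makes the property a
  measurable one and stable under real translations.
\<close>

definition crosses :: "(real \<Rightarrow> real) \<Rightarrow> real \<Rightarrow> real \<Rightarrow> bool" where
  "crosses f x y \<longleftrightarrow> (hits f x y \<longrightarrow>
     (\<exists>r\<in>\<rat> \<inter> {0..1}. f (x + (y - x) * r) < m) \<and> (\<exists>r\<in>\<rat> \<inter> {0..1}. m < f (x + (y - x) * r)))"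

lemma crossesD:
  assumes "crosses f x y" "hits f x y" "x < y"
  obtains s s' where "s \<in> {x..y}" "s' \<in> {x..y}" "f s < m" "m < f s'"
proof -
  obtain r r' where r: "r \<in> {0..1}" "f (x + (y - x) * r) < m" "r' \<in> {0..1}" "m < f (x + (y - x) * r')"
    using assms unfolding crosses_def by blast
  have "x + (y - x) * r \<in> {x..y}" if "r \<in> {0..1}" for r :: real
  proof -
    have "(y - x) * r \<le> y - x" using that assms(3) mult_left_le[of r "y - x"] by simp
    moreover have "0 \<le> (y - x) * r" using that assms(3) by simp
    moreover have "0 \<le> d \<Longrightarrow> d \<le> y - x \<Longrightarrow> x + d \<in> {x..y}" for d by simp
    ultimately show ?thesis by blast
  qed
  then show ?thesis using that[of "x + (y - x) * r" "x + (y - x) * r'"] r by blast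
qed

lemma dense_open_values:
  fixes f :: "real \<Rightarrow> real" and U :: "real set"
  assumes f: "continuous_on UNIV f" and U: "open U" and s: "s \<in> {x..y}" "f s \<in> U" "x < y"
  shows "\<exists>r\<in>\<rat> \<inter> {0..1}. f (x + (y - x) * r) \<in> U"
proof -
  define r0 where "r0 = (s - x) / (y - x)"
  have "0 < y - x" using s by simp
  then have r0: "r0 \<in> {0..1}" "s = x + (y - x) * r0" using s by (simp_all add: r0_def divide_le_eq)
  let ?g = "\<lambda>r. f (x + (y - x) * r)"
  have "continuous_on UNIV ?g" by (intro continuous_on_compose2[OF f] continuous_intros) auto
  then have "open (?g -` U)" using U by (rule open_vimage[rotated])
  moreover have "r0 \<in> ?g -` U" using s r0 by simp
  ultimately obtain e where e: "e > 0" "\<And>r. \<bar>r - r0\<bar> < e \<Longrightarrow> ?g r \<in> U"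
    unfolding open_dist dist_real_def by blast
  have "\<exists>r\<in>\<rat>. max 0 (r0 - e) < r \<and> r < min 1 (r0 + e)"
    using e(1) r0(1) by (intro Rats_dense_in_real) auto
  then obtain r where "r \<in> \<rat>" "max 0 (r0 - e) < r" "r < min 1 (r0 + e)" by blast
  then show ?thesis using e(2)[of r] by (intro bexI[of _ r]) auto
qed

definition returns :: "(real \<Rightarrow> real) \<Rightarrow> real \<Rightarrow> real \<Rightarrow> bool" where
  "returns f s t \<longleftrightarrow> (\<exists>r\<in>\<rat>. 0 \<le> r \<and> s + r \<le> t \<and> big f (s + r) \<and> hits f (s + r) t)"

text \<open>
  The properties of a typical path that the construction needs: a path that touches \<open>m\<close> crosses it,
  which is required of the flipped paths as well, and large excursions end arbitrarily far to
  the left.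
\<close>

definition regular :: "(real \<Rightarrow> real) \<Rightarrow> bool" where
  "regular f \<longleftrightarrow> (\<forall>x\<in>\<rat>. \<forall>y\<in>\<rat>. x < y \<longrightarrow> crosses f x y \<and> (\<forall>q\<in>\<rat>. crosses (flip q f) x y)) \<and>
     (\<forall>k::nat. \<exists>n::nat. returns f (- real k - real n) (- real k))"

end

section \<open>Measurability on path space\<close>

definition paths :: "real \<Rightarrow> real \<Rightarrow> (real \<Rightarrow> real) set" where
  "paths a b = {f. continuous_on UNIV f \<and> range f \<subseteq> {a..b}}"

lemma space_path_space [simp]: "space (path_space a b) = paths a b"
  by (simp add: path_space_def space_restrict_space space_PiM paths_def)

lemma measurable_path_eval [measurable]: "(\<lambda>f. f s) \<in> borel_measurable (path_space a b)"
  unfolding path_space_def by (intro measurable_restrict_space1 measurable_component_singleton) simp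

lemma measurable_into_path_space:
  assumes "\<And>s. (\<lambda>x. F x s) \<in> borel_measurable N" "\<And>x. x \<in> space N \<Longrightarrow> F x \<in> paths a b"
  shows "F \<in> N \<rightarrow>\<^sub>M path_space a b"
  unfolding path_space_def
proof (rule measurable_restrict_space2)
  show "F \<in> space N \<rightarrow> {f. continuous_on UNIV f \<and> range f \<subseteq> {a..b}}" using assms(2) by (auto simp: paths_def)
  show "F \<in> N \<rightarrow>\<^sub>M (\<Pi>\<^sub>M s\<in>UNIV. borel)" using measurable_process[of "\<lambda>s x. F x s", OF assms(1)] by simp
qed

lemma measurable_path_id [measurable]: "(\<lambda>f. f) \<in> path_space a b \<rightarrow>\<^sub>M (\<Pi>\<^sub>M s\<in>UNIV. borel)"
  by (rule measurable_process[of "\<lambda>s f. f s"]) simp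

lemma path_measure_eqI:
  assumes "prob_space \<mu>" "sets \<mu> = sets (path_space a b)" "sets \<nu> = sets (path_space a b)"
    and eq: "\<And>J c. finite J \<Longrightarrow> emeasure \<mu> {f\<in>paths a b. \<forall>s\<in>J. f s \<le> c s} = emeasure \<nu> {f\<in>paths a b. \<forall>s\<in>J. f s \<le> c s}"
  shows "\<mu> = \<nu>"
proof (rule measure_eqI)
  let ?R = "(\<Pi>\<^sub>M s\<in>UNIV. (borel :: real measure)) :: (real \<Rightarrow> real) measure"
  interpret prob_space \<mu> by fact
  have sp: "space \<mu> = paths a b" "space \<nu> = paths a b" using assms(2,3)[THEN sets_eq_imp_space_eq] by auto
  have coord: "(\<lambda>f. f s) \<in> borel_measurable \<mu>" "(\<lambda>f. f s) \<in> borel_measurable \<nu>" for s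
    using assms(2,3) measurable_path_eval by (simp_all cong: measurable_cong_sets)
  have id: "(\<lambda>f. f) \<in> \<mu> \<rightarrow>\<^sub>M ?R" "(\<lambda>f. f) \<in> \<nu> \<rightarrow>\<^sub>M ?R"
    using assms(2,3) measurable_path_id by (simp_all cong: measurable_cong_sets)
  have "distr \<mu> ?R (\<lambda>f s. f s) = distr \<nu> ?R (\<lambda>f s. f s)"
  proof (rule process_law_eqI)
    show "prob_space (distr \<mu> ?R (\<lambda>f s. f s))" using id by (intro prob_space_distr) simp
    fix J :: "real set" and c :: "real \<Rightarrow> real" assume "finite J"
    then show "emeasure (distr \<mu> ?R (\<lambda>f s. f s)) {x. \<forall>s\<in>J. x s \<le> c s} = emeasure (distr \<nu> ?R (\<lambda>f s. f s)) {x. \<forall>s\<in>J. x s \<le> c s}"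
      using eq[of J c] emeasure_process_orthant[of "\<lambda>s f. f s", OF coord(1), of J c]
        emeasure_process_orthant[of "\<lambda>s f. f s", OF coord(2), of J c] by (simp add: sp)
  qed simp_all
  then have D: "distr \<mu> ?R (\<lambda>f. f) = distr \<nu> ?R (\<lambda>f. f)" by simp
  fix A assume "A \<in> sets \<mu>"
  then have "A \<in> sets (path_space a b)" using assms(2) by simp
  then obtain A' where A': "A' \<in> sets ?R" "A = {f. continuous_on UNIV f \<and> range f \<subseteq> {a..b}} \<inter> A'"
    unfolding path_space_def by (subst (asm) sets_restrict_space) auto
  then have "emeasure \<mu> A = emeasure (distr \<mu> ?R (\<lambda>f. f)) A'" "emeasure \<nu> A = emeasure (distr \<nu> ?R (\<lambda>f. f)) A'"
    using id by (simp_all add: emeasure_distr sp paths_def Int_commute)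
  then show "emeasure \<mu> A = emeasure \<nu> A" using D by simp
qed (use assms in simp)

lemma path_continuous: "f \<in> paths a b \<Longrightarrow> continuous_on UNIV f"
  by (simp add: paths_def)

text \<open>
  By continuity the value at a random time is the limit of the values at the dyadic times below it.
\<close>

lemma measurable_path_eval_random:
  assumes X [measurable]: "X \<in> borel_measurable (path_space a b)"
  shows "(\<lambda>f. f (X f)) \<in> borel_measurable (path_space a b)"
proof (rule borel_measurable_LIMSEQ_real)
  fix f assume "f \<in> space (path_space a b)"
  then have f: "continuous_on UNIV f" by (simp add: path_continuous)
  have "(\<lambda>n. real_of_int \<lfloor>2 ^ n * X f\<rfloor> / 2 ^ n) \<longlonglongrightarrow> X f"
  proof (rule tendsto_sandwich[of "\<lambda>n. X f - (1/2) ^ n" _ _ "\<lambda>_. X f"])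
    have "X f - (1/2) ^ n \<le> real_of_int \<lfloor>2 ^ n * X f\<rfloor> / 2 ^ n" for n
    proof -
      have "2 ^ n * X f - 1 \<le> real_of_int \<lfloor>2 ^ n * X f\<rfloor>" by linarith
      then have "(2 ^ n * X f - 1) / 2 ^ n \<le> real_of_int \<lfloor>2 ^ n * X f\<rfloor> / 2 ^ n" by (intro divide_right_mono) auto
      then show ?thesis by (simp add: diff_divide_distrib power_one_over)
    qed
    then show "\<forall>\<^sub>F n in sequentially. X f - (1/2) ^ n \<le> real_of_int \<lfloor>2 ^ n * X f\<rfloor> / 2 ^ n" by simp
    have "real_of_int \<lfloor>2 ^ n * X f\<rfloor> / 2 ^ n \<le> X f" for n :: nat
      by (simp add: divide_le_eq mult.commute)
    then show "\<forall>\<^sub>F n in sequentially. real_of_int \<lfloor>2 ^ n * X f\<rfloor> / 2 ^ n \<le> X f" by simp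
    have "(\<lambda>n. X f - (1/2) ^ n) \<longlonglongrightarrow> X f - 0" by (intro tendsto_intros LIMSEQ_power_zero) auto
    then show "(\<lambda>n. X f - (1/2) ^ n) \<longlonglongrightarrow> X f" by simp
  qed simp
  then show "(\<lambda>n. f (real_of_int \<lfloor>2 ^ n * X f\<rfloor> / 2 ^ n)) \<longlonglongrightarrow> f (X f)"
    using f by (intro isCont_tendsto_compose[of "X f" f]) (auto simp: continuous_on_eq_continuous_at)
next
  fix n :: nat
  show "(\<lambda>f. f (real_of_int \<lfloor>2 ^ n * X f\<rfloor> / 2 ^ n)) \<in> borel_measurable (path_space a b)"
    by (rule measurable_compose_countable[of "\<lambda>(i::int) f. f (real_of_int i / 2 ^ n)"]) measurable
qed

context level
begin

lemma measurable_hits: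
  assumes [measurable]: "X \<in> borel_measurable (path_space a b)" "Y \<in> borel_measurable (path_space a b)"
  shows "Measurable.pred (path_space a b) (\<lambda>f. hits f (X f) (Y f))"
proof -
  have inf: "(\<lambda>x::real. infdist x {m}) \<in> borel_measurable borel"
    by (intro borel_measurable_continuous_onI continuous_on_infdist continuous_on_id)
  have cnt: "countable (\<rat> \<inter> {0..1::real})" using countable_rat by (rule countable_subset[rotated]) auto
  have le: "Measurable.pred (path_space a b) (\<lambda>f. X f \<le> Y f)"
    unfolding pred_def using assms by (rule borel_measurable_le)
  have ev: "(\<lambda>f. infdist (f (X f + (Y f - X f) * r)) {m}) \<in> borel_measurable (path_space a b)" for r
    by (intro measurable_compose[OF measurable_path_eval_random inf] borel_measurable_add borel_measurable_times
      borel_measurable_diff borel_measurable_const assms)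
  have "Measurable.pred (path_space a b) (\<lambda>f. hits_set {m} (X f) (Y f) f)"
    unfolding hits_set_def
  proof (intro pred_intros_countable(1) pred_Bex_countable_set cnt)
    fix n :: nat and r :: real
    show "Measurable.pred (path_space a b) (\<lambda>f. infdist (f (X f + (Y f - X f) * r)) {m} < 1 / real (Suc n))"
      using ev[of r] by (rule borel_measurable_pred_less) simp
  qed
  then have "Measurable.pred (path_space a b) (\<lambda>f. X f \<le> Y f \<and> hits_set {m} (X f) (Y f) f)"
    using le by (intro pred_intros_logic(3))
  then show ?thesis
    by (rule measurable_cong[THEN iffD1, rotated]) (simp add: hits_iff_hits_set[OF path_continuous])
qed

lemma measurable_hits_const [measurable]: "Measurable.pred (path_space a b) (\<lambda>f. hits f x y)"
  by (rule measurable_hits) simp_all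

lemma measurable_big:
  assumes "X \<in> borel_measurable (path_space a b)"
  shows "Measurable.pred (path_space a b) (\<lambda>f. big f (X f))"
proof -
  note [measurable] = measurable_path_eval_random[OF assms]
  show ?thesis unfolding big_def by measurable
qed

lemma measurable_big_const [measurable]: "Measurable.pred (path_space a b) (\<lambda>f. big f x)"
  by (rule measurable_big) simp

lemma measurable_flip_eval [measurable]: "(\<lambda>f. flip q f s) \<in> borel_measurable (path_space a b)"
  unfolding flip_def by measurable

lemma flip_paths:
  assumes "m = (a + b) / 2" "f \<in> paths a b"
  shows "flip q f \<in> paths a b"
proof -
  have "flip q f s \<in> {a..b}" for s
  proof -
    have "f s \<in> {a..b}" using assms(2) by (auto simp: paths_def image_subset_iff)
    moreover have "2 * m = a + b" using assms(1) by simp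
    ultimately show ?thesis by (simp add: flip_def)
  qed
  then show ?thesis using continuous_on_flip[OF path_continuous[OF assms(2)]] by (auto simp: paths_def)
qed

lemma measurable_flip:
  assumes "m = (a + b) / 2"
  shows "flip q \<in> path_space a b \<rightarrow>\<^sub>M path_space a b"
  by (rule measurable_into_path_space) (use flip_paths[OF assms] in auto)

lemma measurable_crosses [measurable]: "Measurable.pred (path_space a b) (\<lambda>f. crosses f x y)"
proof -
  have cnt: "countable (\<rat> \<inter> {0..1::real})" using countable_rat by (rule countable_subset[rotated]) auto
  have [measurable]: "Measurable.pred (path_space a b) (\<lambda>f. \<exists>r\<in>\<rat> \<inter> {0..1}. f (x + (y - x) * r) < m)"
    "Measurable.pred (path_space a b) (\<lambda>f. \<exists>r\<in>\<rat> \<inter> {0..1}. m < f (x + (y - x) * r))"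
    by (intro pred_Bex_countable_set[OF cnt]; measurable)+
  show ?thesis unfolding crosses_def by measurable
qed

lemma measurable_returns [measurable]: "Measurable.pred (path_space a b) (\<lambda>f. returns f s t)"
  unfolding returns_def by (rule pred_Bex_countable_set[OF countable_rat]) measurable

end

lemma path_shift_paths: "f \<in> paths a b \<Longrightarrow> path_shift t f \<in> paths a b"
  unfolding path_shift_def paths_def
  by (auto intro!: continuous_on_compose2[of UNIV f] continuous_intros)

lemma measurable_path_shift [measurable]: "path_shift t \<in> path_space a b \<rightarrow>\<^sub>M path_space a b"
  by (rule measurable_into_path_space) (auto simp: path_shift_paths, simp add: path_shift_def)

section \<open>The law of stationary reflected Brownian motion\<close>

locale stationary_reflected_bm =
  fixes a b :: real and M :: "'a measure" and B :: "real \<Rightarrow> 'a \<Rightarrow> real"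
  assumes ab: "a < b" and rbm: "reflected_brownian_motion a b M B" and stat: "stationary_process M B"
begin

abbreviation "h \<equiv> b - a"

abbreviation "K \<equiv> path_law a b M B"

sublocale level "(a + b) / 2" "(b - a) / 4"
  by unfold_locales (use ab in simp)

abbreviation "mid \<equiv> (a + b) / 2"

definition W :: "real \<Rightarrow> 'a \<Rightarrow> real" where
  "W = (SOME W. two_sided_brownian_motion M W \<and> (\<forall>s. \<forall>\<omega>\<in>space M. B s \<omega> = a + reflect (b - a) (W s \<omega>)))"

lemma W: "two_sided_brownian_motion M W" "\<And>s \<omega>. \<omega> \<in> space M \<Longrightarrow> B s \<omega> = a + reflect h (W s \<omega>)"
proof -
  have "two_sided_brownian_motion M W \<and> (\<forall>s. \<forall>\<omega>\<in>space M. B s \<omega> = a + reflect (b - a) (W s \<omega>))"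
    using rbm unfolding reflected_brownian_motion_def W_def by (rule someI_ex)
  then show "two_sided_brownian_motion M W" "\<And>s \<omega>. \<omega> \<in> space M \<Longrightarrow> B s \<omega> = a + reflect h (W s \<omega>)" by auto
qed

sublocale brownian_motion M W
  by unfold_locales (rule W)

lemma h_pos: "h > 0" using ab by simp

lemma reflect_measurable [measurable]: "reflect h \<in> borel_measurable borel"
  by (intro borel_measurable_continuous_onI continuous_on_reflect h_pos)

lemma B_measurable [measurable]: "B s \<in> borel_measurable M"
proof -
  have "(\<lambda>\<omega>. a + reflect h (W s \<omega>)) \<in> borel_measurable M" by measurable
  then show ?thesis by (rule measurable_cong[THEN iffD1, rotated]) (simp add: W(2))
qed

lemma B_paths: "\<omega> \<in> space M \<Longrightarrow> (\<lambda>s. B s \<omega>) \<in> paths a b"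
proof -
  assume \<omega>: "\<omega> \<in> space M"
  have "continuous_on UNIV (\<lambda>s. a + reflect h (W s \<omega>))"
    by (intro continuous_intros continuous_on_compose2[OF continuous_on_reflect[OF h_pos] W_continuous[OF \<omega>]]) auto
  then have "continuous_on UNIV (\<lambda>s. B s \<omega>)" using W(2)[OF \<omega>] by simp
  moreover have "B s \<omega> \<in> {a..b}" for s
    using reflect_bounds[OF h_pos, of "W s \<omega>"] W(2)[OF \<omega>] by auto
  ultimately show ?thesis by (auto simp: paths_def)
qed

lemma measurable_B_path [measurable]: "(\<lambda>\<omega> s. B s \<omega>) \<in> M \<rightarrow>\<^sub>M path_space a b"
  by (rule measurable_into_path_space) (auto simp: B_paths)

lemma sets_K [simp, measurable_cong]: "sets K = sets (path_space a b)"
  by (simp add: path_law_def)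

lemma space_K [simp]: "space K = paths a b"
  by (simp add: path_law_def)

lemma prob_space_K: "prob_space K"
  unfolding path_law_def by (rule prob_space_distr) simp

lemma emeasure_K:
  assumes "Measurable.pred (path_space a b) Q"
  shows "emeasure K {f\<in>paths a b. Q f} = emeasure M {\<omega>\<in>space M. Q (\<lambda>s. B s \<omega>)}"
proof -
  have "{f\<in>paths a b. Q f} \<in> sets (path_space a b)" using assms by (simp add: pred_def)
  then show ?thesis unfolding path_law_def
    by (subst emeasure_distr) (auto simp: B_paths intro!: arg_cong2[where f = emeasure])
qed

lemma path_shift_preserves: "distr K K (path_shift t) = K"
proof (rule path_measure_eqI)
  interpret K: prob_space K by (rule prob_space_K)
  show "prob_space (distr K K (path_shift t))" by (rule K.prob_space_distr) simp
  fix J :: "real set" and c :: "real \<Rightarrow> real" assume J: "finite J"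
  have eq: "distr M (\<Pi>\<^sub>M s\<in>UNIV. borel) (\<lambda>\<omega> s. B (s + - t) \<omega>) = distr M (\<Pi>\<^sub>M s\<in>UNIV. borel) (\<lambda>\<omega> s. B s \<omega>)"
    using stat unfolding stationary_process_def by blast
  have o: "{f\<in>paths a b. \<forall>s\<in>J. f s \<le> c s} \<in> sets K" and p: "Measurable.pred (path_space a b) (\<lambda>f. \<forall>s\<in>J. f (s - t) \<le> c s)"
    and p': "Measurable.pred (path_space a b) (\<lambda>f. \<forall>s\<in>J. f s \<le> c s)"
  proof -
    show "Measurable.pred (path_space a b) (\<lambda>f. \<forall>s\<in>J. f (s - t) \<le> c s)" "Measurable.pred (path_space a b) (\<lambda>f. \<forall>s\<in>J. f s \<le> c s)"
      using J by measurable
    then show "{f\<in>paths a b. \<forall>s\<in>J. f s \<le> c s} \<in> sets K" by (simp add: pred_def)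
  qed
  have "emeasure (distr K K (path_shift t)) {f\<in>paths a b. \<forall>s\<in>J. f s \<le> c s} = emeasure K {f\<in>paths a b. \<forall>s\<in>J. f (s - t) \<le> c s}"
    using o by (subst emeasure_distr) (auto simp: path_shift_paths intro!: arg_cong2[where f = emeasure], auto simp: path_shift_def)
  also have "\<dots> = emeasure M {\<omega>\<in>space M. \<forall>s\<in>J. B (s + - t) \<omega> \<le> c s}"
    using emeasure_K[OF p] by simp
  also have "\<dots> = emeasure M {\<omega>\<in>space M. \<forall>s\<in>J. B s \<omega> \<le> c s}"
    using emeasure_process_orthant[of "\<lambda>s. B (s + - t)" M J c, OF B_measurable J]
      emeasure_process_orthant[of B M J c, OF B_measurable J] eq by simp
  also have "\<dots> = emeasure K {f\<in>paths a b. \<forall>s\<in>J. f s \<le> c s}"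
    using emeasure_K[OF p'] by simp
  finally show "emeasure (distr K K (path_shift t)) {f\<in>paths a b. \<forall>s\<in>J. f s \<le> c s} = emeasure K {f\<in>paths a b. \<forall>s\<in>J. f s \<le> c s}" .
qed simp_all

lemma emeasure_K_shift:
  assumes Q: "Measurable.pred (path_space a b) Q"
  shows "emeasure K {f\<in>paths a b. Q (path_shift t f)} = emeasure K {f\<in>paths a b. Q f}"
proof -
  have o: "{f\<in>paths a b. Q f} \<in> sets K" using Q by (simp add: pred_def)
  have "emeasure K {f\<in>paths a b. Q f} = emeasure (distr K K (path_shift t)) {f\<in>paths a b. Q f}"
    by (simp add: path_shift_preserves)
  also have "\<dots> = emeasure K {f\<in>paths a b. Q (path_shift t f)}"
    using o by (subst emeasure_distr) (auto simp: path_shift_paths intro!: arg_cong2[where f = emeasure])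
  finally show ?thesis by simp
qed

lemma hits_B:
  assumes "\<omega> \<in> space M"
  shows "hits (\<lambda>s. B s \<omega>) x y \<longleftrightarrow> (\<exists>z\<in>{x..y}. W z \<omega> \<in> mid_points h)"
  using W(2)[OF assms] by (auto simp: hits_def mid_points_def field_simps)

lemma flip_B:
  assumes \<omega>: "\<omega> \<in> space M" and "0 \<le> q" "0 \<le> s"
  shows "flip q (\<lambda>s. B s \<omega>) s = a + reflect h (reflect_at_hit (mid_points h) q (\<lambda>s. V s \<omega>) s)"
proof -
  have VW: "V z \<omega> = W z \<omega>" if "0 \<le> z" for z using that by (simp add: V_def)
  have ex: "(\<exists>z\<in>{q..s}. V z \<omega> \<in> mid_points h) \<longleftrightarrow> hits (\<lambda>s. B s \<omega>) q s"
    unfolding hits_B[OF \<omega>] using assms(2) VW by auto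
  show ?thesis
  proof (cases "hits (\<lambda>s. B s \<omega>) q s")
    case True
    then obtain z where z: "q \<le> z" "V z \<omega> \<in> mid_points h" using ex by auto
    have "V (hit_time (mid_points h) q (\<lambda>s. V s \<omega>)) \<omega> \<in> mid_points h"
      using hit_time(2)[OF V_continuous[OF \<omega>] mid_points(1)[OF h_pos], of q z] z by simp
    then show ?thesis using True W(2)[OF \<omega>] VW[OF assms(3)]
      by (simp add: flip_def reflect_at_hit_def ex reflect_point_symmetry[OF h_pos] field_simps)
  next
    case False
    then show ?thesis using W(2)[OF \<omega>] VW[OF assms(3)] by (simp add: flip_def reflect_at_hit_def ex)
  qed
qed

lemma flip_measurable_K [measurable]: "flip q \<in> K \<rightarrow>\<^sub>M K" "flip q \<in> path_space a b \<rightarrow>\<^sub>M path_space a b"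
  using measurable_flip[of a b q] by (simp_all cong: measurable_cong_sets)

text \<open>
  The midpoint of \<open>[a, b]\<close> is hit exactly when \<open>W\<close> hits a point that folds to it, and reflecting \<open>W\<close> there
  flips \<open>B\<close>. Stationarity first moves the finitely many times in question into the half line on which
  the reflection principle is available.
\<close>

theorem flip_preserves: "distr K K (flip q) = K"
proof (rule path_measure_eqI)
  interpret K: prob_space K by (rule prob_space_K)
  show "prob_space (distr K K (flip q))" by (rule K.prob_space_distr) simp
  fix J :: "real set" and c :: "real \<Rightarrow> real" assume J: "finite J"
  define n where "n = Max ((\<lambda>s. \<bar>s\<bar>) ` insert q J)"
  have n: "\<bar>s\<bar> \<le> n" if "s \<in> insert q J" for s
    unfolding n_def using J that by (intro Max_ge) auto
  have pos: "0 \<le> s + n" if "s \<in> insert q J" for s using n[OF that] by (simp add: abs_le_iff)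
  have p: "Measurable.pred (path_space a b) (\<lambda>f. \<forall>s\<in>J. flip q f s \<le> c s)"
    "Measurable.pred (path_space a b) (\<lambda>f. \<forall>s\<in>J. f s \<le> c s)"
    "Measurable.pred (path_space a b) (\<lambda>f. \<forall>s\<in>J. flip (q + n) f (s + n) \<le> c s)"
    "Measurable.pred (path_space a b) (\<lambda>f. \<forall>s\<in>J. f (s + n) \<le> c s)"
    using J by measurable
  have "emeasure (distr K K (flip q)) {f\<in>paths a b. \<forall>s\<in>J. f s \<le> c s} = emeasure K {f\<in>paths a b. \<forall>s\<in>J. flip q f s \<le> c s}"
    using p(2) flip_paths[of a b _ q] by (subst emeasure_distr) (auto simp: pred_def intro!: arg_cong2[where f = emeasure])
  also have "\<dots> = emeasure K {f\<in>paths a b. \<forall>s\<in>J. flip q (path_shift (- n) f) s \<le> c s}"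
    using emeasure_K_shift[OF p(1), of "- n"] by simp
  also have "\<dots> = emeasure K {f\<in>paths a b. \<forall>s\<in>J. flip (q + n) f (s + n) \<le> c s}"
    by (simp add: flip_shift)
  also have "\<dots> = emeasure M {\<omega>\<in>space M. \<forall>s\<in>J. flip (q + n) (\<lambda>s. B s \<omega>) (s + n) \<le> c s}"
    using emeasure_K[OF p(3)] by simp
  also have "\<dots> = emeasure M {\<omega>\<in>space M. \<forall>s\<in>J. a + reflect h (reflect_at_hit (mid_points h) (q + n) (\<lambda>s. V s \<omega>) (s + n)) \<le> c s}"
    using pos by (intro arg_cong2[where f = emeasure] refl) (auto simp: flip_B)
  also have "\<dots> = emeasure M {\<omega>\<in>space M. \<forall>s\<in>J. a + reflect h (V (s + n) \<omega>) \<le> c s}"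
  proof -
    let ?E = "{v \<in> space (\<Pi>\<^sub>M s\<in>UNIV. borel). \<forall>s\<in>J. a + reflect h (v (s + n)) \<le> c s}"
    have E: "?E \<in> sets (\<Pi>\<^sub>M s\<in>(UNIV::real set). borel)" using J by measurable
    let ?X = "\<lambda>\<omega> s. reflect_at_hit (mid_points h) (q + n) (\<lambda>s. V s \<omega>) s"
    have Xlaw: "distr M (\<Pi>\<^sub>M s\<in>UNIV. borel) ?X = forward_law"
      using pos mid_points[OF h_pos] by (intro reflect_at_hit_distr) auto
    have Xm: "?X \<in> M \<rightarrow>\<^sub>M (\<Pi>\<^sub>M s\<in>UNIV. borel)"
      by (rule measurable_reflect_at_hit) (use pos mid_points[OF h_pos] in auto)
    have "emeasure (distr M (\<Pi>\<^sub>M s\<in>UNIV. borel) ?X) ?E = emeasure M {\<omega>\<in>space M. \<forall>s\<in>J. a + reflect h (?X \<omega> (s + n)) \<le> c s}"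
      using E Xm by (subst emeasure_distr) (auto simp: space_PiM intro!: arg_cong2[where f = emeasure])
    moreover have "emeasure forward_law ?E = emeasure M {\<omega>\<in>space M. \<forall>s\<in>J. a + reflect h (V (s + n) \<omega>) \<le> c s}"
      unfolding forward_law_def using E by (subst emeasure_distr) (auto simp: space_PiM intro!: arg_cong2[where f = emeasure])
    ultimately show ?thesis using Xlaw by simp
  qed
  also have "\<dots> = emeasure M {\<omega>\<in>space M. \<forall>s\<in>J. B (s + n) \<omega> \<le> c s}"
    using pos by (intro arg_cong2[where f = emeasure] refl) (auto simp: W(2) V_def max_absorb2)
  also have "\<dots> = emeasure K {f\<in>paths a b. \<forall>s\<in>J. f (s + n) \<le> c s}"
    using emeasure_K[OF p(4)] by simp
  also have "\<dots> = emeasure K {f\<in>paths a b. \<forall>s\<in>J. f s \<le> c s}"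
    using emeasure_K_shift[OF p(2), of "- n"] by (simp add: path_shift_def)
  finally show "emeasure (distr K K (flip q)) {f\<in>paths a b. \<forall>s\<in>J. f s \<le> c s} = emeasure K {f\<in>paths a b. \<forall>s\<in>J. f s \<le> c s}" .
qed simp_all

end

section \<open>Almost every path is regular\<close>

context level
begin

lemma crosses_shift: "crosses (path_shift t f) x y \<longleftrightarrow> crosses f (x - t) (y - t)"
proof -
  have "path_shift t f (x + (y - x) * r) = f (x - t + (y - t - (x - t)) * r)" for r
    by (simp add: path_shift_def algebra_simps)
  then show ?thesis by (simp only: crosses_def hits_shift)
qed

lemma returns_shift: "returns (path_shift u f) s t \<longleftrightarrow> returns f (s - u) (t - u)"
  by (simp add: returns_def hits_shift big_shift algebra_simps)

end

context stationary_reflected_bm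
begin

lemma AE_K_iff:
  assumes "Measurable.pred (path_space a b) Q"
  shows "(AE f in K. Q f) \<longleftrightarrow> (AE \<omega> in M. Q (\<lambda>s. B s \<omega>))"
  unfolding path_law_def using assms by (subst AE_distr_iff) (auto simp: pred_def)

lemma AE_K_preserved:
  assumes Q: "Measurable.pred (path_space a b) Q" and T: "T \<in> K \<rightarrow>\<^sub>M K" "distr K K T = K"
  shows "(AE f in K. Q (T f)) \<longleftrightarrow> (AE f in K. Q f)"
proof -
  have "(AE f in distr K K T. Q f) \<longleftrightarrow> (AE f in K. Q (T f))"
    using Q T(1) by (subst AE_distr_iff) (auto simp: pred_def)
  then show ?thesis unfolding T(2) ..
qed

lemma path_shift_measurable_K [measurable]: "path_shift t \<in> K \<rightarrow>\<^sub>M K"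
  using measurable_path_shift by (simp cong: measurable_cong_sets)

text \<open>
  On \<open>[1, 1 + p]\<close> the unfolded path almost surely has neither its maximum nor its minimum at a point \<open>c\<close>
  that folds to the midpoint. So if it visits \<open>c\<close> then it takes values on both sides of \<open>c\<close>, in
  particular values \<open>c + e\<close> and \<open>c - e\<close> with a common small \<open>e\<close>, and these fold to different sides of
  the midpoint.
\<close>

lemma AE_crosses_forward:
  assumes p: "p > 0"
  shows "AE f in K. crosses f 1 (1 + p)"
proof (subst AE_K_iff)
  have "AE \<omega> in M. \<forall>c\<in>mid_points h.
      \<not> (\<exists>y\<in>{1..1+p}. 1 * W y \<omega> = c \<and> (\<forall>x\<in>{1..1+p}. 1 * W x \<omega> \<le> c)) \<and>
      \<not> (\<exists>y\<in>{1..1+p}. (- 1) * W y \<omega> = - c \<and> (\<forall>x\<in>{1..1+p}. (- 1) * W x \<omega> \<le> - c))"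
    using p by (subst AE_ball_countable[OF mid_points(3)[OF h_pos]])
      (intro ballI AE_conjI no_extremum_at_level; simp)
  then show "AE \<omega> in M. crosses (\<lambda>s. B s \<omega>) 1 (1 + p)"
  proof (rule AE_mp, intro AE_I2 impI)
    fix \<omega> assume \<omega>: "\<omega> \<in> space M" and
      ext: "\<forall>c\<in>mid_points h.
      \<not> (\<exists>y\<in>{1..1+p}. 1 * W y \<omega> = c \<and> (\<forall>x\<in>{1..1+p}. 1 * W x \<omega> \<le> c)) \<and>
      \<not> (\<exists>y\<in>{1..1+p}. (- 1) * W y \<omega> = - c \<and> (\<forall>x\<in>{1..1+p}. (- 1) * W x \<omega> \<le> - c))"
    show "crosses (\<lambda>s. B s \<omega>) 1 (1 + p)" unfolding crosses_def
    proof
      assume "hits (\<lambda>s. B s \<omega>) 1 (1 + p)"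
      then obtain y where y: "y \<in> {1..1+p}" "W y \<omega> \<in> mid_points h" using hits_B[OF \<omega>] by blast
      define c where "c = W y \<omega>"
      have "\<exists>x\<in>{1..1+p}. \<not> 1 * W x \<omega> \<le> c" "\<exists>x\<in>{1..1+p}. \<not> (- 1) * W x \<omega> \<le> - c"
        using bspec[OF ext y(2)] y(1) unfolding c_def by (metis mult_1 mult_minus1)+
      then obtain x1 x2 where x1: "x1 \<in> {1..1+p}" "c < W x1 \<omega>" and x2: "x2 \<in> {1..1+p}" "W x2 \<omega> < c"
        by (auto simp: not_le)
      define e where "e = min (h / 2) (min (W x1 \<omega> - c) (c - W x2 \<omega>))"
      have e: "0 < e" "e \<le> h / 2" "c + e \<le> W x1 \<omega>" "W x2 \<omega> \<le> c - e"
      proof -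
        have "e \<le> W x1 \<omega> - c" "e \<le> c - W x2 \<omega>" unfolding e_def by linarith+
        then show "c + e \<le> W x1 \<omega>" "W x2 \<omega> \<le> c - e" by linarith+
        show "e \<le> h / 2" unfolding e_def by (rule min.cobounded1)
        show "0 < e" unfolding e_def using x1 x2 h_pos by simp
      qed
      have "connected ((\<lambda>s. W s \<omega>) ` {1..1+p})"
        using W_continuous[OF \<omega>] by (intro connected_continuous_image) (auto intro: continuous_on_subset)
      then have sub: "{W x2 \<omega>..W x1 \<omega>} \<subseteq> (\<lambda>s. W s \<omega>) ` {1..1+p}"
        using x1 x2 by (intro connected_contains_Icc) auto
      have "c + e \<in> {W x2 \<omega>..W x1 \<omega>}" "c - e \<in> {W x2 \<omega>..W x1 \<omega>}" using e x1 x2 by auto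
      then have "c + e \<in> (\<lambda>s. W s \<omega>) ` {1..1+p}" "c - e \<in> (\<lambda>s. W s \<omega>) ` {1..1+p}" using sub by blast+
      then obtain s1 s2 where s: "s1 \<in> {1..1+p}" "W s1 \<omega> = c + e" "s2 \<in> {1..1+p}" "W s2 \<omega> = c - e"
        by (elim imageE) simp
      obtain k :: int where k: "c = h / 2 + of_int k * h" using mid_pointsE[OF h_pos y(2)] c_def by metis
      have v: "B s1 \<omega> = a + (if even k then h / 2 + e else h / 2 - e)" "B s2 \<omega> = a + (if even k then h / 2 - e else h / 2 + e)"
      proof -
        have "reflect h (c + e) = (if even k then h / 2 + e else h / 2 - e)"
          by (rule reflect_near_mid_point[OF h_pos k]) (use e in simp)
        then show "B s1 \<omega> = a + (if even k then h / 2 + e else h / 2 - e)" by (simp only: W(2)[OF \<omega>] s)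
        have "reflect h (c + - e) = (if even k then h / 2 + - e else h / 2 - - e)"
          by (rule reflect_near_mid_point[OF h_pos k]) (use e in simp)
        then have "reflect h (c - e) = (if even k then h / 2 - e else h / 2 + e)" by simp
        then show "B s2 \<omega> = a + (if even k then h / 2 - e else h / 2 + e)" by (simp only: W(2)[OF \<omega>] s)
      qed
      have mid: "a + h / 2 = mid" by (simp add: field_simps)
      have lt: "\<exists>s\<in>{1..1+p}. B s \<omega> \<in> {..<mid}"
      proof (cases "even k")
        case True then show ?thesis using v(2) s(3) e(1) mid by (intro bexI[of _ s2]) auto
      next
        case False then show ?thesis using v(1) s(1) e(1) mid by (intro bexI[of _ s1]) auto
      qed
      have gt: "\<exists>s\<in>{1..1+p}. B s \<omega> \<in> {mid<..}"
      proof (cases "even k")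
        case True then show ?thesis using v(1) s(1) e(1) mid by (intro bexI[of _ s1]) auto
      next
        case False then show ?thesis using v(2) s(3) e(1) mid by (intro bexI[of _ s2]) auto
      qed
      show "(\<exists>r\<in>\<rat> \<inter> {0..1}. B (1 + (1 + p - 1) * r) \<omega> < mid) \<and> (\<exists>r\<in>\<rat> \<inter> {0..1}. mid < B (1 + (1 + p - 1) * r) \<omega>)"
        using lt gt p dense_open_values[OF path_continuous[OF B_paths[OF \<omega>]], of "{..<mid}" _ 1 "1 + p"]
          dense_open_values[OF path_continuous[OF B_paths[OF \<omega>]], of "{mid<..}" _ 1 "1 + p"] by auto
    qed
  qed
qed measurable

lemma AE_crosses:
  assumes "x < y"
  shows "AE f in K. crosses f x y" "AE f in K. crosses (flip q f) x y"
proof -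
  have "AE f in K. crosses (path_shift (1 - x) f) 1 (1 + (y - x))"
    using AE_crosses_forward[of "y - x"] assms
    by (subst AE_K_preserved[where Q = "\<lambda>f. crosses f 1 (1 + (y - x))"]) (auto simp: path_shift_preserves)
  then show "AE f in K. crosses f x y" by (simp add: crosses_shift)
  then show "AE f in K. crosses (flip q f) x y"
    by (subst AE_K_preserved[where Q = "\<lambda>f. crosses f x y"]) (auto simp: flip_preserves)
qed

text \<open>
  An increment larger than \<open>2 * h\<close> forces the unfolded path through an extreme point of the
  folding and afterwards through a point that folds to the midpoint.
\<close>

lemma AE_returns_forward: "AE f in K. \<exists>n::nat. returns f 0 (real n)"
proof (subst AE_K_iff)
  show "AE \<omega> in M. \<exists>n::nat. returns (\<lambda>s. B s \<omega>) 0 (real n)"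
    using large_increment_occurs[of "2 * h"]
  proof (rule AE_mp, intro AE_I2 impI)
    fix \<omega> assume \<omega>: "\<omega> \<in> space M" and "\<exists>i::nat. W (real i + 1) \<omega> - W (real i) \<omega> > 2 * h"
    then obtain i :: nat where i: "W (real i + 1) \<omega> - W (real i) \<omega> > 2 * h" by blast
    \<comment> \<open>The first point above \<open>W i\<close> that folds to the midpoint; one full period of length \<open>h\<close> above it is still covered by the increment.\<close>
    define k where "k = \<lceil>(W (real i) \<omega> - h / 2) / h\<rceil>"
    define c where "c = h / 2 + of_int k * h"
    have k: "(W (real i) \<omega> - h / 2) / h \<le> of_int k" "of_int k < (W (real i) \<omega> - h / 2) / h + 1"
      unfolding k_def by linarith+
    have c: "W (real i) \<omega> \<le> c" "c < W (real i) \<omega> + h"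
      using k h_pos by (auto simp: c_def field_simps)
    have cont: "continuous_on {x..y} (\<lambda>s. W s \<omega>)" for x y
      using W_continuous[OF \<omega>] by (rule continuous_on_subset) simp
    obtain s1 where s1: "real i \<le> s1" "s1 \<le> real i + 1" "W s1 \<omega> = c + h / 2"
    proof -
      have "\<exists>x\<ge>real i. x \<le> real i + 1 \<and> W x \<omega> = c + h / 2"
        using c i h_pos by (intro IVT' cont) (simp_all add: field_simps)
      then show ?thesis using that by blast
    qed
    obtain s2 where s2: "s1 \<le> s2" "s2 \<le> real i + 1" "W s2 \<omega> = c + h"
    proof -
      have "\<exists>x\<ge>s1. x \<le> real i + 1 \<and> W x \<omega> = c + h"
        using c i h_pos s1 by (intro IVT' cont) (simp_all add: field_simps)
      then show ?thesis using that by blast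
    qed
    have "s1 \<noteq> s2" using s1 s2 h_pos by auto
    then have s12: "s1 < s2" using s2 by simp
    have "reflect h (W s1 \<omega>) = (if even k then h / 2 + h / 2 else h / 2 - h / 2)"
      unfolding s1(3) using h_pos by (intro reflect_near_mid_point c_def) auto
    then have big1: "big (\<lambda>s. B s \<omega>) s1"
      using W(2)[OF \<omega>, of s1] h_pos by (auto simp: big_def field_simps abs_if)
    have "c + h = h / 2 + of_int (k + 1) * h" by (simp add: c_def algebra_simps)
    then have "c + h \<in> mid_points h" unfolding mid_points_iff[OF h_pos] by blast
    then have hit: "hits (\<lambda>s. B s \<omega>) x (real (i + 1))" if "x \<le> s2" for x
      unfolding hits_B[OF \<omega>] using that s2 by (intro bexI[of _ s2]) auto
    have "open {x. h / 4 < \<bar>x - mid\<bar>}"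
      by (intro open_Collect_less continuous_intros)
    from open_vimage[OF this path_continuous[OF B_paths[OF \<omega>]]]
    obtain d where d: "d > 0" "\<And>x. \<bar>x - s1\<bar> < d \<Longrightarrow> big (\<lambda>s. B s \<omega>) x"
      using big1 unfolding open_dist dist_real_def big_def by (auto simp: vimage_def)
    have "\<exists>q\<in>\<rat>. s1 < q \<and> q < min s2 (s1 + d)" using d s12 by (intro Rats_dense_in_real) auto
    then obtain q where q: "q \<in> \<rat>" "s1 < q" "q < s2" "q < s1 + d" by auto
    have "returns (\<lambda>s. B s \<omega>) 0 (real (i + 1))" unfolding returns_def
      using q s1 s2 hit[of q] d(2)[of q] by (intro bexI[of _ q]) auto
    then show "\<exists>n::nat. returns (\<lambda>s. B s \<omega>) 0 (real n)" by blast
  qed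
qed measurable

lemma returns_mono: "returns f s t \<Longrightarrow> t \<le> t' \<Longrightarrow> returns f s t'"
  unfolding returns_def using hits_mono by (meson order.refl order.trans)

text \<open>
  By stationarity the window \<open>[- c - n, - c]\<close> contains the end of a large excursion with the
  same probability as \<open>[0, n]\<close>, and the latter tends to 1.
\<close>

lemma AE_returns_backward: "AE f in K. \<exists>n::nat. returns f (- c - real n) (- c)"
proof -
  interpret K: prob_space K by (rule prob_space_K)
  let ?E = "\<lambda>n. {f\<in>paths a b. returns f 0 (real n)}"
  have E: "?E n \<in> sets K" for n using measurable_returns[where a = a and b = b and s = 0 and t = "real n"] by (simp add: pred_def)
  let ?F = "{f\<in>paths a b. \<exists>n::nat. returns f (- c - real n) (- c)}"
  have predF: "Measurable.pred (path_space a b) (\<lambda>f. \<exists>n::nat. returns f (- c - real n) (- c))" by measurable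
  then have F: "?F \<in> sets K" by (simp add: pred_def)
  have "(\<lambda>n. K.prob (?E n)) \<longlonglongrightarrow> K.prob (\<Union>n. ?E n)"
  proof (rule K.finite_Lim_measure_incseq)
    show "incseq ?E" unfolding incseq_def using returns_mono[of _ 0] by (auto intro: of_nat_mono)
  qed (use E in auto)
  moreover have "K.prob (\<Union>n. ?E n) = 1"
  proof (subst K.prob_eq_1)
    show "AE f in K. f \<in> (\<Union>n. ?E n)"
      using AE_returns_forward AE_space by eventually_elim auto
  qed (use E in auto)
  moreover have "K.prob (?E n) \<le> K.prob ?F" for n
  proof -
    have "K.prob (?E n) = K.prob {f\<in>paths a b. returns (path_shift (c + real n) f) 0 (real n)}"
      using emeasure_K_shift[OF measurable_returns[where s = 0 and t = "real n"], of "c + real n"] by (simp add: measure_def)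
    also have "\<dots> \<le> K.prob ?F"
    proof (rule K.finite_measure_mono[OF _ F], rule subsetI)
      fix f assume f: "f \<in> {f\<in>paths a b. returns (path_shift (c + real n) f) 0 (real n)}"
      have "0 - (c + real n) = - c - real n" "real n - (c + real n) = - c" by simp_all
      then have "returns f (- c - real n) (- c)" using f by (simp only: returns_shift mem_Collect_eq)
      then show "f \<in> ?F" using f by blast
    qed
    finally show ?thesis .
  qed
  ultimately have "1 \<le> K.prob ?F" by (intro LIMSEQ_le_const2) auto
  then have "K.prob ?F = 1" using K.prob_le_1[of ?F] by simp
  then have "AE f in K. f \<in> ?F" using F by (subst (asm) K.prob_eq_1) auto
  then show ?thesis by eventually_elim blast
qed

theorem AE_regular: "AE f in K. regular f"
proof -
  have c: "AE f in K. \<forall>x\<in>\<rat>. \<forall>y\<in>\<rat>. x < y \<longrightarrow> crosses f x y \<and> (\<forall>q\<in>\<rat>. crosses (flip q f) x y)"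
  proof (simp only: AE_ball_countable[OF countable_rat], intro ballI)
    fix x y :: real assume "x \<in> \<rat>" "y \<in> \<rat>"
    show "AE f in K. x < y \<longrightarrow> crosses f x y \<and> (\<forall>q\<in>\<rat>. crosses (flip q f) x y)"
    proof (cases "x < y")
      case True
      have "AE f in K. \<forall>q\<in>\<rat>. crosses (flip q f) x y"
        using AE_crosses(2)[OF True] by (simp add: AE_ball_countable[OF countable_rat])
      with AE_crosses(1)[OF True] show ?thesis by eventually_elim blast
    qed simp
  qed
  have "AE f in K. \<forall>k::nat. \<exists>n::nat. returns f (- real k - real n) (- real k)"
    unfolding AE_all_countable using AE_returns_backward by blast
  with c show ?thesis unfolding regular_def by (rule AE_conjI)
qed

end

section \<open>Excursion signs are independent fair coins\<close>

definition rat_time :: "nat \<Rightarrow> real" where "rat_time n = real_of_rat (from_nat n)"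

lemma rat_time_surj: "q \<in> \<rat> \<Longrightarrow> \<exists>n. rat_time n = q"
  unfolding rat_time_def Rats_def using surj_from_nat[where 'a = rat] by (metis imageE surjD)

context level
begin

lemma flip_flip_above:
  "m < flip u (flip u' f) s \<longleftrightarrow> (if hits f u s = hits f u' s then m < f s else f s < m)"
  by (auto simp: flip_def[of u] ) (auto simp: flip_def)

text \<open>
  Let \<open>g\<close> be the last zero before \<open>x\<close>. A flip from a time \<open>u'\<close> between \<open>g\<close> and \<open>x\<close> affects the points after
  the excursion straddling \<open>x\<close> only; a flip from a time \<open>u\<close> slightly before \<open>g\<close> affects these and the
  excursion straddling \<open>x\<close>, but no earlier point of \<open>J\<close>. Together they change the sign at \<open>x\<close> alone.
\<close>

lemma exists_isolating_flips:
  assumes f: "continuous_on UNIV f" and x: "f x \<noteq> m" and past: "\<exists>z<x. f z = m"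
    and J: "finite J" "\<And>y. y \<in> J \<Longrightarrow> f y \<noteq> m" "\<And>y. y \<in> J \<Longrightarrow> hits f (min x y) (max x y)"
  shows "\<exists>u\<in>\<rat>. \<exists>u'\<in>\<rat>. hits f u x \<noteq> hits f u' x \<and> (\<forall>y\<in>J. hits f u y = hits f u' y)"
proof -
  define Z where "Z = {z. z \<le> x \<and> f z = m}"
  have "Z = {..x} \<inter> f -` {m}" by (auto simp: Z_def)
  then have "closed Z" using closed_Int[OF closed_atMost closed_vimage[OF closed_singleton f]] by simp
  moreover obtain z where "z < x" "f z = m" using past by blast
  then have "z \<in> Z" by (simp add: Z_def)
  then have "Z \<noteq> {}" by blast
  moreover have bdd: "bdd_above Z" by (rule bdd_aboveI[of _ x]) (simp add: Z_def)
  ultimately have "Sup Z \<in> Z" by (intro closed_contains_Sup)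
  then obtain g where g: "g \<le> x" "f g = m" "\<And>z. z \<in> Z \<Longrightarrow> z \<le> g"
    using cSup_upper[OF _ bdd] by (auto simp: Z_def)
  have gx: "g < x" using g x by (cases "g = x") auto
  have no: "\<not> hits f u x" if "g < u" for u
    using g(3) that by (force simp: hits_def Z_def)
  obtain u' where u': "u' \<in> \<rat>" "g < u'" "u' < x" using Rats_dense_in_real[OF gx] by blast
  define l where "l = Max (insert (g - 1) {y\<in>J. y < g})"
  have l: "l < g" "\<And>y. y \<in> J \<Longrightarrow> y < g \<Longrightarrow> y \<le> l"
    unfolding l_def using J(1) by (auto simp: Max_less_iff intro!: Max_ge)
  obtain u where u: "u \<in> \<rat>" "l < u" "u < g" using Rats_dense_in_real[OF l(1)] by blast
  have hx: "hits f u x" using u g by (intro hitsI[of u g x]) auto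
  have "hits f u y = hits f u' y" if y: "y \<in> J" for y
  proof (cases "y < x")
    case True
    then have "hits f y x" using J(3)[OF y] by (simp add: min_absorb2 max_absorb1)
    then have "y \<le> g" using no[of y] by force
    then have "y < g" using J(2)[OF y] g(2) by (cases "y = g") auto
    then have "y < u" "y < u'" using l(2)[OF y] u u' by auto
    then show ?thesis by (simp add: hits_def)
  next
    case False
    then have "hits f x y" using J(3)[OF y] by (simp add: min_absorb1 max_absorb2)
    then show ?thesis using hits_mono[of f x y u y] hits_mono[of f x y u' y] u u' g by simp
  qed
  then show ?thesis using u(1) u'(1) hx no[OF u'(2)] by blast
qed

lemma regular_past_zero:
  assumes "regular f"
  shows "\<exists>z<x. f z = m"
proof -
  obtain k :: nat where k: "- x < real k" using reals_Archimedean2 by blast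
  obtain n where "returns f (- real k - real n) (- real k)" using assms unfolding regular_def by blast
  then obtain r where "hits f (- real k - real n + r) (- real k)" unfolding returns_def by blast
  then obtain z where "z \<le> - real k" "f z = m" by (auto simp: hits_def)
  then show ?thesis using k by (intro exI[of _ z]) auto
qed

end

definition coins :: "('i \<Rightarrow> bool) measure" where
  "coins = (\<Pi>\<^sub>M i\<in>UNIV. measure_pmf (bernoulli_pmf (1/2)))"

lemma prob_space_coins: "prob_space coins"
  unfolding coins_def by (intro prob_space_PiM measure_pmf.prob_space_axioms)

lemma measure_fair_coin: "measure (measure_pmf (bernoulli_pmf (1/2))) E = real (card E) / 2"
proof -
  have "E \<in> Pow (UNIV :: bool set)" by simp
  then consider "E = {}" | "E = {True}" | "E = {False}" | "E = {True, False}"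
    unfolding UNIV_bool by auto
  then show ?thesis
    by cases (auto simp: measure_pmf_single measure_measure_pmf_finite)
qed

lemma coins_cylinder:
  assumes "finite J"
  shows "emeasure coins {\<epsilon>. \<forall>j\<in>J. \<epsilon> j \<in> E j} = (\<Prod>j\<in>J. ennreal (real (card (E j)) / 2))"
proof -
  interpret product_prob_space "\<lambda>_::'i. measure_pmf (bernoulli_pmf (1/2))" UNIV by unfold_locales
  have "{\<epsilon>. \<forall>j\<in>J. \<epsilon> j \<in> E j} = prod_emb UNIV (\<lambda>_. measure_pmf (bernoulli_pmf (1/2))) J (Pi\<^sub>E J E)"
    by (auto simp: prod_emb_def space_PiM restrict_def PiE_iff extensional_def)
  then show ?thesis unfolding coins_def using assms
    by (simp add: emeasure_PiM_emb measure_pmf.emeasure_eq_measure measure_fair_coin)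
qed

context stationary_reflected_bm
begin

text \<open>
  The events that ignore the signs of the excursions; they play the part of the sigma-algebra
  generated by the distance of the path to the midpoint.
\<close>

definition flip_invariant :: "(real \<Rightarrow> real) set set" where
  "flip_invariant = {A \<in> sets K. \<forall>q. \<forall>f\<in>paths a b. flip q f \<in> A \<longleftrightarrow> f \<in> A}"

definition Inv :: "(real \<Rightarrow> real) measure" where
  "Inv = sigma (paths a b) flip_invariant"

lemma sigma_algebra_flip_invariant: "sigma_algebra (paths a b) flip_invariant"
  unfolding sigma_algebra_iff2
proof (intro conjI allI impI ballI)
  show "flip_invariant \<subseteq> Pow (paths a b)"
    using sets.sets_into_space[of _ K] by (auto simp: flip_invariant_def)
  show "{} \<in> flip_invariant" by (simp add: flip_invariant_def)
  show "paths a b - s \<in> flip_invariant" if "s \<in> flip_invariant" for s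
    using that sets.compl_sets[of s K] flip_paths[of a b] by (auto simp: flip_invariant_def)
  show "(\<Union>i. A i) \<in> flip_invariant" if "range A \<subseteq> flip_invariant" for A :: "nat \<Rightarrow> _"
    using that by (auto simp: flip_invariant_def)
qed

lemma space_Inv [simp]: "space Inv = paths a b"
  and sets_Inv: "sets Inv = flip_invariant"
proof -
  interpret sigma_algebra "paths a b" flip_invariant by (rule sigma_algebra_flip_invariant)
  show "space Inv = paths a b" "sets Inv = flip_invariant"
    unfolding Inv_def using space_closed sigma_sets_eq by (simp_all add: space_measure_of sets_measure_of)
qed

lemma measurable_InvI:
  assumes X: "X \<in> path_space a b \<rightarrow>\<^sub>M N" and inv: "\<And>q f. f \<in> paths a b \<Longrightarrow> X (flip q f) = X f"
  shows "X \<in> Inv \<rightarrow>\<^sub>M N"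
proof (rule measurableI)
  show "X f \<in> space N" if "f \<in> space Inv" for f using measurable_space[OF X, of f] that by simp
  fix A assume "A \<in> sets N"
  then have "X -` A \<inter> paths a b \<in> sets K" using measurable_sets[OF X] by simp
  then show "X -` A \<inter> space Inv \<in> sets Inv"
    using inv flip_paths[of a b] by (auto simp: sets_Inv flip_invariant_def)
qed

lemma id_measurable_Inv [measurable]: "(\<lambda>f. f) \<in> K \<rightarrow>\<^sub>M Inv"
proof (rule measurableI)
  fix A assume A: "A \<in> sets Inv"
  then have "A \<in> sets K" by (simp add: sets_Inv flip_invariant_def)
  moreover have "(\<lambda>f. f) -` A \<inter> space K = A" using sets.sets_into_space[OF A] by auto
  ultimately show "(\<lambda>f. f) -` A \<inter> space K \<in> sets K" by simp
qed simp

definition flip_pair :: "nat \<Rightarrow> (real \<Rightarrow> real) \<Rightarrow> real \<Rightarrow> real" where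
  "flip_pair n f = flip (rat_time (fst (prod_decode n))) (flip (rat_time (snd (prod_decode n))) f)"

lemma flip_pair_preserves: "flip_pair n \<in> K \<rightarrow>\<^sub>M K" "distr K K (flip_pair n) = K"
proof -
  let ?F = "flip (rat_time (fst (prod_decode n)))" and ?G = "flip (rat_time (snd (prod_decode n)))"
  have eq: "flip_pair n = ?F \<circ> ?G" by (auto simp: flip_pair_def fun_eq_iff)
  show "flip_pair n \<in> K \<rightarrow>\<^sub>M K" unfolding eq by (rule measurable_comp) (rule flip_measurable_K)+
  have "distr K K (?F \<circ> ?G) = distr (distr K K ?G) K ?F"
    by (rule distr_distr[symmetric]) (simp_all add: flip_measurable_K)
  then show "distr K K (flip_pair n) = K" unfolding eq by (simp add: flip_preserves)
qed

lemma flip_pair_invariant: "A \<in> flip_invariant \<Longrightarrow> f \<in> paths a b \<Longrightarrow> flip_pair n f \<in> A \<longleftrightarrow> f \<in> A"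
  using flip_paths[of a b] by (auto simp: flip_invariant_def flip_pair_def)

text \<open>
  The sign of the excursion that straddles the time \<open>t i f\<close>.
\<close>

definition sign_at :: "('i \<Rightarrow> (real \<Rightarrow> real) \<Rightarrow> real) \<Rightarrow> (real \<Rightarrow> real) \<Rightarrow> 'i \<Rightarrow> bool" where
  "sign_at t f i \<longleftrightarrow> mid < f (t i f)"

context
  fixes t :: "'i \<Rightarrow> (real \<Rightarrow> real) \<Rightarrow> real"
  assumes t_meas: "\<And>i. t i \<in> borel_measurable (path_space a b)"
    and t_inv: "\<And>i q f. f \<in> paths a b \<Longrightarrow> t i (flip q f) = t i f"
    and t_good: "AE f in K. (\<forall>i. f (t i f) \<noteq> mid) \<and> (\<forall>i j. i \<noteq> j \<longrightarrow> hits f (min (t i f) (t j f)) (max (t i f) (t j f)))"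
begin

lemma measurable_sign: "Measurable.pred (path_space a b) (\<lambda>f. sign_at t f i)"
  unfolding sign_at_def using measurable_path_eval_random[OF t_meas, of i] by measurable

text \<open>
  The pair of flips that isolates the excursion with label \<open>i\<close> is the first suitable one in an
  enumeration. Suitability depends on the zero set only, so the choice commutes with
  all flips and the combined map still preserves the law.
\<close>

lemma flip_one_sign:
  assumes J: "finite J" "i \<notin> J"
  obtains \<Psi> where "\<Psi> \<in> K \<rightarrow>\<^sub>M K" "distr K K \<Psi> = K"
    "\<And>A f. A \<in> flip_invariant \<Longrightarrow> f \<in> paths a b \<Longrightarrow> \<Psi> f \<in> A \<longleftrightarrow> f \<in> A"
    "AE f in K. (sign_at t (\<Psi> f) i \<longleftrightarrow> \<not> sign_at t f i) \<and> (\<forall>j\<in>J. sign_at t (\<Psi> f) j \<longleftrightarrow> sign_at t f j)"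
proof -
  define C where "C n f \<longleftrightarrow> (hits f (rat_time (fst (prod_decode n))) (t i f) \<noteq> hits f (rat_time (snd (prod_decode n))) (t i f)) \<and>
    (\<forall>j\<in>J. hits f (rat_time (fst (prod_decode n))) (t j f) = hits f (rat_time (snd (prod_decode n))) (t j f))" for n f
  define \<kappa> where "\<kappa> f = (LEAST n. C n f)" for f
  have ht: "Measurable.pred (path_space a b) (\<lambda>f. hits f q (t i f))" for i q
    by (rule measurable_hits) (simp_all add: t_meas)
  have Cm: "Measurable.pred (path_space a b) (C n)" for n
  proof -
    note [measurable] = ht
    show ?thesis unfolding C_def using J(1) by measurable
  qed
  have "\<kappa> \<in> path_space a b \<rightarrow>\<^sub>M count_space UNIV"
    unfolding \<kappa>_def using Cm by (rule measurable_Least)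
  then have \<kappa>: "\<kappa> \<in> K \<rightarrow>\<^sub>M count_space UNIV" by (simp cong: measurable_cong_sets)
  have t2: "t j (flip_pair n f) = t j f" if "f \<in> paths a b" for j n f
    using that flip_paths[of a b] by (simp add: flip_pair_def t_inv)
  have C_inv: "C n (flip_pair k f) = C n f" if "f \<in> paths a b" for n k f
    using t2[OF that] by (simp add: C_def flip_pair_def)
  then have \<kappa>_inv: "\<kappa> (flip_pair k f) = \<kappa> f" if "f \<in> paths a b" for k f
    using that by (simp add: \<kappa>_def)
  let ?\<Psi> = "\<lambda>f. flip_pair (\<kappa> f) f"
  note pres = measure_preserving_piecewise[of flip_pair K \<kappa>, OF flip_pair_preserves \<kappa>]
  show ?thesis
  proof (rule that[of ?\<Psi>])
    show "?\<Psi> \<in> K \<rightarrow>\<^sub>M K" "distr K K ?\<Psi> = K"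
      using pres \<kappa>_inv by auto
    show "?\<Psi> f \<in> A \<longleftrightarrow> f \<in> A" if "A \<in> flip_invariant" "f \<in> paths a b" for A f
      using flip_pair_invariant[OF that] .
    show "AE f in K. (sign_at t (?\<Psi> f) i \<longleftrightarrow> \<not> sign_at t f i) \<and> (\<forall>j\<in>J. sign_at t (?\<Psi> f) j \<longleftrightarrow> sign_at t f j)"
      using t_good AE_regular AE_space
    proof eventually_elim
      case (elim f)
      then have f: "f \<in> paths a b" by simp
      have "\<exists>u\<in>\<rat>. \<exists>u'\<in>\<rat>. hits f u (t i f) \<noteq> hits f u' (t i f) \<and> (\<forall>y\<in>(\<lambda>j. t j f) ` J. hits f u y = hits f u' y)"
      proof (rule exists_isolating_flips[OF path_continuous[OF f]])
        show "f (t i f) \<noteq> mid" using elim by blast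
        show "\<exists>z<t i f. f z = mid" using elim by (intro regular_past_zero) blast
        show "finite ((\<lambda>j. t j f) ` J)" using J by simp
        show "f y \<noteq> mid" if "y \<in> (\<lambda>j. t j f) ` J" for y using elim that by blast
        show "hits f (min (t i f) y) (max (t i f) y)" if y: "y \<in> (\<lambda>j. t j f) ` J" for y
        proof -
          from y obtain j where j: "j \<in> J" "y = t j f" by (rule imageE)
          then have "i \<noteq> j" using J(2) by auto
          then show ?thesis using elim j(2) by simp
        qed
      qed
      then obtain n n' where "hits f (rat_time n) (t i f) \<noteq> hits f (rat_time n') (t i f)"
          "\<forall>y\<in>(\<lambda>j. t j f) ` J. hits f (rat_time n) y = hits f (rat_time n') y"
        using rat_time_surj by metis
      then have "C (prod_encode (n, n')) f" by (simp add: C_def)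
      then have C: "C (\<kappa> f) f" unfolding \<kappa>_def by (rule LeastI)
      have s: "sign_at t (?\<Psi> f) j \<longleftrightarrow> (if hits f (rat_time (fst (prod_decode (\<kappa> f)))) (t j f) = hits f (rat_time (snd (prod_decode (\<kappa> f)))) (t j f)
          then mid < f (t j f) else f (t j f) < mid)" for j
        unfolding sign_at_def t2[OF f] unfolding flip_pair_def by (rule flip_flip_above)
      have "sign_at t (?\<Psi> f) i \<longleftrightarrow> \<not> sign_at t f i"
        using C elim(1) unfolding s C_def by (auto simp: sign_at_def not_less order.order_iff_strict)
      moreover have "\<forall>j\<in>J. sign_at t (?\<Psi> f) j \<longleftrightarrow> sign_at t f j"
        using C unfolding s C_def by (auto simp: sign_at_def)
      ultimately show ?case by blast
    qed
  qed
qed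

text \<open>
  Changing the sign with label \<open>i\<close> alone preserves the law and every event built from invariant events
  and the other signs, so this sign splits each such event into halves.
\<close>

lemma sign_cylinder:
  assumes A: "A \<in> flip_invariant" and J: "finite J"
  shows "emeasure K {f\<in>A. \<forall>j\<in>J. sign_at t f j \<in> E j} = emeasure K A * (\<Prod>j\<in>J. ennreal (real (card (E j)) / 2))"
  using J
proof (induction J rule: finite_induct)
  case empty
  then show ?case by simp
next
  case (insert i J)
  interpret K: prob_space K by (rule prob_space_K)
  let ?X = "{f\<in>A. \<forall>j\<in>J. sign_at t f j \<in> E j}"
  have A_sets: "A \<in> sets K" and A_sub: "A \<subseteq> paths a b"
    using A sets.sets_into_space[of A K] by (auto simp: flip_invariant_def)
  have X_sets: "?X \<in> sets K"
  proof -
    have "Measurable.pred (path_space a b) (\<lambda>f. \<forall>j\<in>J. sign_at t f j \<in> E j)"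
    proof (rule pred_intros_finite(3)[OF insert(1)])
      fix j
      have "Measurable.pred (path_space a b) (\<lambda>f. (sign_at t f j \<and> True \<in> E j) \<or> (\<not> sign_at t f j \<and> False \<in> E j))"
        using measurable_sign[of j] by measurable
      then show "Measurable.pred (path_space a b) (\<lambda>f. sign_at t f j \<in> E j)"
        by (rule measurable_cong[THEN iffD1, rotated]) (metis (full_types))
    qed
    then have "{f\<in>paths a b. \<forall>j\<in>J. sign_at t f j \<in> E j} \<in> sets K" by (simp add: pred_def)
    then have "A \<inter> {f\<in>paths a b. \<forall>j\<in>J. sign_at t f j \<in> E j} \<in> sets K" using A_sets by blast
    also have "A \<inter> {f\<in>paths a b. \<forall>j\<in>J. sign_at t f j \<in> E j} = ?X" using A_sub by auto
    finally show ?thesis .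
  qed
  have S_sets: "{f\<in>paths a b. sign_at t f i} \<in> sets K" using measurable_sign[of i] by (simp add: pred_def)
  let ?P = "{f\<in>?X. sign_at t f i}" and ?N = "{f\<in>?X. \<not> sign_at t f i}"
  have P: "?P \<in> sets K"
  proof -
    have "?P = ?X \<inter> {f\<in>paths a b. sign_at t f i}" using A_sub by auto
    then show ?thesis using sets.Int[OF X_sets S_sets] by simp
  qed
  have N: "?N \<in> sets K"
  proof -
    have "?N = ?X - ?P" by auto
    then show ?thesis using sets.Diff[OF X_sets P] by simp
  qed
  obtain \<Psi> where \<Psi>: "\<Psi> \<in> K \<rightarrow>\<^sub>M K" "distr K K \<Psi> = K"
    "\<And>A f. A \<in> flip_invariant \<Longrightarrow> f \<in> paths a b \<Longrightarrow> \<Psi> f \<in> A \<longleftrightarrow> f \<in> A"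
    "AE f in K. (sign_at t (\<Psi> f) i \<longleftrightarrow> \<not> sign_at t f i) \<and> (\<forall>j\<in>J. sign_at t (\<Psi> f) j \<longleftrightarrow> sign_at t f j)"
    by (rule flip_one_sign[OF insert(1,2)]) (rule that)
  have "emeasure K ?P = emeasure (distr K K \<Psi>) ?P" by (simp add: \<Psi>(2))
  also have "\<dots> = emeasure K (\<Psi> -` ?P \<inter> space K)" using \<Psi>(1) P by (rule emeasure_distr)
  also have "\<dots> = emeasure K ?N"
  proof (rule emeasure_eq_AE)
    show "AE f in K. f \<in> \<Psi> -` ?P \<inter> space K \<longleftrightarrow> f \<in> ?N"
      using \<Psi>(4) AE_space by eventually_elim (use \<Psi>(3)[OF A] in auto)
  qed (use measurable_sets[OF \<Psi>(1) P] N in auto)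
  finally have PN: "emeasure K ?P = emeasure K ?N" .
  have XPN: "emeasure K ?X = emeasure K ?P + emeasure K ?N"
  proof -
    have "emeasure K ?P + emeasure K ?N = emeasure K (?P \<union> ?N)" by (rule plus_emeasure[OF P N]) auto
    also have "?P \<union> ?N = ?X" by auto
    finally show ?thesis ..
  qed
  have half: "emeasure K ?P = emeasure K ?X * ennreal (1 / 2)"
  proof -
    have "K.prob ?X = 2 * K.prob ?P"
      using XPN PN by (simp add: K.emeasure_eq_measure ennreal_plus[symmetric] del: ennreal_plus)
    then have "emeasure K ?P = ennreal (K.prob ?X * (1 / 2))" by (simp add: K.emeasure_eq_measure)
    also have "\<dots> = emeasure K ?X * ennreal (1 / 2)"
      unfolding K.emeasure_eq_measure by (rule ennreal_mult) simp_all
    finally show ?thesis .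
  qed
  have "emeasure K {f\<in>?X. sign_at t f i \<in> E i} = emeasure K ?X * ennreal (real (card (E i)) / 2)"
  proof -
    have "E i \<in> Pow (UNIV :: bool set)" by simp
    then consider "E i = {}" | "E i = {True}" | "E i = {False}" | "E i = {True, False}"
      unfolding UNIV_bool by auto
    then show ?thesis
      by cases (use half PN in \<open>simp_all add: XPN[symmetric]\<close>)
  qed
  moreover have "{f\<in>A. \<forall>j\<in>insert i J. sign_at t f j \<in> E j} = {f\<in>?X. sign_at t f i \<in> E i}" by auto
  ultimately show ?case using insert by (simp add: mult.assoc mult.commute[of "ennreal (real (card (E i)) / 2)"])
qed

text \<open>
  Cylinder events suffice for each fixed invariant event, and rectangles suffice for the pair.
\<close>

theorem signs_are_fair_coins:
  "distr K (Inv \<Otimes>\<^sub>M coins) (\<lambda>f. (f, sign_at t f)) = distr K Inv (\<lambda>f. f) \<Otimes>\<^sub>M (coins :: ('i \<Rightarrow> bool) measure)"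
    (is "?L = ?I \<Otimes>\<^sub>M ?C")
    and measurable_sign_at: "(sign_at t) \<in> K \<rightarrow>\<^sub>M (coins :: ('i \<Rightarrow> bool) measure)"
proof -
  interpret K: prob_space K by (rule prob_space_K)
  interpret I: prob_space ?I by (rule K.prob_space_distr) simp
  interpret C: prob_space ?C by (rule prob_space_coins)
  show s: "(sign_at t) \<in> K \<rightarrow>\<^sub>M ?C"
    unfolding coins_def
  proof (rule measurable_PiM_single')
    fix i
    show "(\<lambda>f. sign_at t f i) \<in> K \<rightarrow>\<^sub>M measure_pmf (bernoulli_pmf (1/2))"
      using measurable_sign[of i] by (simp cong: measurable_cong_sets)
  qed simp
  have pm: "(\<lambda>f. (f, sign_at t f)) \<in> K \<rightarrow>\<^sub>M Inv \<Otimes>\<^sub>M ?C" using s by measurable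
  show "?L = ?I \<Otimes>\<^sub>M ?C"
  proof (rule pair_measure_eqI[symmetric])
    show "sigma_finite_measure ?I" "sigma_finite_measure ?C" by unfold_locales
    show "sets (?I \<Otimes>\<^sub>M ?C) = sets ?L" by (simp cong: sets_pair_measure_cong)
    fix A B assume "A \<in> sets ?I" and B: "B \<in> sets ?C"
    then have A: "A \<in> flip_invariant" by (simp add: sets_Inv)
    then have A': "A \<in> sets K" "A \<subseteq> paths a b" using sets.sets_into_space[of A K] by (auto simp: flip_invariant_def)
    let ?D = "distr (density K (indicator A)) ?C (sign_at t)"
    have sD: "(sign_at t) \<in> density K (indicator A) \<rightarrow>\<^sub>M ?C" using s by (simp cong: measurable_cong_sets)
    have D: "emeasure ?D X = emeasure K {f\<in>A. sign_at t f \<in> X}" if X: "X \<in> sets ?C" for X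
    proof -
      have pre: "(sign_at t) -` X \<inter> paths a b \<in> sets K" using measurable_sets[OF s X] by simp
      have "emeasure ?D X = emeasure (density K (indicator A)) ((sign_at t) -` X \<inter> paths a b)"
        using sD X by (simp add: emeasure_distr)
      also have "\<dots> = (\<integral>\<^sup>+f. indicator A f * indicator ((sign_at t) -` X \<inter> paths a b) f \<partial>K)"
        using A' pre by (intro emeasure_density) auto
      also have "\<dots> = (\<integral>\<^sup>+f. indicator {f\<in>A. sign_at t f \<in> X} f \<partial>K)"
        using A' by (intro nn_integral_cong) (auto simp: indicator_def)
      also have "\<dots> = emeasure K {f\<in>A. sign_at t f \<in> X}"
      proof (rule nn_integral_indicator)
        have "{f\<in>A. sign_at t f \<in> X} = A \<inter> ((sign_at t) -` X \<inter> paths a b)" using A' by auto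
        then show "{f\<in>A. sign_at t f \<in> X} \<in> sets K" using A' pre by auto
      qed
      finally show ?thesis .
    qed
    have "?D = scale_measure (emeasure K A) ?C"
    proof (rule measure_eqI_PiM_infinite[where I = UNIV and M = "\<lambda>_. measure_pmf (bernoulli_pmf (1/2))"])
      show "sets ?D = sets (\<Pi>\<^sub>M i\<in>UNIV. measure_pmf (bernoulli_pmf (1/2)))"
        "sets (scale_measure (emeasure K A) ?C) = sets (\<Pi>\<^sub>M i\<in>UNIV. measure_pmf (bernoulli_pmf (1/2)))"
        by (simp_all add: coins_def)
      show "finite_measure ?D"
        using D[OF sets.top] by (intro finite_measureI) (simp add: K.emeasure_eq_measure)
      fix E :: "'i \<Rightarrow> bool set" and J :: "'i set" assume J: "finite J"
      have emb: "prod_emb UNIV (\<lambda>_. measure_pmf (bernoulli_pmf (1/2))) J (Pi\<^sub>E J E) = {\<epsilon>. \<forall>j\<in>J. \<epsilon> j \<in> E j}"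
        by (auto simp: prod_emb_def space_PiM restrict_def PiE_iff extensional_def)
      have "prod_emb UNIV (\<lambda>_. measure_pmf (bernoulli_pmf (1/2))) J (Pi\<^sub>E J E) \<in> sets ?C"
        unfolding coins_def using J by (intro sets_PiM_I) auto
      then show "emeasure ?D (prod_emb UNIV (\<lambda>_. measure_pmf (bernoulli_pmf (1/2))) J (Pi\<^sub>E J E)) =
          emeasure (scale_measure (emeasure K A) ?C) (prod_emb UNIV (\<lambda>_. measure_pmf (bernoulli_pmf (1/2))) J (Pi\<^sub>E J E))"
        unfolding emb using sign_cylinder[OF A J, of E] coins_cylinder[OF J, of E]
        by (simp add: D emeasure_scale_measure)
    qed
    then have "emeasure K {f\<in>A. sign_at t f \<in> B} = emeasure K A * emeasure ?C B"
      using D[OF B] by (simp add: emeasure_scale_measure)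
    moreover have "emeasure ?L (A \<times> B) = emeasure K {f\<in>A. sign_at t f \<in> B}"
    proof -
      have "A \<times> B \<in> sets (Inv \<Otimes>\<^sub>M ?C)" using A B by (simp add: sets_Inv)
      then show ?thesis using pm A' by (subst emeasure_distr) (auto intro!: arg_cong2[where f = emeasure])
    qed
    moreover have "emeasure ?I A = emeasure K A"
      using A A' by (subst emeasure_distr) (auto simp: sets_Inv intro!: arg_cong2[where f = emeasure])
    ultimately show "emeasure ?I A * emeasure ?C B = emeasure ?L (A \<times> B)" by simp
  qed
qed

end

end

section \<open>The point configuration attached to a path\<close>

definition binary_value :: "(nat \<Rightarrow> bool) \<Rightarrow> real" where
  "binary_value c = (\<Sum>j. if c j then (1/2) ^ Suc j else 0)"

definition poisson_cdf :: "real \<Rightarrow> nat \<Rightarrow> real" where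
  "poisson_cdf l i = (\<Sum>j\<le>i. l ^ j / fact j * exp (- l))"

text \<open>
  A Poisson number of uniform points of \<open>[0, 1)\<close>: if the \<open>v i\<close> are independent and uniform, then the number
  of indices \<open>i\<close> with \<open>poisson_cdf l i \<le> v 0\<close> is Poisson, and the \<open>v (Suc i)\<close> are the
  positions. The value 1, which a binary expansion can take, is discarded so that unit cells
  do not overlap.
\<close>

definition cell_points :: "real \<Rightarrow> (nat \<Rightarrow> real) \<Rightarrow> real set" where
  "cell_points l v = {v (Suc i) | i. poisson_cdf l i \<le> v 0 \<and> v (Suc i) < 1}"

definition bit_index :: "nat \<Rightarrow> nat \<Rightarrow> nat \<Rightarrow> nat" where
  "bit_index k i j = prod_encode (k, prod_encode (i, j))"

text \<open>
  One sequence of coins is split into a double array of sequences, whose binary values are indexed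
  by a unit cell \<open>k\<close> and a variable \<open>i\<close> within that cell.
\<close>

definition uniforms :: "(nat \<Rightarrow> bool) \<Rightarrow> nat \<Rightarrow> nat \<Rightarrow> real" where
  "uniforms c k i = binary_value (\<lambda>j. c (bit_index k i j))"

lemma summable_binary: "summable (\<lambda>j. if c j then (1/2::real) ^ Suc j else 0)"
  by (rule summable_comparison_test[of _ "\<lambda>j. (1/2) ^ Suc j"])
    (auto intro!: summable_mult summable_geometric)

lemma binary_value_nonneg: "0 \<le> binary_value c"
  unfolding binary_value_def by (rule suminf_nonneg[OF summable_binary]) simp

context level
begin

text \<open>
  The end of a large excursion.
\<close>

definition renewal :: "(real \<Rightarrow> real) \<Rightarrow> real \<Rightarrow> bool" where
  "renewal f T \<longleftrightarrow> f T = m \<and> (\<exists>q<T. big f q \<and> (\<forall>x. q \<le> x \<longrightarrow> x < T \<longrightarrow> f x \<noteq> m))"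

definition fresh :: "(real \<Rightarrow> real) \<Rightarrow> real \<Rightarrow> real \<Rightarrow> bool" where
  "fresh f T x \<longleftrightarrow> (\<forall>T'. T < T' \<longrightarrow> T' \<le> x \<longrightarrow> \<not> renewal f T')"

definition apart :: "(real \<Rightarrow> real) \<Rightarrow> real \<Rightarrow> real \<Rightarrow> bool" where
  "apart f x y \<longleftrightarrow> hits f (min x y) (max x y)"

text \<open>
  The excursions after \<open>T\<close> are represented by rational offsets from \<open>T\<close>: an offset is kept if no earlier
  one in the enumeration lies in the same excursion. Offsets below 1 and before the next renewal
  keep the choice local and keep the excursions used for different renewals distinct; counting the
  offsets from \<open>T\<close> makes the choice commute with translations.
\<close>

definition sampled :: "(real \<Rightarrow> real) \<Rightarrow> real \<Rightarrow> nat \<Rightarrow> bool" where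
  "sampled f T i \<longleftrightarrow> 0 < rat_time i \<and> rat_time i < 1 \<and> f (T + rat_time i) \<noteq> m \<and> fresh f T (T + rat_time i) \<and>
     (\<forall>j<i. 0 < rat_time j \<longrightarrow> rat_time j < 1 \<longrightarrow> apart f (T + rat_time j) (T + rat_time i))"

definition probe_index :: "(real \<Rightarrow> real) \<Rightarrow> real \<Rightarrow> nat \<Rightarrow> nat" where
  "probe_index f T k = enumerate {i. sampled f T i} k"

text \<open>
  The first conjunct only matters when there are fewer than \<open>k + 1\<close> sampled offsets; it keeps the
  bit a function of the path on \<open>[T, T + 1]\<close> for every path, not just for almost every one.
\<close>

definition bit :: "(real \<Rightarrow> real) \<Rightarrow> real \<Rightarrow> nat \<Rightarrow> bool" where
  "bit f T k \<longleftrightarrow> sampled f T (probe_index f T k) \<and> m < f (T + rat_time (probe_index f T k))"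

text \<open>
  After each renewal \<open>T\<close> the unit cells \<open>[T + k, T + k + 1)\<close> receive their own points, and everything
  from the next renewal on is cut off.
\<close>

definition points :: "real \<Rightarrow> (real \<Rightarrow> real) \<Rightarrow> real set" where
  "points l f = {T + real k + u | T k u. renewal f T \<and> u \<in> cell_points l (uniforms (bit f T) k) \<and> fresh f T (T + real k + u)}"

lemma renewal_shift: "renewal (path_shift s f) T \<longleftrightarrow> renewal f (T - s)"
proof
  assume "renewal (path_shift s f) T"
  then obtain q where q: "f (T - s) = m" "q < T" "big f (q - s)" "\<And>x. q \<le> x \<Longrightarrow> x < T \<Longrightarrow> f (x - s) \<noteq> m"
    by (auto simp: renewal_def path_shift_def big_def)
  then show "renewal f (T - s)" unfolding renewal_def
    using q(4)[of "_ + s"] by (intro conjI exI[of _ "q - s"]) auto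
next
  assume "renewal f (T - s)"
  then obtain q where q: "f (T - s) = m" "q < T - s" "big f q" "\<And>x. q \<le> x \<Longrightarrow> x < T - s \<Longrightarrow> f x \<noteq> m"
    by (auto simp: renewal_def)
  then show "renewal (path_shift s f) T" unfolding renewal_def path_shift_def big_def
    by (intro conjI exI[of _ "q + s"]) auto
qed

lemma fresh_shift: "fresh (path_shift s f) T x \<longleftrightarrow> fresh f (T - s) (x - s)"
proof
  assume *: "fresh (path_shift s f) T x"
  show "fresh f (T - s) (x - s)" unfolding fresh_def
  proof (intro allI impI)
    fix T' assume "T - s < T'" "T' \<le> x - s"
    then have "\<not> renewal (path_shift s f) (T' + s)" using * by (simp add: fresh_def)
    then show "\<not> renewal f T'" by (simp add: renewal_shift)
  qed
next
  assume "fresh f (T - s) (x - s)"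
  then show "fresh (path_shift s f) T x" by (simp add: fresh_def renewal_shift)
qed

lemma sampled_shift: "sampled (path_shift s f) T i \<longleftrightarrow> sampled f (T - s) i"
proof -
  have e: "T + r - s = T - s + r" for r by simp
  have "apart (path_shift s f) (T + r) (T + r') \<longleftrightarrow> apart f (T - s + r) (T - s + r')" for r r'
    by (simp add: apart_def hits_shift e[symmetric] min_def max_def)
  moreover have "path_shift s f (T + r) = f (T - s + r)" for r
    by (simp add: path_shift_def e)
  ultimately show ?thesis by (simp add: sampled_def fresh_shift e)
qed

lemma bit_shift: "bit (path_shift s f) T = bit f (T - s)"
proof -
  have "path_shift s f (T + r) = f (T - s + r)" for r by (simp add: path_shift_def algebra_simps)
  then show ?thesis by (simp add: fun_eq_iff bit_def probe_index_def sampled_shift)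
qed

theorem points_shift: "points l (path_shift s f) = (\<lambda>x. x + s) ` points l f"
proof (intro set_eqI iffI)
  fix x assume "x \<in> points l (path_shift s f)"
  then obtain T k u where x: "x = T + real k + u" "renewal f (T - s)" "u \<in> cell_points l (uniforms (bit f (T - s)) k)"
    "fresh f (T - s) (T + real k + u - s)"
    by (auto simp: points_def renewal_shift bit_shift fresh_shift)
  have e: "T + real k + u - s = T - s + real k + u" by simp
  have "T - s + real k + u \<in> points l f" using x(2-4) unfolding points_def e by blast
  then have "x - s \<in> points l f" by (simp only: x(1) e)
  then show "x \<in> (\<lambda>x. x + s) ` points l f" by (intro image_eqI[of _ _ "x - s"]) auto
next
  fix x assume "x \<in> (\<lambda>x. x + s) ` points l f"
  then obtain T k u where x: "x = T + real k + u + s" "renewal f T" "u \<in> cell_points l (uniforms (bit f T) k)"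
    "fresh f T (T + real k + u)"
    by (auto simp: points_def)
  show "x \<in> points l (path_shift s f)" unfolding points_def renewal_shift bit_shift fresh_shift
  proof (rule CollectI, rule exI[of _ "T + s"], rule exI[of _ k], rule exI[of _ u], intro conjI)
    have "T + s - s = T" "T + s + real k + u - s = T + real k + u" by simp_all
    then show "fresh f (T + s - s) (T + s + real k + u - s)" "renewal f (T + s - s)"
      "u \<in> cell_points l (uniforms (bit f (T + s - s)) k)" using x(2-4) by (simp_all only:)
  qed (simp add: x(1))
qed

lemma first_hit_renewal:
  assumes f: "continuous_on UNIV f" and q: "big f q" "hits f q x"
  shows "renewal f (hit_time {m} q f)" "q < hit_time {m} q f" "hit_time {m} q f \<le> x"
    "\<And>y. q \<le> y \<Longrightarrow> y < hit_time {m} q f \<Longrightarrow> f y \<noteq> m"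
proof -
  let ?T = "hit_time {m} q f"
  obtain z where z: "q \<le> z" "z \<le> x" "f z = m" using q(2) by (auto simp: hits_def)
  have T: "q \<le> ?T" "f ?T = m" "?T \<le> z"
    using hit_time[OF f, of "{m}" q z] z by simp_all
  show "?T \<le> x" using T z by simp
  have "f q \<noteq> m" using q(1) \<eta> by (auto simp: big_def)
  then show "q < ?T" using T by (cases "q = ?T") auto
  show no: "f y \<noteq> m" if "q \<le> y" "y < ?T" for y
    using hit_time(3)[OF f, of "{m}" q y] that by auto
  show "renewal f ?T" unfolding renewal_def using T(2) \<open>q < ?T\<close> q(1) no by auto
qed

text \<open>
  A large excursion that ends after the zero \<open>T0\<close> also starts after it.
\<close>

lemma renewal_local:
  assumes zero: "f T0 = m" and agree: "\<And>x. T0 \<le> x \<Longrightarrow> x \<le> T \<Longrightarrow> f x = f' x"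
    and T: "T0 < T" "renewal f T"
  shows "renewal f' T"
proof -
  obtain q where q: "q < T" "big f q" "\<And>x. q \<le> x \<Longrightarrow> x < T \<Longrightarrow> f x \<noteq> m" "f T = m"
    using T(2) by (auto simp: renewal_def)
  have "T0 < q" using q(3)[of T0] zero T(1) by force
  then show ?thesis unfolding renewal_def using q agree T(1)
    by (intro conjI exI[of _ q]) (auto simp: big_def)
qed

lemma fresh_local:
  assumes "f T0 = m" "\<And>x. T0 \<le> x \<Longrightarrow> x \<le> y \<Longrightarrow> f x = f' x"
  shows "fresh f T0 y \<longleftrightarrow> fresh f' T0 y"
proof (cases "T0 \<le> y")
  case True
  have "renewal f T \<longleftrightarrow> renewal f' T" if T: "T0 < T" "T \<le> y" for T
    using renewal_local[of f T0 T f'] renewal_local[of f' T0 T f] assms T by auto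
  then show ?thesis by (auto simp: fresh_def)
qed (auto simp: fresh_def)

lemma bit_local:
  assumes zero: "f T = m" and agree: "\<And>x. T \<le> x \<Longrightarrow> x \<le> T + 1 \<Longrightarrow> f x = f' x"
  shows "bit f T = bit f' T"
proof -
  have ap: "apart f (T + r) (T + r') \<longleftrightarrow> apart f' (T + r) (T + r')" if "0 < r" "r < 1" "0 < r'" "r' < 1" for r r'
    unfolding apart_def hits_def
    by (intro bex_cong refl) (use that agree in \<open>auto simp: min_def max_def split: if_splits\<close>)
  have fr: "fresh f T (T + r) \<longleftrightarrow> fresh f' T (T + r)" if "0 < r" "r < 1" for r
    using that by (intro fresh_local zero agree) auto
  have s: "sampled f T i \<longleftrightarrow> sampled f' T i" for i
    unfolding sampled_def using ap fr agree[of "T + rat_time i"] by (auto 0 3)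
  then have "{i. sampled f T i} = {i. sampled f' T i}" by simp
  then have "probe_index f T = probe_index f' T" unfolding probe_index_def[abs_def] by (simp only:)
  moreover have "f (T + rat_time i) = f' (T + rat_time i)" if "sampled f T i" for i
    using that agree[of "T + rat_time i"] by (auto simp: sampled_def)
  ultimately show ?thesis using s by (auto simp: bit_def fun_eq_iff)
qed

text \<open>
  The large value at \<open>q\<close> and the zero between \<open>q\<close> and 0 guarantee a renewal in \<open>(q, 0]\<close>. A point in \<open>(0, 1)\<close>
  belongs to the last renewal before it, which hence lies in \<open>(q, 1)\<close> and uses its bits from the path
  before time 2.
\<close>

theorem points_local:
  assumes f: "continuous_on UNIV f" and q: "big f q" "hits f q 0"
    and agree: "\<And>x. q \<le> x \<Longrightarrow> x < 2 \<Longrightarrow> f x = f' x"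
    and p: "p \<in> points l f" "0 < p" "p < 1"
  shows "p \<in> points l f'"
proof -
  obtain T k u where T: "p = T + real k + u" "renewal f T" "u \<in> cell_points l (uniforms (bit f T) k)" "fresh f T p"
    using p(1) by (auto simp: points_def)
  have u: "0 \<le> u" using T(3) by (auto simp: cell_points_def uniforms_def binary_value_nonneg)
  define d where "d = hit_time {m} q f"
  have d: "renewal f d" "q < d" "d \<le> 0" "\<And>y. q \<le> y \<Longrightarrow> y < d \<Longrightarrow> f y \<noteq> m"
    using first_hit_renewal[OF f q] by (auto simp: d_def)
  have "d \<le> T"
  proof (rule ccontr)
    assume "\<not> d \<le> T"
    then show False using T(4)[unfolded fresh_def, rule_format, of d] d(1,3) p(2) by simp
  qed
  have T1: "T < 1" "T \<le> p" using T(1) u p(3) by auto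
  have zero: "f T = m" using T(2) by (simp add: renewal_def)
  have r': "renewal f' T"
  proof (cases "T = d")
    case True
    have "f' x = f x" if "q \<le> x" "x \<le> d" for x using agree[of x] that d(3) by simp
    then show ?thesis unfolding renewal_def True using d(2,4) zero q(1) True
      by (intro conjI exI[of _ q]) (auto simp: big_def)
  next
    case False
    then show ?thesis using renewal_local[of f d T f'] d T(2) \<open>d \<le> T\<close> T1 agree by (auto simp: renewal_def[of f d])
  qed
  have "bit f T = bit f' T"
    using zero by (rule bit_local) (use agree d(2) \<open>d \<le> T\<close> T1 in auto)
  moreover have "fresh f' T p"
    using fresh_local[of f T p f'] zero T(4) agree d(2) \<open>d \<le> T\<close> p(3) by auto
  ultimately show ?thesis unfolding points_def using T r' by auto
qed

subsection \<open>Invariance under flips\<close>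

lemma renewal_flip [simp]: "renewal (flip q f) = renewal f"
  by (auto simp: renewal_def fun_eq_iff)

lemma fresh_flip [simp]: "fresh (flip q f) = fresh f"
  by (auto simp: fresh_def fun_eq_iff)

lemma sampled_flip [simp]: "sampled (flip q f) = sampled f"
  by (auto simp: sampled_def fun_eq_iff apart_def)

lemma probe_index_flip [simp]: "probe_index (flip q f) = probe_index f"
  by (auto simp: probe_index_def fun_eq_iff)

lemma hit_time_flip [simp]: "hit_time {m} x (flip q f) = hit_time {m} x f"
  by (simp add: hit_time_def)

end

section \<open>Measurability of the point configuration\<close>

lemma measurable_enumerate:
  assumes "\<And>i. Measurable.pred N (\<lambda>x. i \<in> S x)"
  shows "(\<lambda>x. enumerate (S x) k) \<in> N \<rightarrow>\<^sub>M count_space (UNIV :: nat set)"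
  using assms
proof (induction k arbitrary: S)
  case 0
  have "(\<lambda>x. LEAST i. i \<in> S x) \<in> N \<rightarrow>\<^sub>M count_space UNIV" using 0 by (rule measurable_Least)
  then show ?case by (simp add: enumerate_0)
next
  case (Suc k)
  have L: "(\<lambda>x. LEAST i. i \<in> S x) \<in> N \<rightarrow>\<^sub>M count_space UNIV" using Suc.prems by (rule measurable_Least)
  have "Measurable.pred N (\<lambda>x. i \<in> S x - {LEAST i. i \<in> S x})" for i
  proof -
    have "Measurable.pred N (\<lambda>x. (LEAST i. i \<in> S x) = i)" using L by measurable
    then have "Measurable.pred N (\<lambda>x. i \<in> S x \<and> \<not> (LEAST i. i \<in> S x) = i)"
      by (rule pred_intros_logic(3)[OF Suc.prems pred_intros_logic(2)])
    then show ?thesis by (rule measurable_cong[THEN iffD1, rotated]) auto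
  qed
  then show ?case unfolding enumerate_Suc by (rule Suc.IH)
qed

lemma borel_measurable_binary_value:
  assumes "\<And>j. Measurable.pred N (\<lambda>x. c x j)"
  shows "(\<lambda>x. binary_value (c x)) \<in> borel_measurable N"
  unfolding binary_value_def
  by (intro borel_measurable_suminf measurable_If measurable_const) (use assms in \<open>auto simp: pred_def\<close>)

context level
begin

text \<open>
  Every large excursion contains a rational time at which it is already large, so its end is one of
  countably many measurable times.
\<close>

definition active :: "nat \<Rightarrow> (real \<Rightarrow> real) \<Rightarrow> bool" where
  "active n f \<longleftrightarrow> big f (rat_time n) \<and> (\<exists>N::nat. hits f (rat_time n) (real N))"

definition ren_time :: "nat \<Rightarrow> (real \<Rightarrow> real) \<Rightarrow> real" where
  "ren_time n f = hit_time {m} (rat_time n) f"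

lemma active_flip [simp]: "active n (flip q f) \<longleftrightarrow> active n f"
  by (simp add: active_def)

lemma ren_time_flip [simp]: "ren_time n (flip q f) = ren_time n f"
  by (simp add: ren_time_def)

lemma renewal_iff_active:
  assumes f: "continuous_on UNIV f"
  shows "renewal f T \<longleftrightarrow> (\<exists>n. active n f \<and> T = ren_time n f)"
proof
  assume "\<exists>n. active n f \<and> T = ren_time n f"
  then show "renewal f T" using first_hit_renewal(1)[OF f] by (auto simp: active_def ren_time_def)
next
  assume "renewal f T"
  then obtain q where q: "f T = m" "q < T" "big f q" "\<And>x. q \<le> x \<Longrightarrow> x < T \<Longrightarrow> f x \<noteq> m"
    by (auto simp: renewal_def)
  have "open {x. \<eta> < \<bar>x - m\<bar>}" by (intro open_Collect_less continuous_intros)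
  from open_vimage[OF this f] obtain d where d: "d > 0" "\<And>x. \<bar>x - q\<bar> < d \<Longrightarrow> big f x"
    using q(3) unfolding open_dist dist_real_def big_def by (auto simp: vimage_def)
  have "\<exists>q'\<in>\<rat>. q < q' \<and> q' < min T (q + d)" using d q(2) by (intro Rats_dense_in_real) auto
  then obtain q' where q': "q' \<in> \<rat>" "q < q'" "q' < T" "q' < q + d" by auto
  obtain n where n: "rat_time n = q'" using rat_time_surj[OF q'(1)] by blast
  obtain N :: nat where N: "T \<le> real N" using real_arch_simple by blast
  have h: "hit_time {m} q' f \<le> T" "q' \<le> hit_time {m} q' f" "f (hit_time {m} q' f) = m"
    using hit_time[OF f, of "{m}" q' T] q(1) q'(3) by auto
  then have "hit_time {m} q' f = T" using q(4)[of "hit_time {m} q' f"] q'(2) by force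
  moreover have "active n f"
    using d(2)[of q'] q' hitsI[of q' T "real N" f] N q(1) by (auto simp: active_def n)
  ultimately show "\<exists>n. active n f \<and> T = ren_time n f" using n by (auto simp: ren_time_def)
qed

lemma measurable_active [measurable]: "Measurable.pred (path_space a b) (active n)"
  unfolding active_def by measurable

lemma measurable_ren_time [measurable]: "ren_time n \<in> borel_measurable (path_space a b)"
proof (subst borel_measurable_iff_le, rule allI)
  fix c
  let ?q = "rat_time n"
  have eq: "ren_time n f \<le> c \<longleftrightarrow> (if \<exists>N::nat. hits f ?q (real N) then hits f ?q c else Inf {} \<le> c)"
    if "f \<in> paths a b" for f
  proof (cases "\<exists>N::nat. hits f ?q (real N)")
    case True
    then obtain z where "?q \<le> z" "f z = m" by (auto simp: hits_def)
    then show ?thesis using True hits_iff_hit_time[OF path_continuous[OF that], of ?q z c] by (simp add: ren_time_def)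
  next
    case False
    have "{x. ?q \<le> x \<and> f x \<in> {m}} = {}"
    proof (rule ccontr)
      assume "{x. ?q \<le> x \<and> f x \<in> {m}} \<noteq> {}"
      then obtain x where "?q \<le> x" "f x = m" by auto
      moreover obtain N :: nat where "x \<le> real N" using real_arch_simple by blast
      ultimately show False using False by (auto simp: hits_def)
    qed
    then show ?thesis using False unfolding ren_time_def hit_time_def by (simp only: if_False)
  qed
  have "Measurable.pred (path_space a b) (\<lambda>f. if \<exists>N::nat. hits f ?q (real N) then hits f ?q c else Inf {} \<le> c)"
    by measurable
  then have "Measurable.pred (path_space a b) (\<lambda>f. ren_time n f \<le> c)"
    by (rule measurable_cong[THEN iffD1, rotated]) (simp add: eq)
  then show "{f \<in> space (path_space a b). ren_time n f \<le> c} \<in> sets (path_space a b)" by (simp add: pred_def)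
qed

lemma fresh_iff_active:
  assumes "continuous_on UNIV f"
  shows "fresh f T x \<longleftrightarrow> (\<forall>n. \<not> (active n f \<and> T < ren_time n f \<and> ren_time n f \<le> x))"
  unfolding fresh_def renewal_iff_active[OF assms] by blast

lemma measurable_fresh:
  assumes [measurable]: "X \<in> borel_measurable (path_space a b)" "Y \<in> borel_measurable (path_space a b)"
  shows "Measurable.pred (path_space a b) (\<lambda>f. fresh f (X f) (Y f))"
proof -
  have "Measurable.pred (path_space a b) (\<lambda>f. X f < ren_time n f)" for n
    by (rule borel_measurable_pred_less[OF assms(1) measurable_ren_time])
  moreover have "Measurable.pred (path_space a b) (\<lambda>f. ren_time n f \<le> Y f)" for n
    unfolding pred_def by (rule borel_measurable_le[OF measurable_ren_time assms(2)])
  ultimately have "Measurable.pred (path_space a b) (\<lambda>f. \<forall>n. \<not> (active n f \<and> X f < ren_time n f \<and> ren_time n f \<le> Y f))"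
    by (intro pred_intros_countable(1) pred_intros_logic(2,3) measurable_active)
  then show ?thesis
    by (rule measurable_cong[THEN iffD1, rotated]) (simp add: fresh_iff_active[OF path_continuous])
qed

lemma measurable_sampled:
  assumes X [measurable]: "X \<in> borel_measurable (path_space a b)"
  shows "Measurable.pred (path_space a b) (\<lambda>f. sampled f (X f) i)"
proof -
  note [measurable] = measurable_path_eval_random
  have ap [measurable]: "Measurable.pred (path_space a b) (\<lambda>f. apart f (X f + r) (X f + r'))" for r r'
    unfolding apart_def by (rule measurable_hits) measurable
  have fr [measurable]: "Measurable.pred (path_space a b) (\<lambda>f. fresh f (X f) (X f + r))" for r
    by (rule measurable_fresh) measurable
  have ev [measurable]: "(\<lambda>f. f (X f + r)) \<in> borel_measurable (path_space a b)" for r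
    by (rule measurable_path_eval_random) measurable
  show ?thesis unfolding sampled_def by measurable
qed

lemma measurable_probe_index:
  assumes X: "X \<in> borel_measurable (path_space a b)"
  shows "(\<lambda>f. probe_index f (X f) k) \<in> path_space a b \<rightarrow>\<^sub>M count_space UNIV"
  unfolding probe_index_def by (rule measurable_enumerate) (simp add: measurable_sampled[OF X])

lemma measurable_probe_time:
  assumes X [measurable]: "X \<in> borel_measurable (path_space a b)"
  shows "(\<lambda>f. X f + rat_time (probe_index f (X f) k)) \<in> borel_measurable (path_space a b)"
proof -
  have "(\<lambda>f. rat_time (probe_index f (X f) k)) \<in> borel_measurable (path_space a b)"
    by (rule measurable_compose[OF measurable_probe_index[OF X]]) simp
  then show ?thesis by measurable
qed

lemma measurable_bit:
  assumes X: "X \<in> borel_measurable (path_space a b)"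
  shows "Measurable.pred (path_space a b) (\<lambda>f. bit f (X f) k)"
proof -
  have 1: "Measurable.pred (path_space a b) (\<lambda>f. sampled f (X f) (probe_index f (X f) k))"
    by (rule measurable_compose_countable[OF measurable_sampled[OF X] measurable_probe_index[OF X]])
  have 2: "(\<lambda>f. f (X f + rat_time (probe_index f (X f) k))) \<in> borel_measurable (path_space a b)"
    by (rule measurable_path_eval_random[OF measurable_probe_time[OF X]])
  have "Measurable.pred (path_space a b) (\<lambda>f. m < f (X f + rat_time (probe_index f (X f) k)))"
    using 2 by measurable
  with 1 show ?thesis unfolding bit_def by (rule pred_intros_logic(3))
qed

lemma measurable_uniforms:
  assumes X: "X \<in> borel_measurable (path_space a b)"
  shows "(\<lambda>f. uniforms (bit f (X f)) k i) \<in> borel_measurable (path_space a b)"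
  unfolding uniforms_def by (rule borel_measurable_binary_value) (rule measurable_bit[OF X])

lemma points_eq_active:
  assumes "continuous_on UNIV f"
  shows "points l f = {ren_time n f + real k + uniforms (bit f (ren_time n f)) k (Suc i) | n k i.
    active n f \<and> poisson_cdf l i \<le> uniforms (bit f (ren_time n f)) k 0 \<and> uniforms (bit f (ren_time n f)) k (Suc i) < 1 \<and>
    fresh f (ren_time n f) (ren_time n f + real k + uniforms (bit f (ren_time n f)) k (Suc i))}"
  unfolding points_def cell_points_def renewal_iff_active[OF assms] by blast

lemma countable_points:
  assumes "continuous_on UNIV f"
  shows "countable (points l f)"
proof -
  let ?g = "\<lambda>(n, k, i). ren_time n f + real k + uniforms (bit f (ren_time n f)) k (Suc i)"
  have "points l f \<subseteq> range ?g"
  proof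
    fix x assume "x \<in> points l f"
    then obtain n k i where "x = ren_time n f + real k + uniforms (bit f (ren_time n f)) k (Suc i)"
      unfolding points_eq_active[OF assms] by blast
    then have "x = ?g (n, k, i)" by simp
    then show "x \<in> range ?g" by (rule image_eqI) simp
  qed
  then show ?thesis by (rule countable_subset) simp
qed

lemma measurable_points_void:
  assumes A [measurable]: "A \<in> sets borel"
  shows "Measurable.pred (path_space a b) (\<lambda>f. points l f \<inter> A = {})"
proof -
  let ?U = "\<lambda>n k i f. uniforms (bit f (ren_time n f)) k i"
  have U [measurable]: "?U n k i \<in> borel_measurable (path_space a b)" for n k i
    by (rule measurable_uniforms) simp
  have F [measurable]: "Measurable.pred (path_space a b) (\<lambda>f. fresh f (ren_time n f) (ren_time n f + real k + ?U n k (Suc i) f))" for n k i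
    by (rule measurable_fresh) measurable
  have "Measurable.pred (path_space a b) (\<lambda>f. \<forall>n k i. active n f \<longrightarrow> poisson_cdf l i \<le> ?U n k 0 f \<longrightarrow> ?U n k (Suc i) f < 1 \<longrightarrow>
     fresh f (ren_time n f) (ren_time n f + real k + ?U n k (Suc i) f) \<longrightarrow> ren_time n f + real k + ?U n k (Suc i) f \<notin> A)"
    by measurable
  then show ?thesis
  proof (rule measurable_cong[THEN iffD1, rotated])
    fix f assume "f \<in> space (path_space a b)"
    then have f: "continuous_on UNIV f" by (simp add: path_continuous)
    show "(\<forall>n k i. active n f \<longrightarrow> poisson_cdf l i \<le> ?U n k 0 f \<longrightarrow> ?U n k (Suc i) f < 1 \<longrightarrow>
       fresh f (ren_time n f) (ren_time n f + real k + ?U n k (Suc i) f) \<longrightarrow> ren_time n f + real k + ?U n k (Suc i) f \<notin> A) \<longleftrightarrow>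
       points l f \<inter> A = {}"
      unfolding points_eq_active[OF f] by blast
  qed
qed

definition point_map :: "real \<Rightarrow> (real \<Rightarrow> real) \<Rightarrow> real measure" where
  "point_map l f = distr (count_space (points l f)) borel (\<lambda>x. x)"

lemma emeasure_point_map:
  assumes "A \<in> sets borel"
  shows "emeasure (point_map l f) A = emeasure (count_space (points l f)) (A \<inter> points l f)"
  unfolding point_map_def using assms by (subst emeasure_distr) (auto simp: vimage_def)

lemma point_map_void:
  assumes "A \<in> sets borel"
  shows "emeasure (point_map l f) A = 0 \<longleftrightarrow> points l f \<inter> A = {}"
  unfolding emeasure_point_map[OF assms] by (subst emeasure_count_space_eq_0) auto

lemma simple_point_map:
  assumes "continuous_on UNIV f"
  shows "simple_point_measure (point_map l f)"
  unfolding simple_point_measure_def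
proof (intro conjI exI ballI)
  show "countable (points l f)" by (rule countable_points[OF assms])
  fix A :: "real set" assume A: "A \<in> sets borel"
  have "emeasure (point_map l f) A = (\<integral>\<^sup>+x. indicator (A \<inter> points l f) x \<partial>count_space (points l f))"
    unfolding emeasure_point_map[OF A] by (subst nn_integral_indicator) auto
  also have "\<dots> = (\<integral>\<^sup>+x. emeasure (return borel x) A \<partial>count_space (points l f))"
    using A by (intro nn_integral_cong) (auto simp: emeasure_return indicator_def)
  finally show "emeasure (point_map l f) A = (\<integral>\<^sup>+x. emeasure (return borel x) A \<partial>count_space (points l f))" .
qed (simp add: point_map_def)

text \<open>
  Only void events need to be checked, and the configuration avoids \<open>A\<close> iff countably many
  measurable candidate points do.
\<close>

theorem measurable_point_map: "point_map l \<in> path_space a b \<rightarrow>\<^sub>M point_measure_space"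
proof (rule measurable_point_measure_spaceI)
  fix A :: "real set" assume A: "A \<in> sets borel"
  then show "{f \<in> space (path_space a b). emeasure (point_map l f) A = 0} \<in> sets (path_space a b)"
    using measurable_points_void[OF A, where a = a and b = b and l = l] by (simp add: pred_def point_map_void)
qed (simp add: simple_point_map path_continuous)

theorem point_map_shift: "point_map l (path_shift s f) = point_shift s (point_map l f)"
proof (rule measure_eqI)
  fix A assume "A \<in> sets (point_map l (path_shift s f))"
  then have A: "A \<in> sets borel" by (simp add: point_map_def)
  have "point_shift s (point_map l f) = distr (count_space (points l f)) borel (\<lambda>x. x + s)"
    unfolding point_shift_def point_map_def by (subst distr_distr) (auto simp: comp_def)
  then have "emeasure (point_shift s (point_map l f)) A = emeasure (count_space (points l f)) {x \<in> points l f. x + s \<in> A}"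
    using A by (simp add: emeasure_distr vimage_def Int_def conj_commute)
  moreover have "emeasure (point_map l (path_shift s f)) A = emeasure (count_space (points l f)) {x \<in> points l f. x + s \<in> A}"
  proof -
    have eq: "A \<inter> points l (path_shift s f) = (\<lambda>x. x + s) ` {x \<in> points l f. x + s \<in> A}"
      unfolding points_shift by auto
    have inj: "inj_on (\<lambda>x. x + s) {x \<in> points l f. x + s \<in> A}" by (auto simp: inj_on_def)
    show ?thesis unfolding emeasure_point_map[OF A] eq unfolding points_shift
      using card_image[OF inj] finite_image_iff[OF inj] by (subst (1 2) emeasure_count_space) auto
  qed
  ultimately show "emeasure (point_map l (path_shift s f)) A = emeasure (point_shift s (point_map l f)) A" by simp
qed (simp add: point_map_def point_shift_def)

end

section \<open>Renewals and probes along a regular path\<close>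

context level
begin

lemma apart_commute: "apart f x y = apart f y x"
  by (simp add: apart_def min.commute max.commute)

lemma not_apart_trans: "\<not> apart f x y \<Longrightarrow> \<not> apart f y z \<Longrightarrow> \<not> apart f x z"
proof
  assume na: "\<not> apart f x y" "\<not> apart f y z" and "apart f x z"
  then obtain w where w: "min x z \<le> w" "w \<le> max x z" "f w = m" by (auto simp: apart_def hits_def)
  have "(min x y \<le> w \<and> w \<le> max x y) \<or> (min y z \<le> w \<and> w \<le> max y z)" using w(1,2) by linarith
  then show False using na w(3) by (auto simp: apart_def hits_def)
qed

lemma no_zero_same_side:
  fixes g :: "real \<Rightarrow> real"
  assumes g: "continuous_on UNIV g" and no: "\<And>z. z \<in> {x..y} \<Longrightarrow> g z \<noteq> m" and "x \<le> y"
  shows "g x < m \<longleftrightarrow> g y < m"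
proof (rule ccontr)
  have c: "continuous_on {x..y} g" using g by (rule continuous_on_subset) simp
  assume "(g x < m) \<noteq> (g y < m)"
  then consider "g x \<le> m \<and> m \<le> g y" | "g y \<le> m \<and> m \<le> g x" by linarith
  then show False
  proof cases
    case 1
    have "\<exists>z\<ge>x. z \<le> y \<and> g z = m" by (rule IVT') (use 1 assms(3) c in auto)
    then show False using no by auto
  next
    case 2
    have "\<exists>z\<ge>x. z \<le> y \<and> - g z = - m" by (rule IVT') (use 2 assms(3) c in \<open>auto intro: continuous_on_minus\<close>)
    then show False using no by auto
  qed
qed

text \<open>
  With a single zero in between, the path has one sign before it and one sign after it, and
  crossing forces the two to differ.
\<close>

lemma single_zero_changes_side:
  assumes g: "continuous_on UNIV g" and T: "q < T" "T < y" "g T = m"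
    and no: "\<And>z. q \<le> z \<Longrightarrow> z \<le> y \<Longrightarrow> z \<noteq> T \<Longrightarrow> g z \<noteq> m" and cr: "crosses g q y"
  shows "g q < m \<longleftrightarrow> \<not> g y < m"
proof (rule ccontr)
  assume same: "\<not> (g q < m \<longleftrightarrow> \<not> g y < m)"
  have side: "g s < m \<longleftrightarrow> g q < m" if s: "q \<le> s" "s \<le> y" "s \<noteq> T" for s
  proof (cases "s < T")
    case True
    have "g q < m \<longleftrightarrow> g s < m" using s True T(2) by (intro no_zero_same_side[OF g] no) auto
    then show ?thesis by simp
  next
    case False
    have "g s < m \<longleftrightarrow> g y < m" using s False T(1) by (intro no_zero_same_side[OF g] no) auto
    then show ?thesis using same by simp
  qed
  have "hits g q y" using T by (intro hitsI[of q T]) auto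
  then obtain s s' where s: "s \<in> {q..y}" "s' \<in> {q..y}" "g s < m" "m < g s'"
    using crossesD[OF cr] T by (metis order.strict_trans)
  then have "s \<noteq> T" "s' \<noteq> T" using T(3) by auto
  then show False using side[of s] side[of s'] s by auto
qed

context
  fixes f :: "real \<Rightarrow> real"
  assumes f: "continuous_on UNIV f" and reg: "regular f"
begin

text \<open>
  If \<open>T\<close> were isolated from the right, then near \<open>T\<close> the path would change its side at its only zero
  \<open>T\<close>. But the flipped path is required to cross as well, and flipping reverses the side after \<open>T\<close> only.
\<close>

lemma zeros_accumulate:
  assumes T: "renewal f T" and y: "T < y"
  shows "\<exists>z. T < z \<and> z < y \<and> f z = m"
proof (rule ccontr)
  assume no: "\<not> (\<exists>z. T < z \<and> z < y \<and> f z = m)"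
  obtain q0 where q0: "f T = m" "q0 < T" "\<And>x. q0 \<le> x \<Longrightarrow> x < T \<Longrightarrow> f x \<noteq> m"
    using T by (auto simp: renewal_def)
  obtain q where q: "q \<in> \<rat>" "q0 < q" "q < T" using Rats_dense_in_real[OF q0(2)] by blast
  obtain y' where y': "y' \<in> \<rat>" "T < y'" "y' < y" using Rats_dense_in_real[OF y] by blast
  have nz: "f z \<noteq> m" if "q \<le> z" "z \<le> y'" "z \<noteq> T" for z
    using that q0(3)[of z] no q y' by (cases "z < T") auto
  have qy: "q < y'" using q y' by simp
  have cr: "crosses f q y'" "crosses (flip q f) q y'"
    using reg q(1) y'(1) qy unfolding regular_def by blast+
  have 1: "f q < m \<longleftrightarrow> \<not> f y' < m"
    by (rule single_zero_changes_side[OF f q(3) y'(2) q0(1) nz cr(1)])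
  have 2: "flip q f q < m \<longleftrightarrow> \<not> flip q f y' < m"
    by (rule single_zero_changes_side[OF continuous_on_flip[OF f] q(3) y'(2) _ _ cr(2)]) (use q0 nz in auto)
  have "\<not> hits f q q" using nz[of q] q qy by (auto simp: hits_def)
  then have 3: "flip q f q = f q" by (simp add: flip_def)
  have "hits f q y'" using q y' q0 by (intro hitsI[of q T]) auto
  then have 4: "flip q f y' = 2 * m - f y'" by (simp add: flip_def)
  have "f y' \<noteq> m" using nz[of y'] y' qy by auto
  then show False using 1 2 unfolding 3 4 by linarith
qed

lemma nonzero_dense:
  assumes "x < y"
  shows "\<exists>s. x < s \<and> s < y \<and> f s \<noteq> m"
proof -
  obtain x' where x': "x' \<in> \<rat>" "x < x'" "x' < y" using Rats_dense_in_real[OF assms] by blast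
  obtain y' where y': "y' \<in> \<rat>" "x' < y'" "y' < y" using Rats_dense_in_real[OF x'(3)] by blast
  show ?thesis
  proof (cases "hits f x' y'")
    case True
    have "crosses f x' y'" using reg x'(1) y'(1,2) unfolding regular_def by blast
    then obtain s s' where "s \<in> {x'..y'}" "f s < m" using crossesD[OF _ True y'(2)] by blast
    then show ?thesis using x' y' by (intro exI[of _ s]) auto
  next
    case False
    then have "f x' \<noteq> m" using y' by (auto simp: hits_def)
    then show ?thesis using x' by blast
  qed
qed

text \<open>
  A path that is uniformly continuous on a bounded interval needs a minimal time to come back to
  \<open>m\<close> from a distance larger than \<open>\<eta>\<close>.
\<close>

lemma renewal_gap:
  obtains \<delta> where "\<delta> > 0" "\<And>T T'. renewal f T \<Longrightarrow> renewal f T' \<Longrightarrow> \<bar>T\<bar> \<le> c \<Longrightarrow> \<bar>T'\<bar> \<le> c \<Longrightarrow> T < T' \<Longrightarrow> T + \<delta> \<le> T'"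
proof -
  have "uniformly_continuous_on {-c..c} f"
    using f by (intro compact_uniformly_continuous continuous_on_subset[OF f]) auto
  then obtain \<delta> where \<delta>: "\<delta> > 0" "\<And>x x'. x \<in> {-c..c} \<Longrightarrow> x' \<in> {-c..c} \<Longrightarrow> \<bar>x' - x\<bar> < \<delta> \<Longrightarrow> \<bar>f x' - f x\<bar> < \<eta>"
    unfolding uniformly_continuous_on_def dist_real_def using \<eta> by blast
  have "T + \<delta> \<le> T'" if T: "renewal f T" "renewal f T'" "\<bar>T\<bar> \<le> c" "\<bar>T'\<bar> \<le> c" "T < T'" for T T'
  proof (rule ccontr)
    assume less: "\<not> T + \<delta> \<le> T'"
    obtain q where q: "f T' = m" "q < T'" "big f q" "\<And>x. q \<le> x \<Longrightarrow> x < T' \<Longrightarrow> f x \<noteq> m"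
      using T(2) by (auto simp: renewal_def)
    have "f T = m" using T(1) by (simp add: renewal_def)
    then have "T < q" using q(4)[of T] T(5) by force
    then have "\<bar>f q - f T'\<bar> < \<eta>" using q(2) T less by (intro \<delta>(2)) auto
    then show False using q(1,3) by (simp add: big_def)
  qed
  then show ?thesis using \<delta>(1) that by blast
qed

lemma renewal_below: "\<exists>T\<le>x. renewal f T"
proof -
  obtain k :: nat where k: "- x < real k" using reals_Archimedean2 by blast
  obtain n where "returns f (- real k - real n) (- real k)" using reg unfolding regular_def by blast
  then obtain r where r: "big f (- real k - real n + r)" "hits f (- real k - real n + r) (- real k)"
    unfolding returns_def by blast
  show ?thesis using first_hit_renewal(1,3)[OF f r] k by (intro exI[of _ "hit_time {m} (- real k - real n + r) f"]) auto
qed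

lemma last_renewal: "\<exists>T\<le>x. renewal f T \<and> fresh f T x"
proof -
  obtain T0 where T0: "T0 \<le> x" "renewal f T0" using renewal_below by blast
  obtain \<delta> where \<delta>: "\<delta> > 0" "\<And>T T'. renewal f T \<Longrightarrow> renewal f T' \<Longrightarrow> \<bar>T\<bar> \<le> max \<bar>T0\<bar> \<bar>x\<bar> \<Longrightarrow> \<bar>T'\<bar> \<le> max \<bar>T0\<bar> \<bar>x\<bar> \<Longrightarrow> T < T' \<Longrightarrow> T + \<delta> \<le> T'"
    by (rule renewal_gap[of "max \<bar>T0\<bar> \<bar>x\<bar>"]) (rule that)
  define S where "S = {T. renewal f T \<and> T0 \<le> T \<and> T \<le> x}"
  have T0S: "T0 \<in> S" using T0 by (simp add: S_def)
  have bdd: "bdd_above S" by (rule bdd_aboveI[of _ x]) (simp add: S_def)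
  have "\<exists>T\<in>S. Sup S - \<delta> < T"
    using less_cSup_iff[OF _ bdd, of "Sup S - \<delta>"] T0S \<delta>(1) by auto
  then obtain T where T: "T \<in> S" "Sup S - \<delta> < T" by blast
  have "fresh f T x" unfolding fresh_def
  proof (intro allI impI notI)
    fix T' assume T': "T < T'" "T' \<le> x" "renewal f T'"
    then have T'S: "T' \<in> S" using T(1) by (simp add: S_def)
    have "T + \<delta> \<le> T'" using T(1) T'S T' by (intro \<delta>(2)) (auto simp: S_def)
    moreover have "T' \<le> Sup S" using T'S bdd by (rule cSup_upper)
    ultimately show False using T(2) by simp
  qed
  then show ?thesis using T(1) by (auto simp: S_def)
qed

lemma fresh_right:
  assumes T: "renewal f T"
  obtains \<delta> where "0 < \<delta>" "\<delta> < 1" "fresh f T (T + \<delta>)"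
proof -
  obtain d where d: "d > 0" "\<And>U U'. renewal f U \<Longrightarrow> renewal f U' \<Longrightarrow> \<bar>U\<bar> \<le> \<bar>T\<bar> + 1 \<Longrightarrow> \<bar>U'\<bar> \<le> \<bar>T\<bar> + 1 \<Longrightarrow> U < U' \<Longrightarrow> U + d \<le> U'"
    by (rule renewal_gap[of "\<bar>T\<bar> + 1"]) (rule that)
  define \<delta> where "\<delta> = min (d / 2) (1 / 2)"
  have \<delta>: "0 < \<delta>" "\<delta> < 1" "\<delta> < d" using d(1) by (auto simp: \<delta>_def)
  have "fresh f T (T + \<delta>)" unfolding fresh_def
  proof (intro allI impI notI)
    fix T' assume T': "T < T'" "T' \<le> T + \<delta>" "renewal f T'"
    have "T + d \<le> T'" using T T' \<delta> by (intro d(2)) auto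
    then show False using T' \<delta> by simp
  qed
  then show ?thesis using that \<delta> by blast
qed

text \<open>
  Zeros accumulate at \<open>T\<close> from the right and the nonzero times are dense, so excursions lie
  arbitrarily close to \<open>T\<close>. The offset of least index in such an excursion is sampled.
\<close>

lemma infinite_sampled:
  assumes T: "renewal f T"
  shows "infinite {i. sampled f T i}"
proof
  assume fin: "finite {i. sampled f T i}"
  obtain \<delta> where \<delta>: "0 < \<delta>" "\<delta> < 1" "fresh f T (T + \<delta>)" using fresh_right[OF T] by blast
  define S where "S = insert (T + \<delta>) ((\<lambda>i. T + rat_time i) ` {i. sampled f T i})"
  define y where "y = Min S"
  have S: "finite S" "S \<noteq> {}" using fin by (auto simp: S_def)
  have "T < y" unfolding y_def using S \<delta> by (subst Min_gr_iff) (auto simp: S_def sampled_def)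
  then obtain z where z: "T < z" "z < y" "f z = m" using zeros_accumulate[OF T] by blast
  have y_le: "y \<le> T + \<delta>" "\<And>i. sampled f T i \<Longrightarrow> y \<le> T + rat_time i"
    unfolding y_def using S by (auto simp: S_def intro!: Min_le)
  obtain s where s: "T < s" "s < z" "f s \<noteq> m" using nonzero_dense[OF z(1)] by blast
  let ?g = "\<lambda>r. f (T + r)"
  have "continuous_on UNIV ?g" by (intro continuous_on_compose2[OF f] continuous_intros) auto
  then have "open (?g -` (- {m}))" by (rule open_vimage[rotated]) auto
  then obtain e where e: "e > 0" "\<And>r. \<bar>r - (s - T)\<bar> < e \<Longrightarrow> f (T + r) \<noteq> m"
    using s(3) unfolding open_dist dist_real_def by (auto dest!: bspec[of _ _ "s - T"])
  have "\<exists>r\<in>\<rat>. s - T < r \<and> r < min (z - T) (s - T + e)" using e(1) s by (intro Rats_dense_in_real) auto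
  then obtain r where r: "r \<in> \<rat>" "s - T < r" "r < z - T" "r < s - T + e" by auto
  have fr: "f (T + r) \<noteq> m" using e(2)[of r] r by auto
  obtain j0 where j0: "rat_time j0 = r" using rat_time_surj[OF r(1)] by blast
  define P where "P j \<longleftrightarrow> 0 < rat_time j \<and> rat_time j < 1 \<and> f (T + rat_time j) \<noteq> m \<and> \<not> apart f (T + rat_time j) (T + r)" for j
  have "P j0" unfolding P_def j0 using fr r s z y_le(1) \<delta> by (auto simp: apart_def hits_def)
  define i where "i = (LEAST j. P j)"
  have Pi: "P i" unfolding i_def using \<open>P j0\<close> by (rule LeastI)
  have min: "\<not> P j" if "j < i" for j using that unfolding i_def by (rule not_less_Least)
  have iz: "T + rat_time i < z"
  proof (rule ccontr)
    assume "\<not> T + rat_time i < z"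
    then have "apart f (T + rat_time i) (T + r)" unfolding apart_def
      using z(3) r by (intro hitsI[of _ z]) auto
    then show False using Pi by (simp add: P_def)
  qed
  have "sampled f T i" unfolding sampled_def
  proof (intro conjI allI impI)
    show "0 < rat_time i" "rat_time i < 1" "f (T + rat_time i) \<noteq> m" using Pi by (auto simp: P_def)
    show "fresh f T (T + rat_time i)" using \<delta>(3) iz z(2) y_le(1) by (auto simp: fresh_def)
    fix j assume j: "j < i" "0 < rat_time j" "rat_time j < 1"
    show "apart f (T + rat_time j) (T + rat_time i)"
    proof (rule ccontr)
      assume na: "\<not> apart f (T + rat_time j) (T + rat_time i)"
      then have "f (T + rat_time j) \<noteq> m" by (auto simp: apart_def hits_def min_def max_def split: if_splits)
      moreover have "\<not> apart f (T + rat_time j) (T + r)"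
        using not_apart_trans[OF na] Pi by (simp add: P_def)
      ultimately have "P j" using j by (simp add: P_def)
      then show False using min[OF j(1)] by simp
    qed
  qed
  then show False using y_le(2)[of i] iz z(2) by simp
qed

lemma probe_sampled: "renewal f T \<Longrightarrow> sampled f T (probe_index f T k)"
  using enumerate_in_set[OF infinite_sampled, of T k] by (simp add: probe_index_def)

lemma probe_index_inj: "renewal f T \<Longrightarrow> probe_index f T k = probe_index f T k' \<Longrightarrow> k = k'"
  using strict_mono_enumerate[OF infinite_sampled, of T] unfolding probe_index_def
  by (metis strict_mono_eq)

end

subsection \<open>Enumerating the renewals without repetition\<close>

text \<open>
  One label for each renewal: the least one in the enumeration of rational times.
\<close>

definition labels :: "(real \<Rightarrow> real) \<Rightarrow> nat set" where
  "labels f = {n. active n f \<and> (\<forall>j<n. active j f \<longrightarrow> ren_time j f \<noteq> ren_time n f)}"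

definition nth_renewal :: "nat \<Rightarrow> (real \<Rightarrow> real) \<Rightarrow> real" where
  "nth_renewal n f = ren_time (enumerate (labels f) n) f"

text \<open>
  A time inside the excursion that supplies the bit \<open>snd p\<close> of the renewal \<open>fst p\<close>.
\<close>

definition probe :: "nat \<times> nat \<Rightarrow> (real \<Rightarrow> real) \<Rightarrow> real" where
  "probe p f = nth_renewal (fst p) f + rat_time (probe_index f (nth_renewal (fst p) f) (snd p))"

lemma nth_renewal_flip [simp]: "nth_renewal n (flip q f) = nth_renewal n f"
  by (simp add: nth_renewal_def labels_def)

lemma probe_flip [simp]: "probe p (flip q f) = probe p f"
  by (simp add: probe_def)

lemma measurable_nth_renewal: "nth_renewal n \<in> borel_measurable (path_space a b)"
proof -
  have ne: "Measurable.pred (path_space a b) (\<lambda>f. ren_time j f \<noteq> ren_time i f)" for i j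
    unfolding pred_def by (rule borel_measurable_neq) (rule measurable_ren_time)+
  have "Measurable.pred (path_space a b) (\<lambda>f. active j f \<longrightarrow> ren_time j f \<noteq> ren_time i f)" for i j
    by (rule pred_intros_logic(4)[OF measurable_active ne])
  then have "Measurable.pred (path_space a b) (\<lambda>f. \<forall>j\<in>{..<i}. active j f \<longrightarrow> ren_time j f \<noteq> ren_time i f)" for i
    by (rule pred_intros_countable_bounded(3))
  then have "Measurable.pred (path_space a b) (\<lambda>f. active i f \<and> (\<forall>j\<in>{..<i}. active j f \<longrightarrow> ren_time j f \<noteq> ren_time i f))" for i
    by (rule pred_intros_logic(3)[OF measurable_active])
  then have "Measurable.pred (path_space a b) (\<lambda>f. i \<in> labels f)" for i
    unfolding labels_def mem_Collect_eq Ball_def lessThan_iff .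
  from measurable_enumerate[OF this] have "(\<lambda>f. enumerate (labels f) n) \<in> path_space a b \<rightarrow>\<^sub>M count_space UNIV" .
  then have "(\<lambda>f. ren_time (enumerate (labels f) n) f) \<in> borel_measurable (path_space a b)"
    by (rule measurable_compose_countable[OF measurable_ren_time])
  then show ?thesis by (simp add: nth_renewal_def[abs_def])
qed

lemma measurable_probe: "probe p \<in> borel_measurable (path_space a b)"
  using measurable_probe_time[OF measurable_nth_renewal] by (simp add: probe_def[abs_def])

context
  fixes f :: "real \<Rightarrow> real"
  assumes f: "continuous_on UNIV f" and reg: "regular f"
begin

lemma renewal_label:
  assumes "renewal f T"
  shows "\<exists>n\<in>labels f. T = ren_time n f"
proof -
  define P where "P n \<longleftrightarrow> active n f \<and> T = ren_time n f" for n
  obtain n where n: "P n" using assms renewal_iff_active[OF f] unfolding P_def by blast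
  define k where "k = (LEAST n. P n)"
  have k: "P k" unfolding k_def using n by (rule LeastI)
  have "\<not> P j" if "j < k" for j using that unfolding k_def by (rule not_less_Least)
  then have "\<forall>j<k. active j f \<longrightarrow> ren_time j f \<noteq> ren_time k f" using k unfolding P_def by metis
  then have "k \<in> labels f" using k by (simp add: labels_def P_def)
  then show ?thesis using k unfolding P_def by blast
qed

lemma infinite_labels: "infinite (labels f)"
proof
  assume "finite (labels f)"
  then have fin: "finite ((\<lambda>n. ren_time n f) ` labels f)" by simp
  have "{T. renewal f T} \<subseteq> (\<lambda>n. ren_time n f) ` labels f" using renewal_label by auto
  then have fin: "finite {T. renewal f T}" using fin by (rule finite_subset)
  obtain T where "T \<le> Min {T. renewal f T} - 1" "renewal f T" using renewal_below[OF f reg] by blast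
  moreover have "Min {T. renewal f T} \<le> T" using fin calculation(2) by (intro Min_le) auto
  ultimately show False by simp
qed

lemma renewal_iff_nth: "renewal f T \<longleftrightarrow> (\<exists>n. T = nth_renewal n f)"
proof
  assume "renewal f T"
  then obtain n where n: "n \<in> labels f" "T = ren_time n f" using renewal_label by blast
  obtain k where "enumerate (labels f) k = n" using enumerate_Ex[OF infinite_labels n(1)] by blast
  then show "\<exists>n. T = nth_renewal n f" using n by (auto simp: nth_renewal_def)
next
  assume "\<exists>n. T = nth_renewal n f"
  then obtain n where "T = ren_time (enumerate (labels f) n) f" by (auto simp: nth_renewal_def)
  moreover have "enumerate (labels f) n \<in> labels f" by (rule enumerate_in_set[OF infinite_labels])
  ultimately show "renewal f T" unfolding renewal_iff_active[OF f] labels_def by blast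
qed

lemma renewal_nth: "renewal f (nth_renewal n f)"
  using renewal_iff_nth by blast

lemma nth_renewal_inj:
  assumes "nth_renewal n f = nth_renewal n' f"
  shows "n = n'"
proof -
  let ?e = "enumerate (labels f)"
  have mem: "?e n \<in> labels f" "?e n' \<in> labels f" by (rule enumerate_in_set[OF infinite_labels])+
  have "?e n = ?e n'"
  proof (rule ccontr)
    assume "?e n \<noteq> ?e n'"
    then consider "?e n < ?e n'" | "?e n' < ?e n" by linarith
    then show False using mem assms by cases (auto simp: labels_def nth_renewal_def)
  qed
  then show ?thesis using strict_mono_enumerate[OF infinite_labels] by (metis strict_mono_eq)
qed

lemma probe_nonzero: "f (probe p f) \<noteq> m"
  using probe_sampled[OF f reg renewal_nth, of "fst p" "snd p"] by (simp add: probe_def sampled_def)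

text \<open>
  Within one renewal the sampled offsets lie in different excursions by construction; between two
  renewals, the later renewal is itself a zero that separates the probes.
\<close>

lemma probes_apart:
  assumes "p \<noteq> p'"
  shows "apart f (probe p f) (probe p' f)"
proof -
  obtain n j n' j' where p: "p = (n, j)" "p' = (n', j')" by (cases p, cases p') auto
  let ?T = "\<lambda>n. nth_renewal n f"
  let ?i = "\<lambda>n j. probe_index f (?T n) j"
  have s: "sampled f (?T n) (?i n j)" for n j by (rule probe_sampled[OF f reg renewal_nth])
  have later: "apart f (?T n + rat_time (?i n j)) (?T n' + rat_time (?i n' j'))" if lt: "?T n < ?T n'" for n j n' j'
  proof -
    have fr: "fresh f (?T n) (?T n + rat_time (?i n j))" using s[of n j] by (simp add: sampled_def)
    have "?T n + rat_time (?i n j) < ?T n'"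
      using fr[unfolded fresh_def, rule_format, of "?T n'"] lt renewal_nth[of n'] by force
    moreover have "0 < rat_time (?i n' j')" using s[of n' j'] by (simp add: sampled_def)
    moreover have "f (?T n') = m" using renewal_nth[of n'] by (simp add: renewal_def)
    ultimately show ?thesis unfolding apart_def by (intro hitsI[of _ "?T n'"]) auto
  qed
  show ?thesis
  proof (cases "n = n'")
    case True
    then have "?i n j \<noteq> ?i n j'" using assms p probe_index_inj[OF f reg renewal_nth, of n j j'] by auto
    then consider "?i n j < ?i n j'" | "?i n j' < ?i n j" by linarith
    then show ?thesis
    proof cases
      case 1
      then show ?thesis using s[of n j] s[of n j'] True by (simp add: probe_def p sampled_def)
    next
      case 2
      then show ?thesis using s[of n j] s[of n j'] True by (subst apart_commute) (simp add: probe_def p sampled_def)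
    qed
  next
    case False
    then have "?T n \<noteq> ?T n'" using nth_renewal_inj by blast
    then consider "?T n < ?T n'" | "?T n' < ?T n" by linarith
    then show ?thesis
    proof cases
      case 1 then show ?thesis using later[of n n' j j'] by (simp add: probe_def p)
    next
      case 2 then show ?thesis using later[of n' n j' j] by (subst apart_commute) (simp add: probe_def p)
    qed
  qed
qed

lemma bit_nth: "bit f (nth_renewal n f) j \<longleftrightarrow> m < f (probe (n, j) f)"
  using probe_sampled[OF f reg renewal_nth, of n j] by (simp add: bit_def probe_def)

end

end

section \<open>Poisson points from fair coins\<close>

lemma sets_coins: "sets (coins :: ('i \<Rightarrow> bool) measure) = sets (\<Pi>\<^sub>M i\<in>UNIV. count_space UNIV)"
  unfolding coins_def by (rule sets_PiM_cong) simp_all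

lemma space_coins [simp]: "space coins = UNIV"
  by (simp add: coins_def space_PiM)

lemma measurable_coin [measurable]: "Measurable.pred coins (\<lambda>\<epsilon>. \<epsilon> i)"
proof -
  have "(\<lambda>\<epsilon>. \<epsilon> i) \<in> (\<Pi>\<^sub>M i\<in>UNIV. count_space (UNIV :: bool set)) \<rightarrow>\<^sub>M count_space UNIV"
    by (rule measurable_component_singleton) simp
  then show ?thesis unfolding measurable_cong_sets[OF sets_coins refl] .
qed

lemma coins_indep: "prob_space.indep_vars coins (\<lambda>_. count_space UNIV) (\<lambda>i \<epsilon>. \<epsilon> i) (UNIV :: 'i set)"
proof -
  interpret C: prob_space "coins :: ('i \<Rightarrow> bool) measure" by (rule prob_space_coins)
  interpret product_prob_space "\<lambda>_::'i. measure_pmf (bernoulli_pmf (1/2))" UNIV by unfold_locales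
  have "C.indep_vars (\<lambda>_. measure_pmf (bernoulli_pmf (1/2))) (\<lambda>i \<epsilon>. \<epsilon> i) UNIV"
  proof (subst C.indep_vars_iff_distr_eq_PiM)
    show "(\<lambda>\<epsilon>. \<epsilon> i) \<in> coins \<rightarrow>\<^sub>M measure_pmf (bernoulli_pmf (1/2))" for i :: 'i
      unfolding coins_def by (rule measurable_component_singleton) simp
    have "distr coins (\<Pi>\<^sub>M i\<in>UNIV. measure_pmf (bernoulli_pmf (1/2))) (\<lambda>x. \<lambda>i\<in>UNIV. x i) = (coins :: ('i \<Rightarrow> bool) measure)"
      by (simp add: coins_def restrict_def distr_id2)
    also have "\<dots> = (\<Pi>\<^sub>M i\<in>UNIV. distr coins (measure_pmf (bernoulli_pmf (1/2))) (\<lambda>\<epsilon>. \<epsilon> i))"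
      unfolding coins_def by (intro PiM_cong refl) (simp add: PiM_component)
    finally show "distr coins (\<Pi>\<^sub>M i\<in>UNIV. measure_pmf (bernoulli_pmf (1/2))) (\<lambda>x. \<lambda>i\<in>UNIV. x i) =
      (\<Pi>\<^sub>M i\<in>(UNIV::'i set). distr coins (measure_pmf (bernoulli_pmf (1/2))) (\<lambda>\<epsilon>. \<epsilon> i))" .
  qed simp
  from C.indep_vars_compose2[OF this, of "\<lambda>_ x. x" "\<lambda>_. count_space UNIV"]
  show ?thesis by simp
qed

subsection \<open>Binary expansions are uniform\<close>

text \<open>
  The integer whose binary digits are the first \<open>n\<close> entries of \<open>c\<close>, most significant digit first.
\<close>

definition truncation :: "(nat \<Rightarrow> bool) \<Rightarrow> nat \<Rightarrow> nat" where
  "truncation c n = (\<Sum>j<n. if c j then 2 ^ (n - Suc j) else 0)"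

lemma truncation_0 [simp]: "truncation c 0 = 0"
  by (simp add: truncation_def)

lemma truncation_Suc: "truncation c (Suc n) = 2 * truncation c n + (if c n then 1 else 0)"
proof -
  have "(\<Sum>j<n. if c j then 2 ^ (Suc n - Suc j) else 0) = 2 * (\<Sum>j<n. if c j then 2 ^ (n - Suc j) else (0::nat))"
    unfolding sum_distrib_left
  proof (rule sum.cong)
    fix j assume "j \<in> {..<n}"
    then have "Suc n - Suc j = Suc (n - Suc j)" by auto
    then show "(if c j then 2 ^ (Suc n - Suc j) else 0) = 2 * (if c j then 2 ^ (n - Suc j) else (0::nat))" by simp
  qed simp
  then show ?thesis by (simp add: truncation_def)
qed

lemma truncation_bounds:
  "real (truncation c n) / 2 ^ n \<le> binary_value c" "binary_value c \<le> real (truncation c n) / 2 ^ n + (1/2) ^ n"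
proof -
  let ?a = "\<lambda>j. if c j then (1/2::real) ^ Suc j else 0"
  have part: "(\<Sum>j<n. ?a j) = real (truncation c n) / 2 ^ n"
  proof (induction n)
    case (Suc n)
    then show ?case by (simp add: truncation_Suc field_simps power_one_over)
  qed simp
  have split: "binary_value c = (\<Sum>j. ?a (j + n)) + (\<Sum>j<n. ?a j)"
    unfolding binary_value_def by (rule suminf_split_initial_segment[OF summable_binary])
  have summ: "summable (\<lambda>j. ?a (j + n))" using summable_binary by (rule summable_ignore_initial_segment)
  have "0 \<le> (\<Sum>j. ?a (j + n))" by (rule suminf_nonneg[OF summ]) simp
  then show "real (truncation c n) / 2 ^ n \<le> binary_value c" using split part by simp
  have geo: "(\<lambda>j. (1/2::real) ^ Suc (j + n)) sums ((1/2) ^ n)"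
  proof -
    have "(\<lambda>j. (1/2::real) ^ Suc n * (1/2) ^ j) sums ((1/2) ^ Suc n * (1 / (1 - 1/2)))"
      by (intro sums_mult geometric_sums) simp
    then show ?thesis by (simp add: power_add mult.commute mult.left_commute)
  qed
  have "(\<Sum>j. ?a (j + n)) \<le> (\<Sum>j. (1/2::real) ^ Suc (j + n))"
    by (rule suminf_le[OF _ summ]) (use geo in \<open>auto simp: sums_iff\<close>)
  then show "binary_value c \<le> real (truncation c n) / 2 ^ n + (1/2) ^ n"
    using split part geo by (simp add: sums_iff)
qed

lemma truncation_law:
  assumes idx: "inj \<iota>" and k: "k < 2 ^ n"
  shows "emeasure coins {\<epsilon>. truncation (\<lambda>j. \<epsilon> (\<iota> j)) n = k} = ennreal ((1/2) ^ n)"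
proof -
  have ex: "\<exists>b. \<forall>c. truncation c n = k \<longleftrightarrow> (\<forall>j<n. c j = b j)" if "k < 2 ^ n" for k n
    using that
  proof (induction n arbitrary: k)
    case 0
    then show ?case by auto
  next
    case (Suc n)
    have "k div 2 < 2 ^ n" using Suc.prems by auto
    from Suc.IH[OF this] obtain b where b': "\<forall>c. truncation c n = k div 2 \<longleftrightarrow> (\<forall>j<n. c j = b j)" by (rule exE)
    note b = b'[rule_format]
    define b' where "b' = b(n := odd k)"
    have "truncation c (Suc n) = k \<longleftrightarrow> (\<forall>j<Suc n. c j = b' j)" for c
    proof -
      have "truncation c (Suc n) = k \<longleftrightarrow> truncation c n = k div 2 \<and> (c n = odd k)"
      proof (cases "c n")
        case True
        have "2 * truncation c n + 1 = k \<longleftrightarrow> truncation c n = k div 2 \<and> odd k" by presburger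
        then show ?thesis using True by (simp add: truncation_Suc)
      next
        case False
        have "2 * truncation c n = k \<longleftrightarrow> truncation c n = k div 2 \<and> even k" by presburger
        then show ?thesis using False by (simp add: truncation_Suc)
      qed
      also have "\<dots> \<longleftrightarrow> (\<forall>j<Suc n. c j = b' j)" unfolding b by (auto simp: b'_def less_Suc_eq)
      finally show ?thesis .
    qed
    then show ?case by blast
  qed
  from ex[OF k] obtain b where b': "\<forall>c. truncation c n = k \<longleftrightarrow> (\<forall>j<n. c j = b j)" by (rule exE)
  note b = b'[rule_format]
  define g where "g = the_inv \<iota>"
  have g: "g (\<iota> j) = j" for j using idx by (simp add: g_def the_inv_f_f)
  have "{\<epsilon>. truncation (\<lambda>j. \<epsilon> (\<iota> j)) n = k} = {\<epsilon>. \<forall>i\<in>\<iota> ` {..<n}. \<epsilon> i \<in> {b (g i)}}"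
    unfolding b by (auto simp: g)
  also have "emeasure coins \<dots> = (\<Prod>i\<in>\<iota> ` {..<n}. ennreal (real (card {b (g i)}) / 2))"
    by (rule coins_cylinder) simp
  also have "\<dots> = ennreal (1/2) ^ n"
    using card_image[of \<iota> "{..<n}"] inj_on_subset[OF idx] by simp
  also have "\<dots> = ennreal ((1/2) ^ n)" by (rule ennreal_power) simp
  finally show ?thesis .
qed

lemma measurable_binary_coins [measurable]: "(\<lambda>\<epsilon>. binary_value (\<lambda>j. \<epsilon> (\<iota> j))) \<in> borel_measurable coins"
  by (rule borel_measurable_binary_value) measurable

lemma emeasure_uniform_01:
  assumes "B \<in> sets borel"
  shows "emeasure (density lborel (indicator {0..1::real})) B = emeasure lborel (B \<inter> {0..1})"
proof -
  have "emeasure (density lborel (indicator {0..1::real})) B = (\<integral>\<^sup>+y. indicator {0..1} y * indicator B y \<partial>lborel)"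
    using assms by (intro emeasure_density) auto
  also have "\<dots> = (\<integral>\<^sup>+y. indicator (B \<inter> {0..1}) y \<partial>lborel)"
    by (intro nn_integral_cong) (auto split: split_indicator)
  also have "\<dots> = emeasure lborel (B \<inter> {0..1})" using assms by (intro nn_integral_indicator) auto
  finally show ?thesis .
qed

text \<open>
  The truncated expansions are uniform on the multiples of \<open>2 ^ - n\<close> and are within \<open>2 ^ - n\<close> of the
  full value, which determines the distribution function.
\<close>

lemma binary_value_uniform:
  assumes idx: "inj \<iota>"
  shows "distr coins borel (\<lambda>\<epsilon>. binary_value (\<lambda>j. \<epsilon> (\<iota> j))) = density lborel (indicator {0..1})"
proof -
  interpret C: prob_space coins by (rule prob_space_coins)
  let ?U = "\<lambda>\<epsilon>. binary_value (\<lambda>j. \<epsilon> (\<iota> j))"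
  interpret D: prob_space "distr coins borel ?U" by (rule C.prob_space_distr) simp
  have finU: "emeasure (density lborel (indicator {0..1::real})) UNIV = 1"
    by (subst emeasure_uniform_01) simp_all
  have tr: "C.prob {\<epsilon>. truncation (\<lambda>j. \<epsilon> (\<iota> j)) n < k} = real k / 2 ^ n" if "k \<le> 2 ^ n" for n k
  proof -
    have s: "{\<epsilon>. truncation (\<lambda>j. \<epsilon> (\<iota> j)) n = i} \<in> sets coins" for i
    proof -
      have "(\<lambda>\<epsilon>. truncation (\<lambda>j. \<epsilon> (\<iota> j)) n) \<in> coins \<rightarrow>\<^sub>M count_space UNIV"
        unfolding truncation_def by measurable
      then have "Measurable.pred coins (\<lambda>\<epsilon>. truncation (\<lambda>j. \<epsilon> (\<iota> j)) n = i)" by measurable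
      then show ?thesis by (simp add: pred_def)
    qed
    have "{\<epsilon>. truncation (\<lambda>j. \<epsilon> (\<iota> j)) n < k} = (\<Union>i<k. {\<epsilon>. truncation (\<lambda>j. \<epsilon> (\<iota> j)) n = i})" by auto
    then have "C.prob {\<epsilon>. truncation (\<lambda>j. \<epsilon> (\<iota> j)) n < k} = (\<Sum>i<k. C.prob {\<epsilon>. truncation (\<lambda>j. \<epsilon> (\<iota> j)) n = i})"
      using s by (simp only:) (intro C.finite_measure_finite_Union, auto simp: disjoint_family_on_def)
    also have "\<dots> = (\<Sum>i<k. (1/2) ^ n)"
      using truncation_law[OF idx] that by (intro sum.cong refl) (auto simp: measure_def)
    finally show ?thesis by (simp add: power_one_over)
  qed
  have cdf: "C.prob {\<epsilon>. ?U \<epsilon> \<le> x} = x" if x: "0 \<le> x" "x < 1" for x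
  proof -
    have mU: "{\<epsilon>. ?U \<epsilon> \<le> x} \<in> sets coins"
      using measurable_binary_coins[of \<iota>] by (metis (no_types, lifting) borel_measurable_iff_le space_coins UNIV_I Collect_cong)
    have trm: "{\<epsilon>. truncation (\<lambda>j. \<epsilon> (\<iota> j)) n < k} \<in> sets coins" for n k
    proof -
      have "(\<lambda>\<epsilon>. truncation (\<lambda>j. \<epsilon> (\<iota> j)) n) \<in> coins \<rightarrow>\<^sub>M count_space UNIV"
        unfolding truncation_def by measurable
      then have "Measurable.pred coins (\<lambda>\<epsilon>. truncation (\<lambda>j. \<epsilon> (\<iota> j)) n < k)" by measurable
      then show ?thesis by (simp add: pred_def)
    qed
    have close: "\<bar>C.prob {\<epsilon>. ?U \<epsilon> \<le> x} - x\<bar> \<le> 2 * (1/2) ^ n" for n :: nat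
    proof -
      define k where "k = nat \<lfloor>x * 2 ^ n\<rfloor>"
      have "0 \<le> \<lfloor>x * 2 ^ n\<rfloor>" using x by simp
      then have "real k = of_int \<lfloor>x * 2 ^ n\<rfloor>" by (simp add: k_def)
      then have k: "real k \<le> x * 2 ^ n" "x * 2 ^ n < real k + 1" by linarith+
      have "x * 2 ^ n < 1 * 2 ^ n" using x by (intro mult_strict_right_mono) auto
      then have "real k < 2 ^ n" using k(1) by linarith
      then have "real k < real (2 ^ n)" by simp
      then have k2: "Suc k \<le> 2 ^ n" unfolding of_nat_less_iff by (rule Suc_leI)
      have up: "C.prob {\<epsilon>. ?U \<epsilon> \<le> x} \<le> real (Suc k) / 2 ^ n"
      proof -
        have "C.prob {\<epsilon>. ?U \<epsilon> \<le> x} \<le> C.prob {\<epsilon>. truncation (\<lambda>j. \<epsilon> (\<iota> j)) n < Suc k}"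
        proof (rule C.finite_measure_mono[OF _ trm], rule subsetI)
          fix \<epsilon> assume "\<epsilon> \<in> {\<epsilon>. ?U \<epsilon> \<le> x}"
          then have "real (truncation (\<lambda>j. \<epsilon> (\<iota> j)) n) / 2 ^ n \<le> x"
            using truncation_bounds(1)[of "\<lambda>j. \<epsilon> (\<iota> j)" n] by simp
          then have "real (truncation (\<lambda>j. \<epsilon> (\<iota> j)) n) < real k + 1" using k(2) by (simp add: divide_le_eq)
          then show "\<epsilon> \<in> {\<epsilon>. truncation (\<lambda>j. \<epsilon> (\<iota> j)) n < Suc k}" by simp
        qed
        then show ?thesis using tr[OF k2] by simp
      qed
      have low: "real (k - 1) / 2 ^ n \<le> C.prob {\<epsilon>. ?U \<epsilon> \<le> x}"
      proof -
        have "C.prob {\<epsilon>. truncation (\<lambda>j. \<epsilon> (\<iota> j)) n < k} \<le> C.prob {\<epsilon>. ?U \<epsilon> \<le> x}"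
        proof (rule C.finite_measure_mono[OF _ mU], rule subsetI)
          fix \<epsilon> assume "\<epsilon> \<in> {\<epsilon>. truncation (\<lambda>j. \<epsilon> (\<iota> j)) n < k}"
          then have "real (truncation (\<lambda>j. \<epsilon> (\<iota> j)) n) + 1 \<le> x * 2 ^ n" using k(1) by simp
          then have "real (truncation (\<lambda>j. \<epsilon> (\<iota> j)) n) / 2 ^ n + (1/2) ^ n \<le> x"
            by (simp add: field_simps power_one_over)
          then show "\<epsilon> \<in> {\<epsilon>. ?U \<epsilon> \<le> x}" using truncation_bounds(2)[of "\<lambda>j. \<epsilon> (\<iota> j)" n] by simp
        qed
        moreover have "real (k - 1) / 2 ^ n \<le> real k / 2 ^ n" by (intro divide_right_mono) auto
        ultimately show ?thesis using tr[of k n] k2 by simp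
      qed
      have "x \<le> (real k + 1) / 2 ^ n" "real k / 2 ^ n \<le> x" using k by (simp_all add: field_simps)
      moreover have "real (k - 1) \<ge> real k - 1" by simp
      then have "(real k - 1) / 2 ^ n \<le> real (k - 1) / 2 ^ n" by (intro divide_right_mono) auto
      ultimately have "x - 2 * (1 / 2 ^ n) \<le> C.prob {\<epsilon>. ?U \<epsilon> \<le> x}" "C.prob {\<epsilon>. ?U \<epsilon> \<le> x} \<le> x + 1 / 2 ^ n"
        using up low by (simp_all add: add_divide_distrib diff_divide_distrib)
      moreover have "0 \<le> 1 / (2::real) ^ n" by simp
      ultimately have "\<bar>C.prob {\<epsilon>. ?U \<epsilon> \<le> x} - x\<bar> \<le> 2 * (1 / 2 ^ n)" by linarith
      then show ?thesis by (simp add: power_one_over)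
    qed
    have "(\<lambda>n. 2 * (1/2::real) ^ n) \<longlonglongrightarrow> 2 * 0" by (intro tendsto_intros LIMSEQ_power_zero) simp
    from LIMSEQ_le_const[OF this, of "\<bar>C.prob {\<epsilon>. ?U \<epsilon> \<le> x} - x\<bar>"] close
    have "\<bar>C.prob {\<epsilon>. ?U \<epsilon> \<le> x} - x\<bar> \<le> 2 * 0" by blast
    then show ?thesis by simp
  qed
  have dcdf: "measure (distr coins borel ?U) {..x} = C.prob {\<epsilon>. ?U \<epsilon> \<le> x}" for x
    by (subst measure_distr) (auto simp: vimage_def)
  have lcdf: "measure (density lborel (indicator {0..1::real})) {..x} = (if x < 0 then 0 else if x < 1 then x else 1)" for x
  proof -
    have "emeasure (density lborel (indicator {0..1::real})) {..x} = emeasure lborel ({..x} \<inter> {0..1})"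
      by (rule emeasure_uniform_01) simp
    also have "{..x} \<inter> {0..1} = {0..min 1 x}" by auto
    also have "emeasure lborel {0..min 1 x} = ennreal (if x < 0 then 0 else if x < 1 then x else 1)"
      by (auto simp: min_def emeasure_lborel_Icc_eq)
    finally show ?thesis by (simp add: measure_def)
  qed
  have U01: "0 \<le> ?U \<epsilon>" "?U \<epsilon> \<le> 1" for \<epsilon>
    using binary_value_nonneg truncation_bounds(2)[of "\<lambda>j. \<epsilon> (\<iota> j)" 0] by auto
  show ?thesis
  proof (rule cdf_unique)
    show "real_distribution (distr coins borel ?U)"
      by (rule C.real_distribution_distr) simp
    show "real_distribution (density lborel (indicator {0..1::real}))"
      unfolding real_distribution_def real_distribution_axioms_def
      using finU by (auto intro!: prob_spaceI)
    show "cdf (distr coins borel ?U) = cdf (density lborel (indicator {0..1}))"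
    proof
      fix x :: real
      consider "x < 0" | "0 \<le> x" "x < 1" | "1 \<le> x" by linarith
      then show "cdf (distr coins borel ?U) x = cdf (density lborel (indicator {0..1})) x"
      proof cases
        case 1
        then have "{\<epsilon>. ?U \<epsilon> \<le> x} = {}" using U01(1) by (auto simp: not_le) (meson less_le_trans not_le)
        then show ?thesis using 1 by (simp add: cdf_def dcdf lcdf)
      next
        case 2
        then show ?thesis using cdf[of x] by (simp add: cdf_def dcdf lcdf)
      next
        case 3
        then have "{\<epsilon>. ?U \<epsilon> \<le> x} = UNIV" using U01(2) order_trans by blast
        then show ?thesis using 3 C.prob_space by (simp add: cdf_def dcdf lcdf)
      qed
    qed
  qed
qed


subsection \<open>The void probability of the cells\<close>

lemma binary_value_le_1: "binary_value c \<le> 1"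
  using truncation_bounds(2)[of c 0] by simp

lemma bit_index_eq_iff: "bit_index k i j = bit_index k' i' j' \<longleftrightarrow> k = k' \<and> i = i' \<and> j = j'"
  by (simp add: bit_index_def)

lemma measurable_uniforms_coins [measurable]: "(\<lambda>\<epsilon>. uniforms (\<lambda>j. \<epsilon> (n, j)) k i) \<in> borel_measurable coins"
  unfolding uniforms_def by (rule borel_measurable_binary_value) measurable

lemma uniforms_prob:
  fixes n :: nat
  assumes "B \<in> sets borel"
  shows "measure coins {\<epsilon>. uniforms (\<lambda>j. \<epsilon> (n, j)) k i \<in> B} = measure lborel (B \<inter> {0..1})"
proof -
  let ?U = "\<lambda>\<epsilon>. binary_value (\<lambda>j. \<epsilon> ((\<lambda>j. (n, bit_index k i j)) j))"
  have inj: "inj (\<lambda>j. (n, bit_index k i j))" by (auto simp: inj_on_def bit_index_eq_iff)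
  have "measure coins {\<epsilon>. ?U \<epsilon> \<in> B} = measure (distr coins borel ?U) B"
    using assms measurable_binary_coins[of "\<lambda>j. (n, bit_index k i j)"] by (subst measure_distr) (auto simp: vimage_def)
  also have "\<dots> = measure (density lborel (indicator {0..1})) B"
    unfolding binary_value_uniform[OF inj] ..
  also have "\<dots> = measure lborel (B \<inter> {0..1})"
    using emeasure_uniform_01[OF assms] by (simp add: measure_def)
  finally show ?thesis by (simp add: uniforms_def)
qed

lemma uniforms_indep:
  fixes n :: nat
  shows "prob_space.indep_vars coins (\<lambda>_. borel) (\<lambda>i \<epsilon>. uniforms (\<lambda>j. \<epsilon> (n, j)) k i) (UNIV :: nat set)"
proof -
  interpret C: prob_space "coins :: (nat \<times> nat \<Rightarrow> bool) measure" by (rule prob_space_coins)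
  let ?K = "\<lambda>i. range (\<lambda>j. (n, bit_index k i j))"
  have "C.indep_vars (\<lambda>i. PiM (?K i) (\<lambda>_. count_space UNIV)) (\<lambda>i \<epsilon>. restrict (\<lambda>p. \<epsilon> p) (?K i)) (UNIV :: nat set)"
    by (rule C.indep_vars_restrict[OF coins_indep]) (auto simp: disjoint_family_on_def bit_index_eq_iff)
  then have "C.indep_vars (\<lambda>_. borel) (\<lambda>i \<epsilon>. (\<lambda>i z. uniforms (\<lambda>j. z (n, j)) k i) i (restrict (\<lambda>p. \<epsilon> p) (?K i))) (UNIV :: nat set)"
  proof (rule C.indep_vars_compose2)
    fix i :: nat
    show "(\<lambda>z. uniforms (\<lambda>j. z (n, j)) k i) \<in> PiM (?K i) (\<lambda>_. count_space UNIV) \<rightarrow>\<^sub>M borel"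
      unfolding uniforms_def by (rule borel_measurable_binary_value) (rule measurable_component_singleton, simp)
  qed
  then show ?thesis by (simp add: uniforms_def)
qed

lemma poisson_weights_sums:
  fixes l v :: real
  shows "(\<lambda>j. (l * v) ^ j / fact j * exp (- l)) sums exp (- (l * (1 - v)))"
proof -
  have "(\<lambda>j. (l * v) ^ j /\<^sub>R fact j * exp (- l)) sums (exp (l * v) * exp (- l))"
    by (intro sums_mult2 exp_converges)
  moreover have "exp (l * v) * exp (- l) = exp (- (l * (1 - v)))"
    by (simp only: exp_add[symmetric]) (simp add: algebra_simps)
  moreover have "(l * v) ^ j /\<^sub>R fact j = (l * v) ^ j / fact j" for j by (simp add: divide_inverse mult.commute)
  ultimately show ?thesis by simp
qed

text \<open>
  Given that there are \<open>N\<close> points, all of them avoid \<open>A\<close> with probability \<open>v ^ N\<close>, where \<open>v\<close> is the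
  measure of the rest of the unit interval. Summing over the Poisson weights gives the
  generating function \<open>exp (- l * (1 - v))\<close>.
\<close>

lemma cell_void_probability:
  fixes n :: nat
  assumes l: "0 < l" and A: "A \<in> sets borel"
  shows "measure coins {\<epsilon>. cell_points l (uniforms (\<lambda>j. \<epsilon> (n, j)) k) \<inter> A = {}} = exp (- (l * measure lborel (A \<inter> {0..<1})))"
proof -
  interpret C: prob_space "coins :: (nat \<times> nat \<Rightarrow> bool) measure" by (rule prob_space_coins)
  let ?U = "\<lambda>i \<epsilon>. uniforms (\<lambda>j. \<epsilon> (n, j)) k i"
  let ?p = "\<lambda>N. l ^ N / fact N * exp (- l)"
  define F where "F N = (\<Sum>j<N. ?p j)" for N
  define A' where "A' = A \<inter> {0..<1}"
  define v where "v = 1 - measure lborel A'"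
  have A': "A' \<in> sets borel" using A by (simp add: A'_def)
  have p0: "0 \<le> ?p j" for j using l by simp
  have F_sums: "?p sums 1" using poisson_weights_sums[of l 1] by simp
  have F01: "0 \<le> F N" "F N \<le> 1" for N
  proof -
    show "0 \<le> F N" unfolding F_def using p0 by (intro sum_nonneg) auto
    have "F N \<le> suminf ?p" unfolding F_def using F_sums p0 by (intro sum_le_suminf) (auto simp: sums_iff)
    then show "F N \<le> 1" using F_sums by (simp add: sums_iff)
  qed
  have F_Suc: "F (Suc N) = F N + ?p N" for N by (simp add: F_def)
  have cdf: "poisson_cdf l i = F (Suc i)" for i by (simp add: poisson_cdf_def F_def lessThan_Suc_atMost)
  have F_mono: "F i \<le> F j" if "i \<le> j" for i j unfolding F_def using p0 that by (intro sum_mono2) auto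
  have F_lim: "F \<longlonglongrightarrow> 1" using F_sums by (simp add: sums_def F_def[abs_def])
  have U01: "0 \<le> ?U i \<epsilon>" "?U i \<epsilon> \<le> 1" for i \<epsilon>
    by (simp_all add: uniforms_def binary_value_nonneg binary_value_le_1)
  \<comment> \<open>The event that there are exactly \<open>N\<close> points and none of them is in \<open>A\<close>.\<close>
  define E where "E N = {\<epsilon>. ?U 0 \<epsilon> \<in> {F N..<F (Suc N)} \<and> (\<forall>i<N. ?U (Suc i) \<epsilon> \<in> - A')}" for N
  have void_iff: "cell_points l (uniforms (\<lambda>j. \<epsilon> (n, j)) k) \<inter> A = {} \<longleftrightarrow> (\<forall>i. F (Suc i) \<le> ?U 0 \<epsilon> \<longrightarrow> ?U (Suc i) \<epsilon> \<notin> A')" for \<epsilon>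
    unfolding cell_points_def cdf A'_def using U01 by (auto simp: uniforms_def)
  have E_iff: "\<epsilon> \<in> E N \<longleftrightarrow> F N \<le> ?U 0 \<epsilon> \<and> ?U 0 \<epsilon> < F (Suc N) \<and> (\<forall>i. F (Suc i) \<le> ?U 0 \<epsilon> \<longrightarrow> ?U (Suc i) \<epsilon> \<notin> A')" for N \<epsilon>
  proof -
    have "F (Suc i) \<le> ?U 0 \<epsilon> \<longleftrightarrow> i < N" if u: "F N \<le> ?U 0 \<epsilon>" "?U 0 \<epsilon> < F (Suc N)" for i
      using F_mono[of "Suc i" N] F_mono[of "Suc N" "Suc i"] u by (cases "i < N") auto
    then show ?thesis unfolding E_def by auto
  qed
  have Em: "E N \<in> sets coins" for N
  proof -
    have "Measurable.pred coins (\<lambda>\<epsilon>. ?U 0 \<epsilon> \<in> {F N..<F (Suc N)} \<and> (\<forall>i<N. ?U (Suc i) \<epsilon> \<in> - A'))"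
      using A' by measurable
    then show ?thesis by (simp add: pred_def E_def)
  qed
  have disj: "disjoint_family E"
    unfolding disjoint_family_on_def
  proof (intro ballI impI)
    fix N N' :: nat assume "N \<noteq> N'"
    then consider "Suc N \<le> N'" | "Suc N' \<le> N" by linarith
    then show "E N \<inter> E N' = {}" using F_mono by cases (force simp: E_def)+
  qed
  have v01: "measure lborel ((- A') \<inter> {0..1}) = v"
  proof -
    have "measure lborel ({0..1} - A') = measure lborel {0..1::real} - measure lborel A'"
      using A' by (intro measure_Diff) (auto simp: A'_def)
    moreover have "(- A') \<inter> {0..1} = {0..1} - A'" by auto
    ultimately show ?thesis by (simp add: v_def)
  qed
  have PE: "C.prob (E N) = ?p N * v ^ N" for N
  proof -
    define B where "B i = (case i of 0 \<Rightarrow> {F N..<F (Suc N)} | Suc _ \<Rightarrow> - A')" for i :: nat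
    have B: "B i \<in> sets borel" for i using A' by (cases i) (auto simp: B_def)
    have "E N = (\<Inter>i\<in>{..N}. ?U i -` B i \<inter> space coins)"
    proof (intro set_eqI iffI)
      fix \<epsilon> assume e: "\<epsilon> \<in> E N"
      have "?U i \<epsilon> \<in> B i" if "i \<le> N" for i
        using e that by (cases i) (auto simp: E_def B_def)
      then show "\<epsilon> \<in> (\<Inter>i\<in>{..N}. ?U i -` B i \<inter> space coins)" by simp
    next
      fix \<epsilon> assume "\<epsilon> \<in> (\<Inter>i\<in>{..N}. ?U i -` B i \<inter> space coins)"
      then have e: "?U i \<epsilon> \<in> B i" if "i \<le> N" for i using that by simp
      show "\<epsilon> \<in> E N" using e[of 0] e[of "Suc _"] by (simp add: E_def B_def)
    qed
    also have "C.prob \<dots> = (\<Prod>i\<in>{..N}. C.prob (?U i -` B i \<inter> space coins))"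
      using B by (intro C.indep_varsD[OF uniforms_indep]) auto
    also have "\<dots> = (\<Prod>i\<in>{..N}. measure lborel (B i \<inter> {0..1}))"
      using uniforms_prob[OF B] by (simp add: vimage_def)
    also have "\<dots> = measure lborel (B 0 \<inter> {0..1}) * (\<Prod>i<N. measure lborel (B (Suc i) \<inter> {0..1}))"
      by (rule prod.atMost_shift)
    also have "(\<Prod>i<N. measure lborel (B (Suc i) \<inter> {0..1})) = v ^ N" using v01 by (simp add: B_def)
    also have "B 0 \<inter> {0..1} = {F N..<F (Suc N)}" using F01[of N] F01[of "Suc N"] by (auto simp: B_def)
    also have "measure lborel {F N..<F (Suc N)} = ?p N" using F_mono[of N "Suc N"] by (simp add: F_Suc)
    finally show ?thesis .
  qed
  have sums_E: "(\<lambda>N. C.prob (E N)) sums C.prob (\<Union>N. E N)"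
    using Em disj by (intro C.finite_measure_UNION) auto
  have "(\<lambda>N. ?p N * v ^ N) sums exp (- (l * (1 - v)))"
    using poisson_weights_sums[of l v] by (simp add: power_mult_distrib mult_ac)
  then have PU: "C.prob (\<Union>N. E N) = exp (- (l * (1 - v)))"
    using sums_E sums_unique2 unfolding PE by blast
  \<comment> \<open>The weights only exhaust the values below 1 of the variable that selects \<open>N\<close>.\<close>
  have "C.prob {\<epsilon>. ?U 0 \<epsilon> \<in> {1}} = measure lborel ({1} \<inter> {0..1::real})"
    by (rule uniforms_prob) simp
  then have null: "C.prob {\<epsilon>. ?U 0 \<epsilon> = 1} = 0" by simp
  have m1: "{\<epsilon>. ?U 0 \<epsilon> = 1} \<in> sets coins"
  proof -
    have "Measurable.pred coins (\<lambda>\<epsilon>. ?U 0 \<epsilon> = 1)" by measurable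
    then show ?thesis by (simp add: pred_def)
  qed
  let ?V = "{\<epsilon>. \<forall>i. F (Suc i) \<le> ?U 0 \<epsilon> \<longrightarrow> ?U (Suc i) \<epsilon> \<notin> A'}"
  have Vm: "?V \<in> sets coins"
  proof -
    have "Measurable.pred coins (\<lambda>\<epsilon>. \<forall>i. F (Suc i) \<le> ?U 0 \<epsilon> \<longrightarrow> ?U (Suc i) \<epsilon> \<notin> A')"
      using A' by measurable
    then show ?thesis by (simp add: pred_def)
  qed
  have sub1: "(\<Union>N. E N) \<subseteq> ?V" by (auto simp: E_iff)
  have sub2: "?V \<subseteq> (\<Union>N. E N) \<union> {\<epsilon>. ?U 0 \<epsilon> = 1}"
  proof
    fix \<epsilon> assume \<epsilon>: "\<epsilon> \<in> ?V"
    show "\<epsilon> \<in> (\<Union>N. E N) \<union> {\<epsilon>. ?U 0 \<epsilon> = 1}"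
    proof (cases "?U 0 \<epsilon> = 1")
      case False
      then have "?U 0 \<epsilon> < 1" using U01(2)[of \<epsilon> 0] by simp
      then have "eventually (\<lambda>N. ?U 0 \<epsilon> < F N) sequentially" by (rule order_tendstoD(1)[OF F_lim])
      then have ex: "\<exists>N. ?U 0 \<epsilon> < F N" by (auto simp: eventually_sequentially)
      define N where "N = (LEAST N. ?U 0 \<epsilon> < F N)"
      have N: "?U 0 \<epsilon> < F N" unfolding N_def using ex by (rule LeastI_ex)
      have "F 0 = 0" by (simp add: F_def)
      then have "N \<noteq> 0" using N U01(1)[of \<epsilon> 0] by (intro notI) simp
      then obtain N' where N': "N = Suc N'" using not0_implies_Suc by blast
      then have "F N' \<le> ?U 0 \<epsilon>" using not_less_Least[of N' "\<lambda>N. ?U 0 \<epsilon> < F N"] unfolding N_def[symmetric] by simp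
      then have "\<epsilon> \<in> E N'" using \<epsilon> N N' by (simp add: E_iff)
      then show ?thesis by blast
    qed simp
  qed
  have Um: "(\<Union>N. E N) \<in> sets coins" using Em by blast
  have "C.prob ?V \<le> C.prob ((\<Union>N. E N) \<union> {\<epsilon>. ?U 0 \<epsilon> = 1})"
    using sub2 Um m1 by (intro C.finite_measure_mono) auto
  also have "\<dots> \<le> C.prob (\<Union>N. E N) + C.prob {\<epsilon>. ?U 0 \<epsilon> = 1}"
    by (rule measure_Un_le[OF Um m1])
  finally have "C.prob ?V = C.prob (\<Union>N. E N)"
    using C.finite_measure_mono[OF sub1 Vm] null by simp
  then show ?thesis using PU by (simp add: void_iff v_def A'_def)
qed

lemma measurable_cell_void:
  assumes A: "A \<in> sets borel" and c: "\<And>j. Measurable.pred N (\<lambda>x. c x (bit_index k (fst (prod_decode j)) (snd (prod_decode j))))"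
  shows "Measurable.pred N (\<lambda>x. cell_points l (uniforms (c x) k) \<inter> A = {})"
proof -
  have [measurable]: "(\<lambda>x. uniforms (c x) k i) \<in> borel_measurable N" for i
    unfolding uniforms_def
  proof (rule borel_measurable_binary_value)
    fix j show "Measurable.pred N (\<lambda>x. c x (bit_index k i j))" using c[of "prod_encode (i, j)"] by simp
  qed
  have "Measurable.pred N (\<lambda>x. \<forall>i. poisson_cdf l i \<le> uniforms (c x) k 0 \<longrightarrow> uniforms (c x) k (Suc i) < 1 \<longrightarrow> uniforms (c x) k (Suc i) \<notin> A)"
    using A by measurable
  then show ?thesis by (rule measurable_cong[THEN iffD1, rotated]) (auto simp: cell_points_def)
qed

text \<open>
  Different cells read disjoint sets of coins, so the void probabilities multiply.
\<close>

theorem all_cells_void_probability: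
  assumes l: "0 < l" and A: "\<And>p. A p \<in> sets borel"
    and s: "(\<lambda>q. measure lborel (A (prod_decode q) \<inter> {0..<1})) sums s"
  shows "emeasure coins {\<epsilon>. \<forall>n k. cell_points l (uniforms (\<lambda>j. \<epsilon> (n, j)) k) \<inter> A (n, k) = {}} = ennreal (exp (- (l * s)))"
proof -
  interpret C: prob_space "coins :: (nat \<times> nat \<Rightarrow> bool) measure" by (rule prob_space_coins)
  let ?n = "\<lambda>q. fst (prod_decode q)" and ?k = "\<lambda>q. snd (prod_decode q)"
  let ?K = "\<lambda>q. range (\<lambda>p. (?n q, bit_index (?k q) (fst p) (snd p)))"
  define X where "X q \<epsilon> \<longleftrightarrow> cell_points l (uniforms (\<lambda>j. \<epsilon> (?n q, j)) (?k q)) \<inter> A (prod_decode q) = {}" for q and \<epsilon> :: "nat \<times> nat \<Rightarrow> bool"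
  have disj: "disjoint_family ?K"
    unfolding disjoint_family_on_def
  proof (intro ballI impI)
    fix q q' :: nat assume "q \<noteq> q'"
    then have "prod_decode q \<noteq> prod_decode q'" by (simp add: prod_decode_eq)
    then show "?K q \<inter> ?K q' = {}" by (auto simp: bit_index_eq_iff prod_eq_iff)
  qed
  have "C.indep_vars (\<lambda>q. PiM (?K q) (\<lambda>_. count_space UNIV)) (\<lambda>q \<epsilon>. restrict (\<lambda>p. \<epsilon> p) (?K q)) (UNIV :: nat set)"
    by (rule C.indep_vars_restrict[OF coins_indep]) (use disj in auto)
  then have "C.indep_vars (\<lambda>_. count_space UNIV) (\<lambda>q \<epsilon>. X q (restrict (\<lambda>p. \<epsilon> p) (?K q))) (UNIV :: nat set)"
  proof (rule C.indep_vars_compose2)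
    fix q :: nat
    show "X q \<in> PiM (?K q) (\<lambda>_. count_space UNIV) \<rightarrow>\<^sub>M count_space UNIV"
      unfolding X_def
    proof (rule measurable_cell_void[OF A])
      fix j show "Measurable.pred (PiM (?K q) (\<lambda>_. count_space UNIV)) (\<lambda>x. x (?n q, bit_index (?k q) (fst (prod_decode j)) (snd (prod_decode j))))"
        by (rule measurable_component_singleton) (auto intro!: image_eqI[of _ _ "prod_decode j"])
    qed
  qed
  moreover have "X q (restrict (\<lambda>p. \<epsilon> p) (?K q)) = X q \<epsilon>" for q \<epsilon>
  proof -
    have "(?n q, bit_index (?k q) i j) \<in> ?K q" for i j by (rule image_eqI[of _ _ "(i, j)"]) auto
    then have "restrict (\<lambda>p. \<epsilon> p) (?K q) (?n q, bit_index (?k q) i j) = \<epsilon> (?n q, bit_index (?k q) i j)" for i j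
      by (simp only: restrict_apply if_True)
    then have "uniforms (\<lambda>j. restrict (\<lambda>p. \<epsilon> p) (?K q) (?n q, j)) (?k q) = uniforms (\<lambda>j. \<epsilon> (?n q, j)) (?k q)"
      by (intro ext) (simp only: uniforms_def)
    then show ?thesis by (simp only: X_def)
  qed
  ultimately have ind: "C.indep_vars (\<lambda>_. count_space UNIV) X (UNIV :: nat set)" by simp
  have PX: "C.prob {\<epsilon>. X q \<epsilon>} = exp (- (l * measure lborel (A (prod_decode q) \<inter> {0..<1})))" for q
    unfolding X_def by (rule cell_void_probability[OF l A])
  have Xm: "{\<epsilon>. X q \<epsilon>} \<in> sets coins" for q
    using C.indep_vars_def[of "\<lambda>_. count_space UNIV" X UNIV] ind measurable_sets[of "X q" coins "count_space UNIV" "{True}"]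
    by (auto simp: vimage_def)
  let ?E = "\<lambda>N. {\<epsilon>. \<forall>q<N. X q \<epsilon>}"
  have E: "?E N \<in> sets coins" for N
  proof -
    have "Measurable.pred coins (\<lambda>\<epsilon>. X q \<epsilon>)" for q using Xm[of q] by (simp add: pred_def)
    then have "Measurable.pred coins (\<lambda>\<epsilon>. \<forall>q\<in>{..<N}. X q \<epsilon>)" by (rule pred_intros_countable_bounded(3))
    then show ?thesis by (simp add: pred_def Ball_def)
  qed
  have PE: "C.prob (?E N) = exp (- (l * (\<Sum>q<N. measure lborel (A (prod_decode q) \<inter> {0..<1}))))" for N
  proof (cases "N = 0")
    case True
    then show ?thesis using C.prob_space by simp
  next
    case False
    have "?E N = (\<Inter>q\<in>{..<N}. X q -` {True} \<inter> space coins)" using False by auto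
    also have "C.prob \<dots> = (\<Prod>q\<in>{..<N}. C.prob (X q -` {True} \<inter> space coins))"
      using False by (intro C.indep_varsD[OF ind]) auto
    also have "\<dots> = (\<Prod>q<N. exp (- (l * measure lborel (A (prod_decode q) \<inter> {0..<1}))))"
      using PX by (intro prod.cong refl) (simp add: vimage_def)
    finally show ?thesis by (simp add: exp_sum[symmetric] sum_negf sum_distrib_left)
  qed
  have "(\<lambda>N. C.prob (?E N)) \<longlonglongrightarrow> C.prob (\<Inter>N. ?E N)"
    using E by (intro C.finite_Lim_measure_decseq) (auto simp: decseq_def)
  moreover have "(\<lambda>N. C.prob (?E N)) \<longlonglongrightarrow> exp (- (l * s))"
    unfolding PE using s by (intro tendsto_intros) (simp add: sums_def)
  ultimately have "C.prob (\<Inter>N. ?E N) = exp (- (l * s))" by (rule LIMSEQ_unique)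
  moreover have "(\<Inter>N. ?E N) = {\<epsilon>. \<forall>n k. cell_points l (uniforms (\<lambda>j. \<epsilon> (n, j)) k) \<inter> A (n, k) = {}}"
  proof (intro set_eqI iffI)
    fix \<epsilon> assume e: "\<epsilon> \<in> (\<Inter>N. ?E N)"
    then have "X q \<epsilon>" for q by (auto dest: INT_D[of _ _ _ "Suc q"])
    from this[of "prod_encode (_, _)"] show "\<epsilon> \<in> {\<epsilon>. \<forall>n k. cell_points l (uniforms (\<lambda>j. \<epsilon> (n, j)) k) \<inter> A (n, k) = {}}"
      by (simp add: X_def)
  next
    fix \<epsilon> assume "\<epsilon> \<in> {\<epsilon>. \<forall>n k. cell_points l (uniforms (\<lambda>j. \<epsilon> (n, j)) k) \<inter> A (n, k) = {}}"
    then have "X q \<epsilon>" for q by (cases "prod_decode q") (simp add: X_def)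
    then show "\<epsilon> \<in> (\<Inter>N. ?E N)" by simp
  qed
  ultimately show ?thesis by (simp add: C.emeasure_eq_measure)
qed

section \<open>The factor map\<close>

context stationary_reflected_bm
begin

text \<open>
  The void event for \<open>A\<close> with the signs of the path replaced by arbitrary bits. In its first argument
  it depends on the renewals only, hence it is invariant under flips.
\<close>

definition void_given_bits :: "real \<Rightarrow> real set \<Rightarrow> (real \<Rightarrow> real) \<Rightarrow> (nat \<times> nat \<Rightarrow> bool) \<Rightarrow> bool" where
  "void_given_bits l A f \<epsilon> \<longleftrightarrow> (\<forall>n k i. poisson_cdf l i \<le> uniforms (\<lambda>j. \<epsilon> (n, j)) k 0 \<longrightarrow>
     uniforms (\<lambda>j. \<epsilon> (n, j)) k (Suc i) < 1 \<longrightarrow>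
     (\<forall>n'. \<not> (nth_renewal n f < nth_renewal n' f \<and> nth_renewal n' f \<le> nth_renewal n f + real k + uniforms (\<lambda>j. \<epsilon> (n, j)) k (Suc i))) \<longrightarrow>
     nth_renewal n f + real k + uniforms (\<lambda>j. \<epsilon> (n, j)) k (Suc i) \<notin> A)"

text \<open>
  The set \<open>A\<close> as seen from the cell with index \<open>p\<close>, in coordinates that start at the left end of the
  cell, up to the next renewal.
\<close>

definition cell_target :: "real set \<Rightarrow> (real \<Rightarrow> real) \<Rightarrow> nat \<times> nat \<Rightarrow> real set" where
  "cell_target A f p = {x. nth_renewal (fst p) f + real (snd p) + x \<in> A \<and>
     (\<forall>n'. \<not> (nth_renewal (fst p) f < nth_renewal n' f \<and> nth_renewal n' f \<le> nth_renewal (fst p) f + real (snd p) + x))}"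

lemma void_given_bits_iff_cells:
  "void_given_bits l A f \<epsilon> \<longleftrightarrow> (\<forall>n k. cell_points l (uniforms (\<lambda>j. \<epsilon> (n, j)) k) \<inter> cell_target A f (n, k) = {})"
  unfolding void_given_bits_def cell_points_def cell_target_def by (auto; blast)

lemma fresh_nth:
  assumes "continuous_on UNIV f" "regular f"
  shows "fresh f T x \<longleftrightarrow> (\<forall>n'. \<not> (T < nth_renewal n' f \<and> nth_renewal n' f \<le> x))"
  unfolding fresh_def renewal_iff_nth[OF assms] by blast

lemma points_void_iff:
  assumes "continuous_on UNIV f" "regular f"
  shows "points l f \<inter> A = {} \<longleftrightarrow> void_given_bits l A f (sign_at probe f)"
proof -
  have b: "bit f (nth_renewal n f) = (\<lambda>j. sign_at probe f (n, j))" for n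
    using bit_nth[OF assms] by (auto simp: fun_eq_iff sign_at_def)
  have pts: "points l f = {nth_renewal n f + real k + u | n k u. u \<in> cell_points l (uniforms (\<lambda>j. sign_at probe f (n, j)) k) \<and>
      fresh f (nth_renewal n f) (nth_renewal n f + real k + u)}"
    unfolding points_def renewal_iff_nth[OF assms] b[symmetric] by blast
  show ?thesis
    unfolding pts void_given_bits_iff_cells cell_target_def fresh_nth[OF assms] fst_conv snd_conv by blast
qed

lemma borel_no_renewal_before:
  fixes \<tau> :: "nat \<Rightarrow> real"
  shows "{x. \<forall>n'. \<not> (T < \<tau> n' \<and> \<tau> n' \<le> c + x)} \<in> sets borel"
proof -
  have "Measurable.pred borel (\<lambda>x. \<forall>n'. \<not> (T < \<tau> n' \<and> \<tau> n' \<le> c + x))" by measurable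
  then show ?thesis by (simp add: pred_def)
qed

lemma borel_cell_target:
  assumes "A \<in> sets borel"
  shows "cell_target A f p \<in> sets borel"
proof -
  let ?c = "nth_renewal (fst p) f + real (snd p)"
  have "cell_target A f p = (\<lambda>x. x + ?c) -` A \<inter>
      {x. \<forall>n'. \<not> (nth_renewal (fst p) f < nth_renewal n' f \<and> nth_renewal n' f \<le> ?c + x)}"
    unfolding cell_target_def by (simp add: Int_def vimage_def add.commute)
  then show ?thesis using vimage_translate_borel(1)[OF assms] borel_no_renewal_before by simp
qed

text \<open>
  The cells, cut off at the next renewal, partition the line: each time has a last renewal before it.
\<close>

lemma cell_target_measure_sums:
  assumes f: "continuous_on UNIV f" "regular f" and A: "A \<in> sets borel" "emeasure lborel A < \<infinity>"
  shows "(\<lambda>q. measure lborel (cell_target A f (prod_decode q) \<inter> {0..<1})) sums measure lborel A"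
proof -
  let ?T = "\<lambda>p. nth_renewal (fst p) f + real (snd p)"
  define D where "D p = {y. ?T p \<le> y \<and> y < ?T p + 1 \<and> fresh f (nth_renewal (fst p) f) y}" for p
  have D_eq: "cell_target A f p \<inter> {0..<1} = (\<lambda>x. x + ?T p) -` (A \<inter> D p)" for p
    by (auto simp: cell_target_def D_def fresh_nth[OF f] ac_simps)
  have D_borel: "D p \<in> sets borel" for p
  proof -
    have "D p = {?T p..<?T p + 1} \<inter> {y. \<forall>n'. \<not> (nth_renewal (fst p) f < nth_renewal n' f \<and> nth_renewal n' f \<le> 0 + y)}"
      by (auto simp: D_def fresh_nth[OF f])
    then show ?thesis using borel_no_renewal_before by simp
  qed
  have before: False if "nth_renewal n f < nth_renewal n' f" "y \<in> D (n, k)" "y \<in> D (n', k')" for n n' k k' y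
  proof -
    have "nth_renewal n' f \<le> y" using that(3) by (auto simp: D_def)
    then show False using that(1,2) renewal_nth[OF f, of n'] by (auto simp: D_def fresh_def)
  qed
  have disj: "disjoint_family (\<lambda>q. A \<inter> D (prod_decode q))"
    unfolding disjoint_family_on_def
  proof (intro ballI impI)
    fix q q' :: nat assume "q \<noteq> q'"
    then have ne: "prod_decode q \<noteq> prod_decode q'" by (simp add: prod_decode_eq)
    obtain n k n' k' where p: "prod_decode q = (n, k)" "prod_decode q' = (n', k')" by (metis surj_pair)
    have False if y: "y \<in> D (n, k)" "y \<in> D (n', k')" for y
    proof (cases "n = n'")
      case True
      then have "k \<noteq> k'" using ne p by simp
      then show False using y True by (auto simp: D_def)
    next
      case False
      then have "nth_renewal n f \<noteq> nth_renewal n' f" using nth_renewal_inj[OF f] by blast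
      then show False using before[of n n' y k k'] before[of n' n y k' k] y by linarith
    qed
    then show "(A \<inter> D (prod_decode q)) \<inter> (A \<inter> D (prod_decode q')) = {}" unfolding p by blast
  qed
  have cover: "(\<Union>q. A \<inter> D (prod_decode q)) = A"
  proof -
    have "\<exists>q. y \<in> D (prod_decode q)" for y
    proof -
      obtain T where T: "T \<le> y" "renewal f T" "fresh f T y" using last_renewal[OF f] by blast
      obtain n where n: "T = nth_renewal n f" using T(2) renewal_iff_nth[OF f] by blast
      define k where "k = nat \<lfloor>y - T\<rfloor>"
      have "0 \<le> \<lfloor>y - T\<rfloor>" using T(1) by simp
      then have "real k = of_int \<lfloor>y - T\<rfloor>" by (simp add: k_def)
      then have "real k \<le> y - T" "y - T < real k + 1" by linarith+
      then have "y \<in> D (n, k)" using T(3) n by (simp add: D_def)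
      then have "y \<in> D (prod_decode (prod_encode (n, k)))" by simp
      then show ?thesis by blast
    qed
    then show ?thesis by blast
  qed
  have "(\<lambda>q. measure lborel (A \<inter> D (prod_decode q))) sums measure lborel (\<Union>q. A \<inter> D (prod_decode q))"
  proof (rule measure_UNION[OF _ disj])
    show "range (\<lambda>q. A \<inter> D (prod_decode q)) \<subseteq> sets lborel"
      using sets.Int[OF A(1) D_borel] by (simp add: image_subset_iff del: split_paired_All)
    show "emeasure lborel (\<Union>q. A \<inter> D (prod_decode q)) \<noteq> \<infinity>" unfolding cover using A(2) by simp
  qed
  moreover have "measure lborel (cell_target A f p \<inter> {0..<1}) = measure lborel (A \<inter> D p)" for p
    unfolding D_eq using vimage_translate_borel(2)[of "A \<inter> D p" "?T p"] A D_borel by (simp add: measure_def)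
  ultimately show ?thesis unfolding cover by simp
qed

lemma measurable_void_given_bits:
  assumes A: "A \<in> sets borel"
  shows "Measurable.pred (Inv \<Otimes>\<^sub>M coins) (\<lambda>x. void_given_bits l A (fst x) (snd x))"
proof -
  let ?M = "Inv \<Otimes>\<^sub>M (coins :: (nat \<times> nat \<Rightarrow> bool) measure)"
  have general: "Measurable.pred ?M (\<lambda>x. \<forall>n k i. poisson_cdf l i \<le> U n k 0 x \<longrightarrow> U n k (Suc i) x < 1 \<longrightarrow>
     (\<forall>n'. \<not> (T n x < T n' x \<and> T n' x \<le> T n x + real k + U n k (Suc i) x)) \<longrightarrow> T n x + real k + U n k (Suc i) x \<notin> A)"
    if T: "\<And>n. T n \<in> borel_measurable ?M" and U: "\<And>n k i. U n k i \<in> borel_measurable ?M"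
    for T :: "nat \<Rightarrow> _ \<Rightarrow> real" and U :: "nat \<Rightarrow> nat \<Rightarrow> nat \<Rightarrow> _ \<Rightarrow> real"
  proof -
    have V: "(\<lambda>x. T n x + real k + U n k i x) \<in> borel_measurable ?M" for n k i
      by (intro borel_measurable_add T U borel_measurable_const)
    have 1: "Measurable.pred ?M (\<lambda>x. poisson_cdf l i \<le> U n k 0 x)" for n k i
      unfolding pred_def by (rule borel_measurable_le[OF borel_measurable_const U])
    have 2: "Measurable.pred ?M (\<lambda>x. U n k (Suc i) x < 1)" for n k i
      by (rule borel_measurable_pred_less[OF U borel_measurable_const])
    have 3: "Measurable.pred ?M (\<lambda>x. T n x < T n' x)" for n n' by (rule borel_measurable_pred_less[OF T T])
    have 4: "Measurable.pred ?M (\<lambda>x. T n' x \<le> T n x + real k + U n k (Suc i) x)" for n n' k i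
      unfolding pred_def by (rule borel_measurable_le[OF T V])
    have 5: "Measurable.pred ?M (\<lambda>x. T n x + real k + U n k (Suc i) x \<in> A)" for n k i
      using measurable_sets[OF V[of n k "Suc i"] A] by (simp add: pred_def vimage_def Int_def conj_commute)
    show ?thesis
      by (rule pred_intros_countable(1) pred_intros_logic(4) pred_intros_logic(2) pred_intros_logic(3) 1 2 3 4 5)+
  qed
  have T: "(\<lambda>x. nth_renewal n (fst x)) \<in> borel_measurable ?M" for n
  proof (rule measurable_compose[OF measurable_fst])
    show "nth_renewal n \<in> borel_measurable Inv" by (rule measurable_InvI[OF measurable_nth_renewal]) simp
  qed
  have U: "(\<lambda>x. uniforms (\<lambda>j. snd x (n, j)) k i) \<in> borel_measurable ?M" for n k i
    by (rule measurable_compose[OF measurable_snd measurable_uniforms_coins])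
  show ?thesis unfolding void_given_bits_def by (rule general[OF T U])
qed

text \<open>
  The signs at the probes are fair coins independent of the invariant events, so the probability is
  the average over the path of the void probability for independent coins. The latter does not depend on the
  path: the measures of the targets add up to that of \<open>A\<close> for almost every path.
\<close>

theorem point_map_void_probability:
  assumes l: "0 < l" and A: "A \<in> sets borel" "emeasure lborel A < \<infinity>"
  shows "emeasure K {f\<in>paths a b. points l f \<inter> A = {}} = ennreal (exp (- (l * measure lborel A)))"
proof -
  interpret K: prob_space K by (rule prob_space_K)
  let ?C = "coins :: (nat \<times> nat \<Rightarrow> bool) measure"
  interpret C: prob_space ?C by (rule prob_space_coins)
  let ?I = "distr K Inv (\<lambda>f. f)"
  interpret I: prob_space ?I by (rule K.prob_space_distr) simp
  have good: "AE f in K. (\<forall>p. f (probe p f) \<noteq> mid) \<and> (\<forall>p p'. p \<noteq> p' \<longrightarrow> hits f (min (probe p f) (probe p' f)) (max (probe p f) (probe p' f)))"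
    using AE_regular AE_space
  proof eventually_elim
    case (elim f)
    then have "continuous_on UNIV f" by (simp add: path_continuous)
    then show ?case using elim(1) probe_nonzero probes_apart unfolding apart_def by blast
  qed
  have law: "distr K (Inv \<Otimes>\<^sub>M ?C) (\<lambda>f. (f, sign_at probe f)) = ?I \<Otimes>\<^sub>M ?C"
    and sm: "sign_at probe \<in> K \<rightarrow>\<^sub>M ?C"
    using signs_are_fair_coins[of probe, OF measurable_probe _ good] measurable_sign_at[of probe, OF measurable_probe _ good]
    by simp_all
  let ?H = "{x \<in> space (Inv \<Otimes>\<^sub>M ?C). void_given_bits l A (fst x) (snd x)}"
  have H: "?H \<in> sets (Inv \<Otimes>\<^sub>M ?C)" using measurable_void_given_bits[OF A(1), of l] by (simp add: pred_def)
  have H': "?H \<in> sets (?I \<Otimes>\<^sub>M ?C)" using H by (simp cong: sets_pair_measure_cong)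
  have pm: "(\<lambda>f. (f, sign_at probe f)) \<in> K \<rightarrow>\<^sub>M Inv \<Otimes>\<^sub>M ?C" using sm by measurable
  have "emeasure K {f\<in>paths a b. points l f \<inter> A = {}} = emeasure K ((\<lambda>f. (f, sign_at probe f)) -` ?H \<inter> space K)"
  proof (rule emeasure_eq_AE)
    show "AE f in K. f \<in> {f\<in>paths a b. points l f \<inter> A = {}} \<longleftrightarrow> f \<in> (\<lambda>f. (f, sign_at probe f)) -` ?H \<inter> space K"
      using AE_regular AE_space
    proof eventually_elim
      case (elim f)
      then have "continuous_on UNIV f" by (simp add: path_continuous)
      from points_void_iff[OF this elim(1), of l A] elim(2) show ?case by (auto simp: space_pair_measure)
    qed
    show "{f\<in>paths a b. points l f \<inter> A = {}} \<in> sets K"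
      using measurable_points_void[OF A(1), where a = a and b = b and l = l] by (simp add: pred_def)
    show "(\<lambda>f. (f, sign_at probe f)) -` ?H \<inter> space K \<in> sets K" using pm H by (rule measurable_sets)
  qed
  also have "\<dots> = emeasure (distr K (Inv \<Otimes>\<^sub>M ?C) (\<lambda>f. (f, sign_at probe f))) ?H"
    using pm H by (rule emeasure_distr[symmetric])
  also have "\<dots> = (\<integral>\<^sup>+f. emeasure ?C (Pair f -` ?H) \<partial>?I)"
    unfolding law using H' by (rule C.emeasure_pair_measure_alt)
  also have "\<dots> = (\<integral>\<^sup>+f. ennreal (exp (- (l * measure lborel A))) \<partial>?I)"
  proof (rule nn_integral_cong_AE)
    have "AE f in K. emeasure ?C (Pair f -` ?H) = ennreal (exp (- (l * measure lborel A)))"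
      using AE_regular AE_space
    proof eventually_elim
      case (elim f)
      then have f: "continuous_on UNIV f" "regular f" by (simp_all add: path_continuous)
      have "Pair f -` ?H = {\<epsilon>. \<forall>n k. cell_points l (uniforms (\<lambda>j. \<epsilon> (n, j)) k) \<inter> cell_target A f (n, k) = {}}"
        using elim(2) by (auto simp: space_pair_measure void_given_bits_iff_cells)
      then show ?case
        using all_cells_void_probability[OF l borel_cell_target[OF A(1)] cell_target_measure_sums[OF f A]] by simp
    qed
    moreover have "{f \<in> space Inv. emeasure ?C (Pair f -` ?H) = ennreal (exp (- (l * measure lborel A)))} \<in> sets Inv"
    proof -
      have [measurable]: "(\<lambda>f. emeasure ?C (Pair f -` ?H)) \<in> borel_measurable Inv"
        by (rule C.measurable_emeasure_Pair[OF H])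
      show ?thesis by measurable
    qed
    ultimately show "AE f in ?I. emeasure ?C (Pair f -` ?H) = ennreal (exp (- (l * measure lborel A)))"
      by (subst AE_distr_iff) auto
  qed
  also have "\<dots> = ennreal (exp (- (l * measure lborel A)))" using I.emeasure_space_1 by simp
  finally show ?thesis .
qed

lemma mp_flow_K: "mp_flow K path_shift"
  unfolding mp_flow_def
proof (intro conjI allI ballI)
  show "prob_space K" by (rule prob_space_K)
  show "path_shift t \<in> K \<rightarrow>\<^sub>M K" "distr K K (path_shift t) = K" for t
    by (simp_all add: path_shift_preserves)
  show "path_shift 0 f = f" for f by (simp add: path_shift_def)
  show "path_shift (s + t) f = path_shift s (path_shift t f)" for s t f
    by (simp add: path_shift_def fun_eq_iff algebra_simps)
qed

theorem factor_map_point_map: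
  assumes l: "0 < l" and P: "poisson_point_process l N P"
  shows "factor_map K path_shift (distr N point_measure_space P) point_shift (point_map l)"
proof -
  let ?Q = "distr N point_measure_space P"
  interpret K: prob_space K by (rule prob_space_K)
  have m: "point_map l \<in> K \<rightarrow>\<^sub>M point_measure_space"
    using measurable_point_map[of l a b] by (simp cong: measurable_cong_sets)
  then have m': "point_map l \<in> K \<rightarrow>\<^sub>M ?Q" by (simp cong: measurable_cong_sets)
  have "distr K ?Q (point_map l) = ?Q"
  proof (rule point_process_law_eqI)
    show "prob_space (distr K ?Q (point_map l))" using m' by (rule K.prob_space_distr)
    show "prob_space ?Q"
      using P unfolding poisson_point_process_def by (auto intro: prob_space.prob_space_distr)
    fix A :: "real set" assume A: "A \<in> sets borel" "emeasure lborel A < \<infinity>"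
    have pre: "point_map l -` {m. simple_point_measure m \<and> emeasure m A = 0} \<inter> space K = {f\<in>paths a b. points l f \<inter> A = {}}"
      using simple_point_map[OF path_continuous] point_map_void[OF A(1)] by auto
    have "emeasure (distr K ?Q (point_map l)) {m. simple_point_measure m \<and> emeasure m A = 0} =
        emeasure K (point_map l -` {m. simple_point_measure m \<and> emeasure m A = 0} \<inter> space K)"
      using m' void_event_in_sets[OF A(1)] by (intro emeasure_distr) auto
    also have "\<dots> = ennreal (exp (- (l * measure lborel A)))"
      unfolding pre by (rule point_map_void_probability[OF l A])
    finally show "emeasure (distr K ?Q (point_map l)) {m. simple_point_measure m \<and> emeasure m A = 0} =
        emeasure ?Q {m. simple_point_measure m \<and> emeasure m A = 0}"
      using poisson_void_probability[OF P A] by simp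
  qed simp_all
  then show ?thesis unfolding factor_map_def
    using mp_flow_K mp_flow_poisson[OF P] m' point_map_shift by auto
qed

lemma points_agree:
  assumes f: "f \<in> paths a b" "f' \<in> paths a b" and r: "returns f (- real n) 0"
    and agree: "\<And>x. \<bar>x\<bar> < real n + 2 \<Longrightarrow> f x = f' x"
  shows "points l f \<inter> {0<..<1} = points l f' \<inter> {0<..<1}"
proof -
  obtain r where r: "0 \<le> r" "- real n + r \<le> 0" "big f (- real n + r)" "hits f (- real n + r) 0"
    using r unfolding returns_def by blast
  let ?q = "- real n + r"
  have ag: "f x = f' x" if "?q \<le> x" "x < 2" for x using that r(1) by (intro agree) (simp add: abs_less_iff)
  have big': "big f' ?q" using r(2,3) ag[of ?q] by (simp add: big_def)
  obtain z where z: "?q \<le> z" "z \<le> 0" "f z = mid" using r(4) by (auto simp: hits_def)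
  then have hits': "hits f' ?q 0" using ag[of z] by (intro hitsI[of ?q z 0]) auto
  have "p \<in> points l f'" if "p \<in> points l f" "0 < p" "p < 1" for p
    using points_local[OF path_continuous[OF f(1)] r(3,4) ag that] .
  moreover have "p \<in> points l f" if "p \<in> points l f'" "0 < p" "p < 1" for p
    using points_local[OF path_continuous[OF f(2)] big' hits' ag[symmetric] that] .
  ultimately show ?thesis by auto
qed

text \<open>
  The window reaches back to a large excursion that has ended by time 0, and forward to time 2.
\<close>

theorem finitary_point_map: "finitary K (point_map l)"
proof -
  define w :: "(real \<Rightarrow> real) \<Rightarrow> enat" where
    "w f = (if \<exists>n::nat. returns f (- real n) 0 then enat ((LEAST n::nat. returns f (- real n) 0) + 2) else \<infinity>)" for f
  have "w \<in> path_space a b \<rightarrow>\<^sub>M count_space UNIV" unfolding w_def by measurable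
  then have wm: "w \<in> K \<rightarrow>\<^sub>M count_space UNIV" by (simp cong: measurable_cong_sets)
  have "AE f in K. w f < \<infinity>"
    using AE_returns_backward[of 0] by eventually_elim (auto simp: w_def)
  moreover have "density (point_map l f) (indicator {0<..<1}) = density (point_map l f') (indicator {0<..<1})"
    if f: "f \<in> space K" "f' \<in> space K" and agree: "\<forall>x. ereal \<bar>x\<bar> < ereal_of_enat (w f) \<longrightarrow> f x = f' x" for f f'
  proof -
    have eq: "points l f \<inter> {0<..<1} = points l f' \<inter> {0<..<1}"
    proof (cases "\<exists>n::nat. returns f (- real n) 0")
      case False
      then have "f = f'" using agree by (auto simp: w_def fun_eq_iff)
      then show ?thesis by simp
    next
      case True
      define n where "n = (LEAST n::nat. returns f (- real n) 0)"
      have "returns f (- real n) 0" unfolding n_def using True by (rule LeastI_ex)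
      moreover have "w f = enat (n + 2)" using True by (simp add: w_def n_def)
      then have "f x = f' x" if "\<bar>x\<bar> < real n + 2" for x using agree that by simp
      ultimately show ?thesis using f points_agree[of f f' n] by simp
    qed
    have d: "emeasure (density (point_map l g) (indicator {0<..<1})) A = emeasure (count_space UNIV) (A \<inter> (points l g \<inter> {0<..<1}))"
      if A: "A \<in> sets borel" for A g
    proof -
      have s: "sets (point_map l g) = sets borel" by (simp add: point_map_def)
      have "emeasure (density (point_map l g) (indicator {0<..<1})) A = (\<integral>\<^sup>+x. indicator {0<..<1} x * indicator A x \<partial>point_map l g)"
        using A s by (intro emeasure_density) (auto cong: measurable_cong_sets)
      also have "\<dots> = (\<integral>\<^sup>+x. indicator (A \<inter> {0<..<1}) x \<partial>point_map l g)"
        by (intro nn_integral_cong) (auto split: split_indicator)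
      also have "\<dots> = emeasure (point_map l g) (A \<inter> {0<..<1})" using A s by (intro nn_integral_indicator) auto
      also have "\<dots> = emeasure (count_space (points l g)) (A \<inter> (points l g \<inter> {0<..<1}))"
        using A by (simp add: emeasure_point_map Int_ac)
      also have "\<dots> = emeasure (count_space UNIV) (A \<inter> (points l g \<inter> {0<..<1}))"
        by (subst (1 2) emeasure_count_space) auto
      finally show ?thesis .
    qed
    show ?thesis
      by (rule measure_eqI) (simp_all add: point_map_def[symmetric] d eq, simp_all add: point_map_def d[unfolded point_map_def] eq)
  qed
  ultimately show ?thesis unfolding finitary_def using wm by blast
qed

end

theorem theorem4:
  fixes a b l :: real
    and M :: "'a measure" and B :: "real \<Rightarrow> 'a \<Rightarrow> real"
    and N :: "'b measure" and P :: "'b \<Rightarrow> real measure"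
  assumes "a < b" and "l > 0"
    and "reflected_brownian_motion a b M B"
    and "stationary_process M B"
    and "poisson_point_process l N P"
  shows "\<exists>\<phi>. factor_map (path_law a b M B) path_shift
                 (distr N point_measure_space P) point_shift \<phi> \<and>
             finitary (path_law a b M B) \<phi>"
proof -
  interpret stationary_reflected_bm a b M B
    using assms by unfold_locales
  show ?thesis
    using factor_map_point_map[OF assms(2,5)] finitary_point_map[of l] by blast
qed

end
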